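(* Let $(M,g)$ be a compact orientable Riemannian manifold without boundary, and let $(N,h,\xi,\lambda)$ be a nontrivial Ricci soliton with $\operatorname{Ric}^N>\lambda h$ or $\operatorname{Ric}^N<\lambda h$. Then any harmonic map $\varphi:(M,g)\to(N,h)$ is constant.
   Context: Manifolds are smooth and connected; maps, vector fields and functions are smooth. A Ricci soliton $(N,h,\xi,\lambda)$ is a Riemannian manifold $(N,h)$ with a smooth vector field $\xi$ and a constant $\lambda\in\mathbb{R}$ such that $\operatorname{Ric}^N+\frac12\mathcal{L}_\xi h=\lambda h$, where $\operatorname{Ric}^N$ is the Ricci tensor of $(N,h)$ and $\mathcal{L}_\xi h$ is the Lie derivative of $h$ along $\xi$. It is nontrivial if $(N,h)$ is not Einstein. The condition $\operatorname{Ric}^N>\lambda h$ (resp. $\operatorname{Ric}^N<\lambda h$) means $\operatorname{Ric}^N(v,v)>\lambda h(v,v)$ (resp. $\operatorname{Ric}^N(v,v)<\lambda h(v,v)$) for every $p\in N$ and every $v\in T_pN\setminus\{0\}$. For a smooth map $\varphi:(M,g)\to(N,h)$, the tension field is $\tau(\varphi)=\operatorname{trace}_g\nabla d\varphi=\sum_i\big(\nabla^{\varphi}_{e_i}d\varphi(e_i)-d\varphi(\nabla^{M}_{e_i}e_i)\big)$, where $\{e_i\}$ is a local orthonormal frame of $(M,g)$, $\nabla^M$ is the Levi-Civita connection of $g$ and $\nabla^\varphi$ is the pull-back connection on $\varphi^{-1}TN$. The map $\varphi$ is harmonic if $\tau(\varphi)=0$. *)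

theory Defs
  imports "HOL-Analysis.Analysis"
begin

text \<open>Only meant for open \<open>S\<close>: \<open>f\<close> is $C^{k+1}$ iff it is differentiable and all its directional
  derivatives are $C^k$.\<close>

fun Ck_on :: "nat \<Rightarrow> 'a::real_normed_vector set \<Rightarrow> ('a \<Rightarrow> 'b::real_normed_vector) \<Rightarrow> bool" where
  "Ck_on 0 S f \<longleftrightarrow> continuous_on S f"
| "Ck_on (Suc k) S f \<longleftrightarrow> (\<forall>x\<in>S. f differentiable (at x)) \<and>
     (\<forall>v. Ck_on k S (\<lambda>x. frechet_derivative f (at x) v))"

definition smooth_on :: "'a::real_normed_vector set \<Rightarrow> ('a \<Rightarrow> 'b::real_normed_vector) \<Rightarrow> bool" where
  "smooth_on S f \<longleftrightarrow> (\<forall>k. Ck_on k S f)"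

text \<open>A chart is a pair of an open domain and a coordinate map; the values of the coordinate map
  outside the domain are irrelevant. The manifold is the whole type; its smooth structure is
  the one generated by an atlas, which need not be maximal. All charts have open images in
  \<^typ>\<open>real ^ 'n\<close>, so manifolds have no boundary.\<close>

type_synonym ('m, 'n) chart = "'m set \<times> ('m \<Rightarrow> real ^ 'n)"

definition chart_inv :: "('m, 'n::finite) chart \<Rightarrow> real ^ 'n \<Rightarrow> 'm" where
  "chart_inv c = inv_into (fst c) (snd c)"

definition transition :: "('m, 'n::finite) chart \<Rightarrow> ('m, 'n) chart \<Rightarrow> real ^ 'n \<Rightarrow> real ^ 'n" where
  "transition c d = snd d \<circ> chart_inv c"

definition is_chart :: "('m::topological_space, 'n::finite) chart \<Rightarrow> bool" where
  "is_chart c \<longleftrightarrow> open (fst c) \<and> open (snd c ` fst c) \<and>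
     homeomorphism (fst c) (snd c ` fst c) (snd c) (chart_inv c)"

definition smooth_atlas ::
  "('m::{second_countable_topology, t2_space}, 'n::finite) chart set \<Rightarrow> bool" where
  "smooth_atlas A \<longleftrightarrow> (\<forall>c\<in>A. is_chart c) \<and> (\<Union>c\<in>A. fst c) = UNIV \<and>
     (\<forall>c\<in>A. \<forall>d\<in>A. smooth_on (snd c ` (fst c \<inter> fst d)) (transition c d))"

definition smooth_manifold ::
  "('m::{second_countable_topology, t2_space}, 'n::finite) chart set \<Rightarrow> bool" where
  "smooth_manifold A \<longleftrightarrow> smooth_atlas A \<and> connected (UNIV :: 'm set)"

definition orientable ::
  "('m::{second_countable_topology, t2_space}, 'n::finite) chart set \<Rightarrow> bool" where
  "orientable A \<longleftrightarrow> (\<exists>C. smooth_atlas C \<and> smooth_atlas (A \<union> C) \<and>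
     (\<forall>c\<in>C. \<forall>d\<in>C. \<forall>x\<in>snd c ` (fst c \<inter> fst d).
        det (matrix (frechet_derivative (transition c d) (at x))) > 0))"

definition map_in_charts ::
  "('m, 'a::finite) chart \<Rightarrow> ('n, 'b::finite) chart \<Rightarrow> ('m \<Rightarrow> 'n) \<Rightarrow> real ^ 'a \<Rightarrow> real ^ 'b" where
  "map_in_charts c d \<phi> = snd d \<circ> \<phi> \<circ> chart_inv c"

definition smooth_map ::
  "('m::topological_space, 'a::finite) chart set \<Rightarrow> ('n::topological_space, 'b::finite) chart set
    \<Rightarrow> ('m \<Rightarrow> 'n) \<Rightarrow> bool" where
  "smooth_map A B \<phi> \<longleftrightarrow> continuous_on UNIV \<phi> \<and>
     (\<forall>c\<in>A. \<forall>d\<in>B. smooth_on (snd c ` (fst c \<inter> \<phi> -` fst d)) (map_in_charts c d \<phi>))"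

text \<open>A tensor field is given by its components in every chart of the atlas, which have to obey the
  transformation law on overlaps. A tangent vector at the point with coordinates \<open>x\<close> in a chart
  is given by its components, an arbitrary element of \<^typ>\<open>real ^ 'n\<close>.\<close>

type_synonym ('m, 'n) vfield = "('m, 'n) chart \<Rightarrow> real ^ 'n \<Rightarrow> real ^ 'n"
type_synonym ('m, 'n) metric = "('m, 'n) chart \<Rightarrow> real ^ 'n \<Rightarrow> real ^ 'n ^ 'n"

definition bilin :: "real ^ 'n ^ 'n \<Rightarrow> real ^ 'n \<Rightarrow> real ^ 'n \<Rightarrow> real" where
  "bilin G v w = v \<bullet> (G *v w)"

definition smooth_vector_field :: "('m, 'n::finite) chart set \<Rightarrow> ('m, 'n) vfield \<Rightarrow> bool" where
  "smooth_vector_field A \<xi> \<longleftrightarrow>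
     (\<forall>c\<in>A. smooth_on (snd c ` fst c) (\<xi> c)) \<and>
     (\<forall>c\<in>A. \<forall>d\<in>A. \<forall>x\<in>snd c ` (fst c \<inter> fst d).
        \<xi> d (transition c d x) = frechet_derivative (transition c d) (at x) (\<xi> c x))"

definition riemannian_metric :: "('m, 'n::finite) chart set \<Rightarrow> ('m, 'n) metric \<Rightarrow> bool" where
  "riemannian_metric A g \<longleftrightarrow>
     (\<forall>c\<in>A. smooth_on (snd c ` fst c) (g c)) \<and>
     (\<forall>c\<in>A. \<forall>x\<in>snd c ` fst c. transpose (g c x) = g c x \<and> (\<forall>v. v \<noteq> 0 \<longrightarrow> bilin (g c x) v v > 0)) \<and>
     (\<forall>c\<in>A. \<forall>d\<in>A. \<forall>x\<in>snd c ` (fst c \<inter> fst d). \<forall>v w.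
        bilin (g d (transition c d x))
          (frechet_derivative (transition c d) (at x) v)
          (frechet_derivative (transition c d) (at x) w) = bilin (g c x) v w)"

definition riemannian_manifold ::
  "('m::{second_countable_topology, t2_space}, 'n::finite) chart set \<Rightarrow> ('m, 'n) metric \<Rightarrow> bool" where
  "riemannian_manifold A g \<longleftrightarrow> smooth_manifold A \<and> riemannian_metric A g"

text \<open>Here \<open>G\<close> is the matrix of the metric as a function on an open subset of \<^typ>\<open>real ^ 'n\<close>, and
  vector fields are functions \<^typ>\<open>real ^ 'n \<Rightarrow> real ^ 'n\<close> defined near the point considered.\<close>

definition coord_field :: "'n \<Rightarrow> real ^ 'n \<Rightarrow> real ^ 'n::finite" where
  "coord_field i = (\<lambda>_. axis i 1)"

definition bracket ::
  "(real ^ 'n \<Rightarrow> real ^ 'n) \<Rightarrow> (real ^ 'n \<Rightarrow> real ^ 'n) \<Rightarrow> real ^ 'n \<Rightarrow> real ^ 'n::finite" where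
  "bracket X Y = (\<lambda>x. frechet_derivative Y (at x) (X x) - frechet_derivative X (at x) (Y x))"

text \<open>Christoffel symbols $\Gamma^k_{ij} = \frac12 g^{kl}(\partial_i g_{jl} + \partial_j g_{il} -
  \partial_l g_{ij})$ of the Levi-Civita connection, the torsion-free metric connection (see
  \<open>levi_civita_torsion_free\<close> and \<open>levi_civita_metric\<close> below).\<close>

definition christoffel ::
  "(real ^ 'n \<Rightarrow> real ^ 'n ^ 'n) \<Rightarrow> real ^ 'n \<Rightarrow> 'n \<Rightarrow> 'n \<Rightarrow> 'n::finite \<Rightarrow> real" where
  "christoffel G x k i j = (\<Sum>l\<in>UNIV. matrix_inv (G x) $ k $ l *
     (frechet_derivative G (at x) (axis i 1) $ j $ l
      + frechet_derivative G (at x) (axis j 1) $ i $ l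
      - frechet_derivative G (at x) (axis l 1) $ i $ j)) / 2"

definition christoffel_form ::
  "(real ^ 'n \<Rightarrow> real ^ 'n ^ 'n) \<Rightarrow> real ^ 'n \<Rightarrow> real ^ 'n \<Rightarrow> real ^ 'n \<Rightarrow> real ^ 'n::finite" where
  "christoffel_form G x u v = (\<chi> k. \<Sum>i\<in>UNIV. \<Sum>j\<in>UNIV. christoffel G x k i j * u $ i * v $ j)"

definition levi_civita ::
  "(real ^ 'n \<Rightarrow> real ^ 'n ^ 'n) \<Rightarrow> (real ^ 'n \<Rightarrow> real ^ 'n) \<Rightarrow> (real ^ 'n \<Rightarrow> real ^ 'n)
    \<Rightarrow> real ^ 'n \<Rightarrow> real ^ 'n::finite" where
  "levi_civita G X Y = (\<lambda>x. frechet_derivative Y (at x) (X x) + christoffel_form G x (X x) (Y x))"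

definition curvature ::
  "(real ^ 'n \<Rightarrow> real ^ 'n ^ 'n) \<Rightarrow> (real ^ 'n \<Rightarrow> real ^ 'n) \<Rightarrow> (real ^ 'n \<Rightarrow> real ^ 'n)
    \<Rightarrow> (real ^ 'n \<Rightarrow> real ^ 'n) \<Rightarrow> real ^ 'n \<Rightarrow> real ^ 'n::finite" where
  "curvature G X Y Z = (\<lambda>x. levi_civita G X (levi_civita G Y Z) x
     - levi_civita G Y (levi_civita G X Z) x - levi_civita G (bracket X Y) Z x)"

text \<open>$\mathrm{Ric}(v,w)$ is the trace of $u \mapsto R(u,v)w$ (positive on round spheres); vectors at
  \<open>x\<close> are extended to vector fields with constant components.\<close>

definition ricci ::
  "(real ^ 'n \<Rightarrow> real ^ 'n ^ 'n) \<Rightarrow> real ^ 'n \<Rightarrow> real ^ 'n \<Rightarrow> real ^ 'n::finite \<Rightarrow> real" where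
  "ricci G x v w = (\<Sum>i\<in>UNIV. curvature G (coord_field i) (\<lambda>_. v) (\<lambda>_. w) x $ i)"

definition lie_derivative ::
  "(real ^ 'n \<Rightarrow> real ^ 'n) \<Rightarrow> (real ^ 'n \<Rightarrow> real ^ 'n ^ 'n) \<Rightarrow> (real ^ 'n \<Rightarrow> real ^ 'n)
    \<Rightarrow> (real ^ 'n \<Rightarrow> real ^ 'n::finite) \<Rightarrow> real ^ 'n \<Rightarrow> real" where
  "lie_derivative \<xi> G X Y = (\<lambda>x. frechet_derivative (\<lambda>y. bilin (G y) (X y) (Y y)) (at x) (\<xi> x)
     - bilin (G x) (bracket \<xi> X x) (Y x) - bilin (G x) (X x) (bracket \<xi> Y x))"

text \<open>The pull-back connection of \<open>H\<close> along \<open>f\<close>, acting on a vector field \<open>V\<close> along \<open>f\<close>.\<close>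

definition pullback_connection ::
  "(real ^ 'b \<Rightarrow> real ^ 'b ^ 'b) \<Rightarrow> (real ^ 'a \<Rightarrow> real ^ 'b) \<Rightarrow> (real ^ 'a \<Rightarrow> real ^ 'a)
    \<Rightarrow> (real ^ 'a \<Rightarrow> real ^ 'b) \<Rightarrow> real ^ 'a::finite \<Rightarrow> real ^ 'b::finite" where
  "pullback_connection H f X V = (\<lambda>x. frechet_derivative V (at x) (X x)
     + christoffel_form H (f x) (frechet_derivative f (at x) (X x)) (V x))"

definition second_fundamental_form ::
  "(real ^ 'a \<Rightarrow> real ^ 'a ^ 'a) \<Rightarrow> (real ^ 'b \<Rightarrow> real ^ 'b ^ 'b) \<Rightarrow> (real ^ 'a \<Rightarrow> real ^ 'b)
    \<Rightarrow> (real ^ 'a \<Rightarrow> real ^ 'a) \<Rightarrow> (real ^ 'a \<Rightarrow> real ^ 'a) \<Rightarrow> real ^ 'a::finite \<Rightarrow> real ^ 'b::finite" where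
  "second_fundamental_form G H f X Y = (\<lambda>x.
     pullback_connection H f X (\<lambda>y. frechet_derivative f (at y) (Y y)) x
     - frechet_derivative f (at x) (levi_civita G X Y x))"

text \<open>$\mathrm{trace}_g \nabla df = g^{ij}\,\nabla df(\partial_i,\partial_j)$; that this is the sum over an
  orthonormal frame is shown in \<open>tension_eq_frame_sum\<close> below.\<close>

definition tension ::
  "(real ^ 'a \<Rightarrow> real ^ 'a ^ 'a) \<Rightarrow> (real ^ 'b \<Rightarrow> real ^ 'b ^ 'b) \<Rightarrow> (real ^ 'a \<Rightarrow> real ^ 'b)
    \<Rightarrow> real ^ 'a::finite \<Rightarrow> real ^ 'b::finite" where
  "tension G H f = (\<lambda>x. \<Sum>i\<in>UNIV. \<Sum>j\<in>UNIV. matrix_inv (G x) $ i $ j *\<^sub>R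
     second_fundamental_form G H f (coord_field i) (coord_field j) x)"

definition harmonic_map ::
  "('m::topological_space, 'a::finite) chart set \<Rightarrow> ('m, 'a) metric
    \<Rightarrow> ('n::topological_space, 'b::finite) chart set \<Rightarrow> ('n, 'b) metric \<Rightarrow> ('m \<Rightarrow> 'n) \<Rightarrow> bool" where
  "harmonic_map A g B h \<phi> \<longleftrightarrow> smooth_map A B \<phi> \<and>
     (\<forall>c\<in>A. \<forall>d\<in>B. \<forall>x\<in>snd c ` (fst c \<inter> \<phi> -` fst d). tension (g c) (h d) (map_in_charts c d \<phi>) x = 0)"

definition einstein :: "('n, 'b::finite) chart set \<Rightarrow> ('n, 'b) metric \<Rightarrow> bool" where
  "einstein B h \<longleftrightarrow> (\<exists>\<mu>. \<forall>d\<in>B. \<forall>y\<in>snd d ` fst d. \<forall>v w. ricci (h d) y v w = \<mu> * bilin (h d y) v w)"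

definition ricci_soliton ::
  "('n::{second_countable_topology, t2_space}, 'b::finite) chart set \<Rightarrow> ('n, 'b) metric
    \<Rightarrow> ('n, 'b) vfield \<Rightarrow> real \<Rightarrow> bool" where
  "ricci_soliton B h \<xi> \<Lambda> \<longleftrightarrow> riemannian_manifold B h \<and> smooth_vector_field B \<xi> \<and>
     (\<forall>d\<in>B. \<forall>y\<in>snd d ` fst d. \<forall>v w.
        ricci (h d) y v w + 1 / 2 * lie_derivative (\<xi> d) (h d) (\<lambda>_. v) (\<lambda>_. w) y
        = \<Lambda> * bilin (h d y) v w)"

definition nontrivial_ricci_soliton ::
  "('n::{second_countable_topology, t2_space}, 'b::finite) chart set \<Rightarrow> ('n, 'b) metric
    \<Rightarrow> ('n, 'b) vfield \<Rightarrow> real \<Rightarrow> bool" where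
  "nontrivial_ricci_soliton B h \<xi> \<Lambda> \<longleftrightarrow> ricci_soliton B h \<xi> \<Lambda> \<and> \<not> einstein B h"

definition ricci_greater :: "('n, 'b::finite) chart set \<Rightarrow> ('n, 'b) metric \<Rightarrow> real \<Rightarrow> bool" where
  "ricci_greater B h \<Lambda> \<longleftrightarrow>
     (\<forall>d\<in>B. \<forall>y\<in>snd d ` fst d. \<forall>v. v \<noteq> 0 \<longrightarrow> ricci (h d) y v v > \<Lambda> * bilin (h d y) v v)"

definition ricci_less :: "('n, 'b::finite) chart set \<Rightarrow> ('n, 'b) metric \<Rightarrow> real \<Rightarrow> bool" where
  "ricci_less B h \<Lambda> \<longleftrightarrow>
     (\<forall>d\<in>B. \<forall>y\<in>snd d ` fst d. \<forall>v. v \<noteq> 0 \<longrightarrow> ricci (h d) y v v < \<Lambda> * bilin (h d y) v v)"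

lemma has_derivative_entry:
  fixes G :: "real ^ 'n::finite \<Rightarrow> real ^ 'b::finite ^ 'c::finite"
  assumes "(G has_derivative D) (at x)"
  shows "((\<lambda>y. G y $ i $ j) has_derivative (\<lambda>v. D v $ i $ j)) (at x)"
  using bounded_linear.has_derivative[OF bounded_linear_vec_nth
      bounded_linear.has_derivative[OF bounded_linear_vec_nth assms]] .

lemma metric_derivative_symmetric:
  fixes G :: "real ^ 'n \<Rightarrow> real ^ 'n ^ 'n::finite"
  assumes "open S" "x \<in> S" "\<And>y. y \<in> S \<Longrightarrow> transpose (G y) = G y" "G differentiable (at x)"
  shows "frechet_derivative G (at x) v $ i $ j = frechet_derivative G (at x) v $ j $ i"
proof -
  let ?D = "frechet_derivative G (at x)"
  have D: "(G has_derivative ?D) (at x)" using assms(4) by (simp add: frechet_derivative_works)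
  have sym: "G y $ i $ j = G y $ j $ i" if "y \<in> S" for y
    using arg_cong[OF assms(3)[OF that], of "\<lambda>M. M $ j $ i"] by (simp add: transpose_def)
  have "((\<lambda>y. G y $ j $ i) has_derivative (\<lambda>v. ?D v $ i $ j)) (at x)"
    by (rule has_derivative_transform_within_open[OF has_derivative_entry[OF D] assms(1,2)])
       (rule sym)
  from has_derivative_unique[OF this has_derivative_entry[OF D]]
  show ?thesis by (rule fun_cong)
qed

lemma levi_civita_torsion_free:
  fixes G :: "real ^ 'n \<Rightarrow> real ^ 'n ^ 'n::finite"
  assumes "open S" "x \<in> S" "\<And>y. y \<in> S \<Longrightarrow> transpose (G y) = G y" "G differentiable (at x)"
  shows "levi_civita G X Y x - levi_civita G Y X x = bracket X Y x"
proof -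
  note s = metric_derivative_symmetric[OF assms]
  have sym: "christoffel G x k i j = christoffel G x k j i" for k i j
    unfolding christoffel_def
    by (intro arg_cong[of _ _ "\<lambda>a. a / 2"] sum.cong refl) (simp add: s[of _ i j])
  have "christoffel_form G x u v = christoffel_form G x v u" for u v
  proof -
    have "(\<Sum>i\<in>UNIV. \<Sum>j\<in>UNIV. christoffel G x k i j * u $ i * v $ j)
        = (\<Sum>j\<in>UNIV. \<Sum>i\<in>UNIV. christoffel G x k j i * v $ j * u $ i)" for k
      by (subst sum.swap) (intro sum.cong refl, simp add: sym[of k])
    then show ?thesis by (simp add: christoffel_form_def)
  qed
  from this[of "X x" "Y x"] show ?thesis by (simp add: levi_civita_def bracket_def)
qed

lemma bilin_sum: "bilin G v w = (\<Sum>i\<in>UNIV. \<Sum>j\<in>UNIV. G $ i $ j * v $ i * w $ j)"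
  unfolding bilin_def inner_vec_def matrix_vector_mult_def
  by (simp add: sum_distrib_left mult_ac)

lemma christoffel_lowered:
  fixes G :: "real ^ 'n \<Rightarrow> real ^ 'n ^ 'n::finite"
  assumes "invertible (G x)"
  shows "(\<Sum>k\<in>UNIV. G x $ m $ k * christoffel G x k i j) =
    (frechet_derivative G (at x) (axis i 1) $ j $ m
      + frechet_derivative G (at x) (axis j 1) $ i $ m
      - frechet_derivative G (at x) (axis m 1) $ i $ j) / 2"
proof -
  define E where "E l = (frechet_derivative G (at x) (axis i 1) $ j $ l
      + frechet_derivative G (at x) (axis j 1) $ i $ l
      - frechet_derivative G (at x) (axis l 1) $ i $ j) / 2" for l
  have "G x ** matrix_inv (G x) = mat 1"
    using someI_ex[OF assms[unfolded invertible_def]] by (simp add: matrix_inv_def)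
  then have I: "(\<Sum>k\<in>UNIV. G x $ m $ k * matrix_inv (G x) $ k $ l) = (if m = l then 1 else 0)" for l
    unfolding matrix_matrix_mult_def mat_def vec_eq_iff by simp
  have C: "christoffel G x k i j = (\<Sum>l\<in>UNIV. matrix_inv (G x) $ k $ l * E l)" for k
    unfolding christoffel_def E_def by (simp add: sum_divide_distrib)
  have "(\<Sum>k\<in>UNIV. G x $ m $ k * christoffel G x k i j)
      = (\<Sum>k\<in>UNIV. \<Sum>l\<in>UNIV. G x $ m $ k * matrix_inv (G x) $ k $ l * E l)"
    unfolding C by (simp only: sum_distrib_left mult.assoc)
  also have "\<dots> = (\<Sum>l\<in>UNIV. (\<Sum>k\<in>UNIV. G x $ m $ k * matrix_inv (G x) $ k $ l) * E l)"
    by (subst sum.swap) (simp only: sum_distrib_right)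
  also have "\<dots> = (\<Sum>l\<in>UNIV. if m = l then E l else 0)"
    unfolding I by (intro sum.cong refl) simp
  also have "\<dots> = E m" by (simp add: sum.delta)
  finally show ?thesis by (simp only: E_def)
qed

lemma bilin_christoffel:
  fixes G :: "real ^ 'n \<Rightarrow> real ^ 'n ^ 'n::finite"
  assumes "invertible (G x)" "transpose (G x) = G x"
  shows "bilin (G x) (christoffel_form G x u v) w = (\<Sum>i\<in>UNIV. \<Sum>j\<in>UNIV. \<Sum>m\<in>UNIV.
    (frechet_derivative G (at x) (axis i 1) $ j $ m
      + frechet_derivative G (at x) (axis j 1) $ i $ m
      - frechet_derivative G (at x) (axis m 1) $ i $ j) / 2 * u $ i * v $ j * w $ m)"
proof -
  have sym: "G x $ k $ m = G x $ m $ k" for k m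
    using arg_cong[OF assms(2), of "\<lambda>M. M $ m $ k"] by (simp add: transpose_def)
  have low: "(\<Sum>k\<in>UNIV. G x $ k $ m * christoffel G x k i j)
      = (\<Sum>k\<in>UNIV. G x $ m $ k * christoffel G x k i j)" for i j m
    by (intro sum.cong refl arg_cong2[of _ _ _ _ "(*)"] sym)
  have "bilin (G x) (christoffel_form G x u v) w
     = (\<Sum>k\<in>UNIV. \<Sum>m\<in>UNIV. \<Sum>i\<in>UNIV. \<Sum>j\<in>UNIV. G x $ k $ m * christoffel G x k i j * u $ i * v $ j * w $ m)"
    unfolding bilin_sum christoffel_form_def
    by (simp add: sum_distrib_left sum_distrib_right mult.assoc)
  also have "\<dots> = (\<Sum>m\<in>UNIV. \<Sum>k\<in>UNIV. \<Sum>i\<in>UNIV. \<Sum>j\<in>UNIV. G x $ k $ m * christoffel G x k i j * u $ i * v $ j * w $ m)"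
    by (rule sum.swap)
  also have "\<dots> = (\<Sum>m\<in>UNIV. \<Sum>i\<in>UNIV. \<Sum>k\<in>UNIV. \<Sum>j\<in>UNIV. G x $ k $ m * christoffel G x k i j * u $ i * v $ j * w $ m)"
    by (rule sum.cong[OF refl], rule sum.swap)
  also have "\<dots> = (\<Sum>m\<in>UNIV. \<Sum>i\<in>UNIV. \<Sum>j\<in>UNIV. \<Sum>k\<in>UNIV. G x $ k $ m * christoffel G x k i j * u $ i * v $ j * w $ m)"
    by (rule sum.cong[OF refl], rule sum.cong[OF refl], rule sum.swap)
  also have "\<dots> = (\<Sum>m\<in>UNIV. \<Sum>i\<in>UNIV. \<Sum>j\<in>UNIV. (\<Sum>k\<in>UNIV. G x $ k $ m * christoffel G x k i j) * u $ i * v $ j * w $ m)"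
    by (simp only: sum_distrib_right)
  also have "\<dots> = (\<Sum>i\<in>UNIV. \<Sum>m\<in>UNIV. \<Sum>j\<in>UNIV. (\<Sum>k\<in>UNIV. G x $ k $ m * christoffel G x k i j) * u $ i * v $ j * w $ m)"
    by (rule sum.swap)
  also have "\<dots> = (\<Sum>i\<in>UNIV. \<Sum>j\<in>UNIV. \<Sum>m\<in>UNIV. (\<Sum>k\<in>UNIV. G x $ k $ m * christoffel G x k i j) * u $ i * v $ j * w $ m)"
    by (rule sum.cong[OF refl], rule sum.swap)
  finally show ?thesis by (simp only: low christoffel_lowered[of G x, OF assms(1)])
qed

lemma linear_axis_sum:
  fixes f :: "real ^ 'n::finite \<Rightarrow> 'b::real_vector"
  assumes "linear f"
  shows "f v = (\<Sum>i\<in>UNIV. v $ i *\<^sub>R f (axis i 1))"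
proof -
  have "f v = f (\<Sum>i\<in>UNIV. v $ i *\<^sub>R axis i 1)"
    by (metis basis_expansion scalar_mult_eq_scaleR)
  also have "\<dots> = (\<Sum>i\<in>UNIV. v $ i *\<^sub>R f (axis i 1))"
    using assms by (simp add: linear_sum linear_cmul)
  finally show ?thesis .
qed

lemma bilin_has_derivative:
  fixes G :: "real ^ 'a::finite \<Rightarrow> real ^ 'n ^ 'n::finite"
  assumes "(G has_derivative D) (at x)" "(Y has_derivative DY) (at x)" "(Z has_derivative DZ) (at x)"
  shows "((\<lambda>y. bilin (G y) (Y y) (Z y)) has_derivative
    (\<lambda>v. bilin (D v) (Y x) (Z x) + bilin (G x) (DY v) (Z x) + bilin (G x) (Y x) (DZ v))) (at x)"
proof -
  note y = bounded_linear.has_derivative[OF bounded_linear_vec_nth assms(2)]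
  note z = bounded_linear.has_derivative[OF bounded_linear_vec_nth assms(3)]
  have "((\<lambda>y. \<Sum>i\<in>UNIV. \<Sum>j\<in>UNIV. G y $ i $ j * Y y $ i * Z y $ j) has_derivative
    (\<lambda>v. \<Sum>i\<in>UNIV. \<Sum>j\<in>UNIV. (G x $ i $ j * Y x $ i) * DZ v $ j
       + (G x $ i $ j * DY v $ i + D v $ i $ j * Y x $ i) * Z x $ j)) (at x)"
    by (intro has_derivative_sum has_derivative_mult has_derivative_entry[OF assms(1)] y z)
  then show ?thesis
    unfolding bilin_sum by (simp add: sum.distrib algebra_simps)
qed

lemma levi_civita_metric:
  fixes G :: "real ^ 'n \<Rightarrow> real ^ 'n ^ 'n::finite"
  assumes "open S" "x \<in> S" "\<And>y. y \<in> S \<Longrightarrow> transpose (G y) = G y" "invertible (G x)"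
    and "G differentiable (at x)" "Y differentiable (at x)" "Z differentiable (at x)"
  shows "frechet_derivative (\<lambda>y. bilin (G y) (Y y) (Z y)) (at x) (X x)
    = bilin (G x) (levi_civita G X Y x) (Z x) + bilin (G x) (Y x) (levi_civita G X Z x)"
proof -
  let ?D = "frechet_derivative G (at x)"
  note s = metric_derivative_symmetric[OF assms(1-3,5)]
  note G = assms(5)[unfolded frechet_derivative_works]
  note bil = bilin_has_derivative[OF G assms(6,7)[unfolded frechet_derivative_works]]
  have T: "transpose (G x) = G x" using assms(2,3) by blast
  have swap: "bilin (G x) a b = bilin (G x) b a" for a b
    unfolding bilin_def by (metis T dot_lmul_matrix inner_commute vector_transpose_matrix)
  have lin: "?D u $ j $ m = (\<Sum>i\<in>UNIV. u $ i * ?D (axis i 1) $ j $ m)" for u j m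
    by (subst linear_axis_sum[OF has_derivative_linear[OF G]]) simp
  have main: "bilin (?D u) v w = bilin (G x) (christoffel_form G x u v) w
      + bilin (G x) v (christoffel_form G x u w)" for u v w
  proof -
    let ?f = "\<lambda>i j m. ?D (axis i 1) $ j $ m * u $ i * v $ j * w $ m"
    have "bilin (G x) v (christoffel_form G x u w) = bilin (G x) (christoffel_form G x u w) v"
      by (rule swap)
    also have "\<dots> = (\<Sum>i\<in>UNIV. \<Sum>j\<in>UNIV. \<Sum>m\<in>UNIV.
      (?D (axis i 1) $ m $ j + ?D (axis m 1) $ i $ j - ?D (axis j 1) $ i $ m) / 2 * u $ i * w $ m * v $ j)"
      unfolding bilin_christoffel[of G x, OF assms(4) T]
      by (rule sum.cong[OF refl], rule sum.swap)
    finally have "bilin (G x) (christoffel_form G x u v) w + bilin (G x) v (christoffel_form G x u w)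
      = (\<Sum>i\<in>UNIV. \<Sum>j\<in>UNIV. \<Sum>m\<in>UNIV. ?f i j m)"
      unfolding bilin_christoffel[of G x, OF assms(4) T]
      by (simp only: sum.distrib[symmetric])
         (intro sum.cong refl, simp add: s[of _ m j for m j] field_simps)
    also have "\<dots> = (\<Sum>j\<in>UNIV. \<Sum>i\<in>UNIV. \<Sum>m\<in>UNIV. ?f i j m)"
      by (rule sum.swap)
    also have "\<dots> = (\<Sum>j\<in>UNIV. \<Sum>m\<in>UNIV. \<Sum>i\<in>UNIV. ?f i j m)"
      by (rule sum.cong[OF refl], rule sum.swap)
    also have "\<dots> = bilin (?D u) v w"
      unfolding bilin_sum by (simp add: lin[of u] sum_distrib_left sum_distrib_right mult_ac)
    finally show ?thesis by simp
  qed
  have add1: "bilin M (a + b) c = bilin M a c + bilin M b c" for M a b c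
    by (simp add: bilin_def inner_add_left)
  have add2: "bilin M c (a + b) = bilin M c a + bilin M c b" for M a b c
    by (simp add: bilin_def matrix_vector_right_distrib inner_add_right)
  show ?thesis
    unfolding frechet_derivative_at[OF bil, symmetric] levi_civita_def
    by (simp add: main add1 add2)
qed


lemma christoffel_form_linear:
  "linear (christoffel_form G x u)" "linear (\<lambda>u. christoffel_form G x u v)"
  unfolding christoffel_form_def
  by (auto simp: linear_iff vec_eq_iff sum_distrib_left algebra_simps sum.distrib)

lemma second_fundamental_form_tensorial:
  fixes f :: "real ^ 'a::finite \<Rightarrow> real ^ 'b::finite"
  assumes "open S" "x \<in> S" "smooth_on S f" "Y differentiable (at x)"
  shows "second_fundamental_form G H f X Y x = (\<Sum>i\<in>UNIV. \<Sum>j\<in>UNIV.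
    (X x $ i * Y x $ j) *\<^sub>R second_fundamental_form G H f (coord_field i) (coord_field j) x)"
proof -
  let ?df = "\<lambda>y. frechet_derivative f (at y)"
  have C2: "Ck_on (Suc (Suc 0)) S f" using assms(3) by (simp only: smooth_on_def)
  have d1: "(f has_derivative ?df y) (at y)" if "y \<in> S" for y
    using C2 that by (simp add: frechet_derivative_works)
  have d2: "((\<lambda>y. ?df y v) has_derivative frechet_derivative (\<lambda>y. ?df y v) (at x)) (at x)" for v
    using C2 assms(2) by (simp add: frechet_derivative_works)
  define Q where "Q u j = frechet_derivative (\<lambda>y. ?df y (axis j 1)) (at x) u" for u j
  have linQ: "linear (\<lambda>u. Q u j)" for j
    unfolding Q_def using has_derivative_linear[OF d2] .
  have lindf: "linear (?df x)" using has_derivative_linear[OF d1[OF assms(2)]] .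
  have ex: "second_fundamental_form G H f X Y x = (\<Sum>j\<in>UNIV. Y x $ j *\<^sub>R Q (X x) j)
      + christoffel_form H (f x) (?df x (X x)) (?df x (Y x)) - ?df x (christoffel_form G x (X x) (Y x))"
    if "Y differentiable (at x)" for X Y
  proof -
    let ?DY = "frechet_derivative Y (at x)"
    have Y: "(Y has_derivative ?DY) (at x)" using that by (simp add: frechet_derivative_works)
    note y = bounded_linear.has_derivative[OF bounded_linear_vec_nth Y]
    have "((\<lambda>y. \<Sum>j\<in>UNIV. Y y $ j *\<^sub>R ?df y (axis j 1)) has_derivative
      (\<lambda>u. \<Sum>j\<in>UNIV. Y x $ j *\<^sub>R Q u j + ?DY u $ j *\<^sub>R ?df x (axis j 1))) (at x)"
      unfolding Q_def by (intro has_derivative_sum has_derivative_scaleR y d2)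
    then have "((\<lambda>y. ?df y (Y y)) has_derivative
      (\<lambda>u. \<Sum>j\<in>UNIV. Y x $ j *\<^sub>R Q u j + ?DY u $ j *\<^sub>R ?df x (axis j 1))) (at x)"
      by (rule has_derivative_transform_within_open[OF _ assms(1,2)])
         (rule linear_axis_sum[OF has_derivative_linear[OF d1], symmetric])
    from frechet_derivative_at[OF this, symmetric]
    have "frechet_derivative (\<lambda>y. ?df y (Y y)) (at x) (X x)
      = (\<Sum>j\<in>UNIV. Y x $ j *\<^sub>R Q (X x) j) + ?df x (?DY (X x))"
      by (simp add: sum.distrib linear_axis_sum[OF lindf, of "?DY (X x)"])
    then show ?thesis
      by (simp add: second_fundamental_form_def pullback_connection_def levi_civita_def
          linear_add[OF lindf])
  qed
  define T where "T u v = (\<Sum>j\<in>UNIV. v $ j *\<^sub>R Q u j)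
      + christoffel_form H (f x) (?df x u) (?df x v) - ?df x (christoffel_form G x u v)" for u v
  have T1: "linear (\<lambda>u. T u v)" for v
    unfolding T_def
    by (intro linear_compose_sub linear_compose_add linear_compose_sum ballI
        linear_compose_scale_right linQ
        linear_compose[OF lindf christoffel_form_linear(2), unfolded comp_def]
        linear_compose[OF christoffel_form_linear(2) lindf, unfolded comp_def])
  have T2: "linear (T u)" for u
  proof -
    have "linear (\<lambda>v. \<Sum>j\<in>UNIV. v $ j *\<^sub>R Q u j)"
      by (auto simp: linear_iff sum.distrib scaleR_add_left scaleR_sum_right)
    then show ?thesis
      unfolding T_def
      by (intro linear_compose_sub linear_compose_add
          linear_compose[OF lindf christoffel_form_linear(1), unfolded comp_def]
          linear_compose[OF christoffel_form_linear(1) lindf, unfolded comp_def])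
  qed
  have c: "second_fundamental_form G H f (coord_field i) (coord_field j) x = T (axis i 1) (axis j 1)" for i j
    by (subst ex) (simp_all add: T_def coord_field_def)
  have "second_fundamental_form G H f X Y x = T (X x) (Y x)"
    by (simp add: ex[OF assms(4)] T_def)
  also have "\<dots> = (\<Sum>i\<in>UNIV. X x $ i *\<^sub>R T (axis i 1) (Y x))"
    by (rule linear_axis_sum[OF T1])
  also have "\<dots> = (\<Sum>i\<in>UNIV. X x $ i *\<^sub>R (\<Sum>j\<in>UNIV. Y x $ j *\<^sub>R T (axis i 1) (axis j 1)))"
    by (subst linear_axis_sum[OF T2]) (rule refl)
  finally show ?thesis by (simp only: c scaleR_sum_right scaleR_scaleR)
qed

lemma tension_eq_frame_sum:
  fixes f :: "real ^ 'a::finite \<Rightarrow> real ^ 'b::finite" and e :: "'a \<Rightarrow> real ^ 'a \<Rightarrow> real ^ 'a"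
  assumes "open S" "x \<in> S" "smooth_on S f" "\<And>k. e k differentiable (at x)"
    and orthonormal: "\<And>k l. bilin (G x) (e k x) (e l x) = (if k = l then 1 else 0)"
  shows "tension G H f x = (\<Sum>k\<in>UNIV.
    pullback_connection H f (e k) (\<lambda>y. frechet_derivative f (at y) (e k y)) x
    - frechet_derivative f (at x) (levi_civita G (e k) (e k) x))"
proof -
  let ?T = "\<lambda>i j. second_fundamental_form G H f (coord_field i) (coord_field j) x"
  define E :: "real ^ 'a ^ 'a" where "E = (\<chi> i k. e k x $ i)"
  have "transpose E ** (G x ** E) = mat 1"
    using orthonormal
    by (simp add: vec_eq_iff matrix_matrix_mult_def transpose_def mat_def E_def bilin_def
        inner_vec_def matrix_vector_mult_def)
  then have a: "(G x ** E) ** transpose E = mat 1"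
    by (simp add: matrix_left_right_inverse)
  then have b: "G x ** (E ** transpose E) = mat 1" by (simp add: matrix_mul_assoc)
  then have b': "(E ** transpose E) ** G x = mat 1" by (simp add: matrix_left_right_inverse)
  have inv: "G x ** matrix_inv (G x) = mat 1"
    using someI_ex[of "\<lambda>M. G x ** M = mat 1 \<and> M ** G x = mat 1"] b b' by (auto simp: matrix_inv_def)
  have "matrix_inv (G x) = (E ** transpose E) ** (G x ** matrix_inv (G x))"
    by (simp only: matrix_mul_assoc b' matrix_mul_lid)
  then have "matrix_inv (G x) = E ** transpose E" by (simp add: inv)
  then have m: "matrix_inv (G x) $ i $ j = (\<Sum>k\<in>UNIV. e k x $ i * e k x $ j)" for i j
    by (simp add: matrix_matrix_mult_def transpose_def E_def)
  have "tension G H f x = (\<Sum>i\<in>UNIV. \<Sum>j\<in>UNIV. \<Sum>k\<in>UNIV. (e k x $ i * e k x $ j) *\<^sub>R ?T i j)"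
    by (simp add: tension_def m scaleR_sum_left)
  also have "\<dots> = (\<Sum>i\<in>UNIV. \<Sum>k\<in>UNIV. \<Sum>j\<in>UNIV. (e k x $ i * e k x $ j) *\<^sub>R ?T i j)"
    by (rule sum.cong[OF refl], rule sum.swap)
  also have "\<dots> = (\<Sum>k\<in>UNIV. \<Sum>i\<in>UNIV. \<Sum>j\<in>UNIV. (e k x $ i * e k x $ j) *\<^sub>R ?T i j)"
    by (rule sum.swap)
  also have "\<dots> = (\<Sum>k\<in>UNIV. second_fundamental_form G H f (e k) (e k) x)"
    by (simp only: second_fundamental_form_tensorial[OF assms(1-4)])
  finally show ?thesis by (simp only: second_fundamental_form_def)
qed

end

theory Submission
  imports Defs
begin

text \<open>By the soliton equation $\frac12 L_\xi h = \lambda h - \mathrm{Ric}$ is positive or negative definite. For harmonic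
  $\varphi$ the one-form $\theta(X) = h(d\varphi(X), \xi \circ \varphi)$ has divergence
  $\mathrm{trace}_g\, \varphi^*(\frac12 L_\xi h)$, because the term $h(\tau(\varphi), \xi \circ \varphi)$ drops out.
  The divergence has integral zero but does not change sign; hence it vanishes, which forces $d\varphi = 0$.

  No measure on the manifold is needed. With a $C^1$ partition of unity $\rho_i$ the divergence theorem in the
  $i$-th chart equates the integral of $\rho_i\, \mathrm{div}\, \theta$ with the integral of
  $- \langle \theta, d\rho_i \rangle = - \sum_k \rho_k \langle \theta, d\rho_i \rangle$. By the change of variables
  theorem, the $k$-th summand can be computed in the $k$-th chart instead, and there the sum over $i$ vanishes since
  $\sum_i d\rho_i = 0$.\<close>

section \<open>Continuously differentiable functions\<close>

text \<open>The factor rho_k is what permits the exchange of charts. Alone, <theta, d rho_i> is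
  supported in the i-th chart but in general not in the k-th; after multiplication by rho_k the
  support lies in both, so the two chart integrals run over the same overlap. They agree because
  sqrt(det g) absorbs the Jacobian and <theta, d rho_i> is a scalar. Since theta involves
  \<open>h\<close> and \<open>\<xi>\<close>, a "chart" here is a chart of M paired with a chart of
  N, restricted to the points that the map sends into the latter. The term h(tau, xi) is isolated by
  a cancellation: the contracted Christoffel symbol g^{kl} Gamma^j_{kl} enters once through the
  derivatives of sqrt(det g) g^{ij} and once, with the opposite sign, through the tension field.
  Only first derivatives of theta and of the rho_i are ever integrated, so C^1 bump functions with
  an explicit formula suffice. All integrals of rho_i div theta have the same sign and sum to zero,
  so each vanishes, and continuity turns this into pointwise vanishing of div theta where rho_i >
  0.\<close>

abbreviation C1_on :: "'a::real_normed_vector set \<Rightarrow> ('a \<Rightarrow> 'b::real_normed_vector) \<Rightarrow> bool" where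
  "C1_on \<equiv> Ck_on (Suc 0)"

text \<open>\<open>frechet_derivative\<close> is a choice. Uniqueness of derivatives identifies it
  with any explicit candidate \<open>f'\<close>, so continuity has to be checked for the candidate
  only.\<close>

lemma C1_onI:
  assumes "\<And>x. x \<in> S \<Longrightarrow> (f has_derivative f' x) (at x)" "\<And>v. continuous_on S (\<lambda>x. f' x v)"
  shows "C1_on S f"
proof -
  have "frechet_derivative f (at x) = f' x" if "x \<in> S" for x
    using frechet_derivative_at[OF assms(1)[OF that]] by simp
  then have "continuous_on S (\<lambda>x. frechet_derivative f (at x) v)" for v
    using assms(2)[of v] by (simp cong: continuous_on_cong)
  then show ?thesis
    using assms(1) by (auto simp: differentiable_def)
qed

lemma C1_on_has_derivative:
  "C1_on S f \<Longrightarrow> x \<in> S \<Longrightarrow> (f has_derivative frechet_derivative f (at x)) (at x)"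
  by (simp add: frechet_derivative_works)

lemma C1_on_continuous_derivative:
  "C1_on S f \<Longrightarrow> continuous_on S (\<lambda>x. frechet_derivative f (at x) v)"
  by simp

lemma C1_on_imp_continuous_on: "C1_on S f \<Longrightarrow> continuous_on S f"
  by (auto intro!: continuous_at_imp_continuous_on differentiable_imp_continuous_within)

lemma C1_on_subset: "C1_on S f \<Longrightarrow> T \<subseteq> S \<Longrightarrow> C1_on T f"
  by (auto intro: continuous_on_subset)

lemma C1_on_cong:
  assumes "open S" "C1_on S f" "\<And>x. x \<in> S \<Longrightarrow> g x = f x"
  shows "C1_on S g"
proof (rule C1_onI)
  show "(g has_derivative frechet_derivative f (at x)) (at x)" if "x \<in> S" for x
    by (rule has_derivative_transform_within_open[OF C1_on_has_derivative[OF assms(2) that] assms(1) that])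
       (simp add: assms(3))
qed (rule C1_on_continuous_derivative[OF assms(2)])

lemma C1_on_Un: "open S \<Longrightarrow> open T \<Longrightarrow> C1_on S f \<Longrightarrow> C1_on T f \<Longrightarrow> C1_on (S \<union> T) f"
  by (auto intro: continuous_on_open_Un)

lemma C1_on_const: "C1_on S (\<lambda>_. c)"
  by (rule C1_onI[where f' = "\<lambda>_ _. 0"]) auto

lemma C1_on_bounded_linear:
  assumes "bounded_linear L" "C1_on S f"
  shows "C1_on S (\<lambda>x. L (f x))"
  by (rule C1_onI[where f' = "\<lambda>x v. L (frechet_derivative f (at x) v)"])
     (auto intro!: bounded_linear.has_derivative[OF assms(1)] C1_on_has_derivative[OF assms(2)]
        bounded_linear.continuous_on[OF assms(1)] C1_on_continuous_derivative[OF assms(2)])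

lemma C1_on_ident: "C1_on S (\<lambda>x. x)"
  by (rule C1_onI[where f' = "\<lambda>_ v. v"]) auto

lemma C1_on_add: "C1_on S f \<Longrightarrow> C1_on S g \<Longrightarrow> C1_on S (\<lambda>x. f x + g x)"
  by (rule C1_onI[where f' = "\<lambda>x v. frechet_derivative f (at x) v + frechet_derivative g (at x) v"])
     (auto intro!: has_derivative_add C1_on_has_derivative continuous_intros)

lemma C1_on_diff: "C1_on S f \<Longrightarrow> C1_on S g \<Longrightarrow> C1_on S (\<lambda>x. f x - g x)"
  by (rule C1_onI[where f' = "\<lambda>x v. frechet_derivative f (at x) v - frechet_derivative g (at x) v"])
     (auto intro!: has_derivative_diff C1_on_has_derivative continuous_intros)

lemma C1_on_sum: "(\<And>i. i \<in> I \<Longrightarrow> C1_on S (f i)) \<Longrightarrow> C1_on S (\<lambda>x. \<Sum>i\<in>I. f i x)"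
  by (induction I rule: infinite_finite_induct) (auto simp del: Ck_on.simps intro!: C1_on_const C1_on_add)

lemma C1_on_scaleR:
  assumes "C1_on S f" "C1_on S g"
  shows "C1_on S (\<lambda>x. f x *\<^sub>R g x)"
  by (rule C1_onI[where f' = "\<lambda>x v. f x *\<^sub>R frechet_derivative g (at x) v + frechet_derivative f (at x) v *\<^sub>R g x"])
     (auto intro!: has_derivative_scaleR C1_on_has_derivative[OF assms(1)] C1_on_has_derivative[OF assms(2)]
      continuous_intros C1_on_continuous_derivative[OF assms(1)] C1_on_continuous_derivative[OF assms(2)]
      C1_on_imp_continuous_on[OF assms(1)] C1_on_imp_continuous_on[OF assms(2)])

lemma C1_on_mult: "C1_on S f \<Longrightarrow> C1_on S g \<Longrightarrow> C1_on S (\<lambda>x. f x * g x :: real)"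
  using C1_on_scaleR[of S f g] by simp

lemma C1_on_prod: "(\<And>i. i \<in> I \<Longrightarrow> C1_on S (f i)) \<Longrightarrow> C1_on S (\<lambda>x. \<Prod>i\<in>I. f i x :: real)"
  by (induction I rule: infinite_finite_induct) (auto simp del: Ck_on.simps intro!: C1_on_const C1_on_mult)

text \<open>\<open>Ck_on\<close> gives continuity of the derivative in each fixed direction, but in
  the chain rule the direction fed to the derivative of \<open>g\<close> moves with
  \<open>x\<close>. Expanding that direction in a basis reduces to fixed directions, hence the
  Euclidean middle type.\<close>

lemma C1_on_compose:
  fixes g :: "'b::euclidean_space \<Rightarrow> 'c::real_normed_vector"
  assumes "C1_on T g" "C1_on S f" "f ` S \<subseteq> T"
  shows "C1_on S (\<lambda>x. g (f x))"
proof (rule C1_onI)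
  let ?f' = "\<lambda>x v. frechet_derivative f (at x) v" and ?g' = "\<lambda>y v. frechet_derivative g (at y) v"
  show "((\<lambda>x. g (f x)) has_derivative (\<lambda>v. ?g' (f x) (?f' x v))) (at x)" if "x \<in> S" for x
    using has_derivative_compose[OF C1_on_has_derivative[OF assms(2) that]
        C1_on_has_derivative[OF assms(1)]] assms(3) that by auto
  have lin: "linear (?g' (f x))" if "x \<in> S" for x
    using has_derivative_linear[OF C1_on_has_derivative[OF assms(1)]] assms(3) that by auto
  have eq: "?g' (f x) w = (\<Sum>b\<in>Basis. (w \<bullet> b) *\<^sub>R ?g' (f x) b)" if "x \<in> S" for x w
    by (subst euclidean_representation[of w, symmetric])
       (simp only: linear_sum[OF lin[OF that]] linear_cmul[OF lin[OF that]])
  have "continuous_on S (\<lambda>x. \<Sum>b\<in>Basis. (?f' x v \<bullet> b) *\<^sub>R ?g' (f x) b)" for v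
    by (intro continuous_on_sum continuous_on_scaleR continuous_on_inner continuous_on_const
        C1_on_continuous_derivative[OF assms(2)]
        continuous_on_compose2[OF C1_on_continuous_derivative[OF assms(1)] C1_on_imp_continuous_on[OF assms(2)] assms(3)])
  then show "continuous_on S (\<lambda>x. ?g' (f x) (?f' x v))" for v
    using eq by (simp cong: continuous_on_cong)
qed

lemma C1_on_real:
  assumes "\<And>x. x \<in> S \<Longrightarrow> (f has_real_derivative f' x) (at x)" "continuous_on S f'"
  shows "C1_on S f"
  by (rule C1_onI[where f' = "\<lambda>x. (*) (f' x)"])
     (use assms in \<open>auto simp: has_field_derivative_def intro!: continuous_intros\<close>)

lemma C1_on_inverse:
  assumes "C1_on S f" "\<And>x. x \<in> S \<Longrightarrow> f x \<noteq> 0"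
  shows "C1_on S (\<lambda>x. inverse (f x) :: real)"
proof (rule C1_on_compose[of "-{0}" inverse])
  show "C1_on (-{0}) (inverse :: real \<Rightarrow> real)"
    by (rule C1_on_real[where f' = "\<lambda>x. - inverse x * inverse x"])
       (auto intro!: derivative_eq_intros continuous_intros simp: power2_eq_square)
qed (use assms in auto)

lemma C1_on_sqrt:
  assumes "C1_on S f" "\<And>x. x \<in> S \<Longrightarrow> f x > 0"
  shows "C1_on S (\<lambda>x. sqrt (f x))"
proof (rule C1_on_compose[of "{0<..}" sqrt])
  show "C1_on {0<..} sqrt"
    by (rule C1_on_real[where f' = "\<lambda>x. inverse (sqrt x) / 2"])
       (auto intro!: derivative_eq_intros continuous_intros simp: power2_eq_square)
qed (use assms in auto)

lemma C1_on_nth: "C1_on S f \<Longrightarrow> C1_on S (\<lambda>x. f x $ i)"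
  by (rule C1_on_bounded_linear[OF bounded_linear_vec_nth])

lemma C1_on_vecI:
  fixes f :: "'a::real_normed_vector \<Rightarrow> 'c::euclidean_space ^ 'n::finite"
  assumes "\<And>i. C1_on S (\<lambda>x. f x $ i)"
  shows "C1_on S f"
proof -
  have "linear (axis i :: 'c \<Rightarrow> 'c ^ 'n)" for i
    by (auto simp: linear_iff vec_eq_iff axis_def)
  then have "bounded_linear (axis i :: 'c \<Rightarrow> 'c ^ 'n)" for i
    by (simp only: linear_conv_bounded_linear)
  then have "C1_on S (\<lambda>x. \<Sum>i\<in>UNIV. axis i (f x $ i))"
    by (intro C1_on_sum C1_on_bounded_linear[OF _ assms])
  also have "(\<lambda>x. \<Sum>i\<in>UNIV. axis i (f x $ i)) = f"
  proof (intro ext iffD2[OF vec_eq_iff] allI)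
    fix x k
    have "(\<Sum>i\<in>UNIV. axis i (f x $ i)) $ k = (\<Sum>i\<in>UNIV. if i = k then f x $ i else 0)"
      unfolding sum_component by (intro sum.cong) (auto simp: axis_def)
    then show "(\<Sum>i\<in>UNIV. axis i (f x $ i)) $ k = f x $ k" by simp
  qed
  finally show ?thesis .
qed

lemma C1_on_bilin:
  fixes G :: "'a::real_normed_vector \<Rightarrow> real ^ 'n ^ 'n::finite"
  shows "C1_on S G \<Longrightarrow> C1_on S u \<Longrightarrow> C1_on S v \<Longrightarrow> C1_on S (\<lambda>x. bilin (G x) (u x) (v x))"
  unfolding bilin_sum by (intro C1_on_sum C1_on_mult C1_on_nth)

lemma C1_on_det:
  fixes G :: "'a::real_normed_vector \<Rightarrow> real ^ 'n ^ 'n::finite"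
  assumes "\<And>i j. C1_on S (\<lambda>x. G x $ i $ j)"
  shows "C1_on S (\<lambda>x. det (G x))"
  unfolding det_def by (intro C1_on_sum C1_on_mult C1_on_prod assms C1_on_const)

lemma smooth_on_imp_C1_on: "smooth_on S f \<Longrightarrow> C1_on S f"
  by (simp add: smooth_on_def del: Ck_on.simps)

lemma smooth_on_derivative_C1_on:
  assumes "smooth_on S f" shows "C1_on S (\<lambda>x. frechet_derivative f (at x) v)"
proof -
  have "Ck_on (Suc (Suc 0)) S f" using assms by (simp add: smooth_on_def del: Ck_on.simps)
  then show ?thesis by (subst (asm) Ck_on.simps(2)) blast
qed

section \<open>Differentiable dependence of the inverse matrix\<close>

lemma matrix_inv_inverse:
  fixes A :: "real ^ 'n ^ 'n::finite"
  assumes "invertible A"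
  shows "A ** matrix_inv A = mat 1" "matrix_inv A ** A = mat 1"
  using someI_ex[OF assms[unfolded invertible_def]] by (simp_all add: matrix_inv_def)

text \<open>Cramer's rule for the l-th basis vector. It exhibits the entries of the inverse as
  quotients of polynomials in the entries of \<open>A\<close>, from which C^1 dependence
  follows.\<close>

lemma matrix_inv_entry:
  fixes A :: "real ^ 'n ^ 'n::finite"
  assumes "invertible A"
  shows "matrix_inv A $ k $ l = det (\<chi> i j. if j = k then axis l 1 $ i else A $ i $ j) * inverse (det A)"
proof -
  have "A *v (matrix_inv A *v axis l 1) = axis l 1"
    by (simp add: matrix_vector_mul_assoc matrix_inv_inverse[OF assms])
  with cramer_lemma[of k A "matrix_inv A *v axis l 1"]
  have "det (\<chi> i j. if j = k then axis l 1 $ i else A $ i $ j) = (matrix_inv A *v axis l 1) $ k * det A"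
    by (simp only:)
  also have "(matrix_inv A *v axis l 1) $ k = matrix_inv A $ k $ l"
    by (simp add: matrix_vector_mult_def axis_def if_distrib sum.delta cong: if_cong)
  finally show ?thesis using assms by (simp add: invertible_det_nz)
qed

lemma C1_on_matrix_inv:
  fixes G :: "real ^ 'm \<Rightarrow> real ^ 'n ^ 'n::finite"
  assumes "open S" "C1_on S G" "\<And>x. x \<in> S \<Longrightarrow> invertible (G x)"
  shows "C1_on S (\<lambda>x. matrix_inv (G x))"
proof (rule C1_on_vecI, rule C1_on_vecI)
  fix k l
  show "C1_on S (\<lambda>x. matrix_inv (G x) $ k $ l)"
  proof (rule C1_on_cong[OF assms(1)])
    have "C1_on S (\<lambda>x. (\<chi> i j. if j = k then axis l 1 $ i else G x $ i $ j) $ i $ j)" for i j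
      by (cases "j = k") (simp_all del: Ck_on.simps add: C1_on_const C1_on_nth assms)
    then have "C1_on S (\<lambda>x. det (\<chi> i j. if j = k then axis l 1 $ i else G x $ i $ j))"
      by (rule C1_on_det)
    moreover have "C1_on S (\<lambda>x. inverse (det (G x)))"
      using assms(3) by (intro C1_on_inverse C1_on_det C1_on_nth assms(2)) (simp add: invertible_det_nz)
    ultimately show "C1_on S (\<lambda>x. det (\<chi> i j. if j = k then axis l 1 $ i else G x $ i $ j) * inverse (det (G x)))"
      by (rule C1_on_mult)
  qed (simp add: matrix_inv_entry assms(3))
qed


section \<open>Positive definite matrices and determinants\<close>

lemma bilin_axis: "bilin P (axis a 1) (axis b 1) = P $ a $ b"
  by (simp add: bilin_def inner_axis' matrix_vector_mult_basis column_def)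

text \<open>With a zero diagonal entry the form on \<open>t *\<^sub>R axis k 1 + axis i 1\<close> is
  affine in \<open>t\<close>, and an affine function bounded below has slope zero.\<close>

lemma psd_row_eq_0:
  fixes P :: "real ^ 'n ^ 'n::finite"
  assumes sym: "\<And>i j. P $ i $ j = P $ j $ i" and psd: "\<And>v. bilin P v v \<ge> 0" and "P $ k $ k = 0"
  shows "P $ k $ i = 0"
proof (rule ccontr)
  assume nz: "P $ k $ i \<noteq> 0"
  \<comment> \<open>Solves \<open>2 * t * P $ k $ i + P $ i $ i = -1\<close>.\<close>
  define t where "t = - (P $ i $ i + 1) / (2 * P $ k $ i)"
  have "bilin P (t *\<^sub>R axis k 1 + axis i 1) (t *\<^sub>R axis k 1 + axis i 1)
    = t * t * P $ k $ k + t * P $ k $ i + t * P $ i $ k + P $ i $ i"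
    unfolding bilin_axis[symmetric]
    by (simp add: bilin_def matrix_vector_right_distrib inner_add_left inner_add_right
        matrix_vector_mult_scaleR algebra_simps)
  also have "\<dots> = 2 * t * P $ k $ i + P $ i $ i" using sym[of i k] assms(3) by simp
  also have "\<dots> = -1" using nz by (simp add: t_def field_simps)
  finally show False using psd[of "t *\<^sub>R axis k 1 + axis i 1"] by simp
qed

text \<open>Cholesky factorisation by symmetric elimination, by induction on a set of indices
  outside of which the rows vanish. A zero pivot has a zero row and is skipped; otherwise a rank-one
  matrix is split off and the rest is supported on a smaller set.\<close>

lemma psd_factor_supported:
  fixes P :: "real ^ 'n ^ 'n::finite"
  assumes "finite S" "\<And>i j. P $ i $ j = P $ j $ i" "\<And>v. bilin P v v \<ge> 0"
    and "\<And>i j. P $ i $ j \<noteq> 0 \<Longrightarrow> i \<in> S"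
  shows "\<exists>V :: 'n \<Rightarrow> real ^ 'n. \<forall>i j. P $ i $ j = (\<Sum>k\<in>S. V k $ i * V k $ j)"
  using assms
proof (induction S arbitrary: P rule: finite_induct)
  case empty
  then have "P $ i $ j = 0" for i j by blast
  then show ?case by simp
next
  case (insert k S)
  note sym = insert.prems(1) and psd = insert.prems(2)
  show ?case
  proof (cases "P $ k $ k = 0")
    case True
    have "P $ k $ i = 0" for i using psd_row_eq_0[OF sym psd True] .
    then have "i \<in> S" if "P $ i $ j \<noteq> 0" for i j using insert.prems(3)[OF that] that by auto
    then obtain V :: "'n \<Rightarrow> real ^ 'n" where V: "\<And>i j. P $ i $ j = (\<Sum>k\<in>S. V k $ i * V k $ j)"
      using insert.IH[OF sym psd] by blast
    show ?thesis
      using insert.hyps V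
      by (intro exI[of _ "V(k := 0)"]) (auto intro!: sum.cong)
  next
    case False
    have pos: "P $ k $ k > 0" using psd[of "axis k 1"] False by (simp add: bilin_axis)
    \<comment> \<open>The Schur complement of the pivot \<open>P $ k $ k\<close>: its k-th row and
      column are zero.\<close>
    define Q :: "real ^ 'n ^ 'n" where "Q = (\<chi> i j. P $ i $ j - P $ k $ i * P $ k $ j / P $ k $ k)"
    have "bilin Q v v \<ge> 0" for v
    proof -
      define s where "s = (\<Sum>j\<in>UNIV. P $ k $ j * v $ j)"
      have s: "bilin P (axis k 1) v = s" "bilin P v (axis k 1) = s"
        by (simp add: bilin_def s_def inner_axis' matrix_vector_mult_def)
           (simp add: bilin_def s_def matrix_vector_mult_basis column_def inner_vec_def sym[of _ k] mult.commute)
      have "bilin Q v v = bilin P v v - s * s / P $ k $ k"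
        unfolding bilin_sum Q_def s_def
        by (simp add: sum_distrib_left sum_distrib_right sum_subtractf sum_divide_distrib algebra_simps)
      \<comment> \<open>Completing the square: \<open>Q\<close> evaluates \<open>P\<close> on the
        part of \<open>v\<close> that is \<open>P\<close>-orthogonal to the k-th axis, so it
        inherits semidefiniteness.\<close>
      also have "\<dots> = bilin P (v - (s / P $ k $ k) *\<^sub>R axis k 1) (v - (s / P $ k $ k) *\<^sub>R axis k 1)"
      proof -
        have "bilin P (v - c *\<^sub>R axis k 1) (v - c *\<^sub>R axis k 1)
          = bilin P v v - c * bilin P (axis k 1) v - c * bilin P v (axis k 1) + c * c * bilin P (axis k 1) (axis k 1)" for c
          by (simp add: bilin_def matrix_vector_mult_diff_distrib inner_diff_left inner_diff_right
              matrix_vector_mult_scaleR algebra_simps)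
        then show ?thesis using False by (simp add: s bilin_axis)
      qed
      finally show ?thesis using psd by simp
    qed
    moreover have "Q $ i $ j = Q $ j $ i" for i j by (simp add: Q_def sym[of i j] mult.commute)
    moreover have "i \<in> S" if "Q $ i $ j \<noteq> 0" for i j
    proof -
      have "i \<noteq> k" using that False by (auto simp: Q_def)
      moreover have "P $ i $ j \<noteq> 0 \<or> P $ i $ k \<noteq> 0" using that sym[of i k] by (auto simp: Q_def)
      ultimately show ?thesis using insert.prems(3) by blast
    qed
    ultimately obtain V :: "'n \<Rightarrow> real ^ 'n" where V: "\<And>i j. Q $ i $ j = (\<Sum>k\<in>S. V k $ i * V k $ j)"
      using insert.IH[of Q] by blast
    define W where "W = V(k := (1 / sqrt (P $ k $ k)) *\<^sub>R P $ k)"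
    have "P $ i $ j = (\<Sum>k\<in>insert k S. W k $ i * W k $ j)" for i j
    proof -
      have "(\<Sum>k\<in>S. W k $ i * W k $ j) = Q $ i $ j"
        unfolding V using insert.hyps by (intro sum.cong) (auto simp: W_def)
      then show ?thesis
        using insert.hyps pos by (simp add: W_def Q_def field_simps)
    qed
    then show ?thesis by blast
  qed
qed

lemma psd_factor:
  fixes P :: "real ^ 'n ^ 'n::finite"
  assumes "transpose P = P" "\<And>v. bilin P v v \<ge> 0"
  obtains V :: "'n \<Rightarrow> real ^ 'n" where "\<And>i j. P $ i $ j = (\<Sum>k\<in>UNIV. V k $ i * V k $ j)"
proof -
  have "P $ i $ j = P $ j $ i" for i j
    by (subst assms(1)[symmetric]) (simp add: transpose_def)
  then show thesis using psd_factor_supported[of UNIV P] assms(2) that by auto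
qed

lemma positive_definite_invertible:
  fixes G :: "real ^ 'n ^ 'n::finite"
  assumes "\<And>v. v \<noteq> 0 \<Longrightarrow> bilin G v v > 0"
  shows "invertible G"
proof -
  have "v = 0" if "G *v v = 0" for v
    using assms[of v] that by (auto simp: bilin_def)
  then show ?thesis
    using matrix_left_invertible_ker[of G] invertible_left_inverse[of G] by blast
qed

text \<open>A factorisation of \<open>G\<close> as M times its transpose makes the determinant a
  square, and invertibility excludes zero.\<close>

lemma positive_definite_det_pos:
  fixes G :: "real ^ 'n ^ 'n::finite"
  assumes "transpose G = G" "\<And>v. v \<noteq> 0 \<Longrightarrow> bilin G v v > 0"
  shows "det G > 0"
proof -
  have "bilin G v v \<ge> 0" for v using assms(2)[of v] by (cases "v = 0") (auto simp: bilin_def)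
  then obtain V :: "'n \<Rightarrow> real ^ 'n" where V: "\<And>i j. G $ i $ j = (\<Sum>k\<in>UNIV. V k $ i * V k $ j)"
    using psd_factor[OF assms(1)] by blast
  define M :: "real ^ 'n ^ 'n" where "M = (\<chi> i k. V k $ i)"
  have "G = M ** transpose M"
    by (simp add: vec_eq_iff V M_def matrix_matrix_mult_def transpose_def)
  then have "det G = det M * det M" by (simp add: det_mul)
  then have "det G \<ge> 0" by simp
  moreover have "det G \<noteq> 0" using positive_definite_invertible[OF assms(2)] by (simp add: invertible_det_nz)
  ultimately show ?thesis by simp
qed

lemma matrix_inv_transpose:
  fixes G :: "real ^ 'n ^ 'n::finite"
  assumes "invertible G" "transpose G = G"
  shows "transpose (matrix_inv G) = matrix_inv G"
proof -
  have "transpose (matrix_inv G) ** G = mat 1"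
    by (metis assms matrix_inv_inverse(1) matrix_transpose_mul transpose_mat)
  then have "transpose (matrix_inv G) ** (G ** matrix_inv G) = matrix_inv G"
    by (simp add: matrix_mul_assoc)
  then show ?thesis by (simp add: matrix_inv_inverse(1)[OF assms(1)])
qed

text \<open>The value of the inverse form at \<open>v\<close> is the value of \<open>G\<close> at
  \<open>matrix_inv G *v v\<close>.\<close>

lemma positive_definite_matrix_inv:
  fixes G :: "real ^ 'n ^ 'n::finite"
  assumes "\<And>v. v \<noteq> 0 \<Longrightarrow> bilin G v v > 0"
  shows "bilin (matrix_inv G) v v \<ge> 0"
proof -
  note inv = positive_definite_invertible[OF assms]
  have "bilin G (matrix_inv G *v v) (matrix_inv G *v v) = bilin (matrix_inv G) v v"
    by (simp add: bilin_def matrix_vector_mul_assoc matrix_inv_inverse[OF inv] inner_commute)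
  then show ?thesis
    using assms[of "matrix_inv G *v v"] by (cases "matrix_inv G *v v = 0") (auto simp: bilin_def)
qed

text \<open>For \<open>p \<noteq> id\<close> at least two of the factors vanish at the identity matrix, so only the diagonal product
  contributes to the derivative.\<close>

lemma det_has_derivative_at_mat_1:
  fixes K :: "'a::real_normed_vector \<Rightarrow> real ^ 'n ^ 'n::finite"
  assumes K: "\<And>i j. ((\<lambda>y. K y $ i $ j) has_derivative E i j) (at x)" and "K x = mat 1"
  shows "((\<lambda>y. det (K y)) has_derivative (\<lambda>v. \<Sum>i\<in>UNIV. E i i v)) (at x)"
proof -
  have "((\<lambda>y. det (K y)) has_derivative (\<lambda>v. \<Sum>p | p permutes UNIV.
      of_int (sign p) * (\<Sum>i\<in>UNIV. E i (p i) v * (\<Prod>j\<in>UNIV - {i}. K x $ j $ p j)))) (at x)"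
    unfolding det_def
    by (intro has_derivative_sum has_derivative_mult_right has_derivative_prod K)
  also have "(\<lambda>v. \<Sum>p | p permutes UNIV.
      of_int (sign p) * (\<Sum>i\<in>UNIV. E i (p i) v * (\<Prod>j\<in>UNIV - {i}. K x $ j $ p j)))
    = (\<lambda>v. \<Sum>i\<in>UNIV. E i i v)"
  proof
    fix v
    have zero: "(\<Prod>j\<in>UNIV - {i}. K x $ j $ p j) = 0" if p: "p permutes UNIV" "p \<noteq> id" for p i
    proof -
      obtain a where a: "p a \<noteq> a" using p(2) by (auto simp: fun_eq_iff)
      have inj: "inj p" using p(1) by (rule permutes_inj)
      have "p (p a) \<noteq> p a" using inj a by (auto simp: inj_eq)
      with a obtain b where "b \<noteq> i" "p b \<noteq> b" by metis
      then have "b \<in> UNIV - {i}" "K x $ b $ p b = 0" by (auto simp: assms(2) mat_def)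
      then show ?thesis by (meson finite prod_zero)
    qed
    have one: "(\<Prod>j\<in>UNIV - {i}. K x $ j $ id j) = 1" for i
      by (intro prod.neutral) (auto simp: assms(2) mat_def)
    have "(\<Sum>p | p permutes UNIV.
        of_int (sign p) * (\<Sum>i\<in>UNIV. E i (p i) v * (\<Prod>j\<in>UNIV - {i}. K x $ j $ p j)))
      = (\<Sum>p\<in>{id}. of_int (sign p) * (\<Sum>i\<in>UNIV. E i (p i) v * (\<Prod>j\<in>UNIV - {i}. K x $ j $ p j)))"
      by (rule sum.mono_neutral_right) (auto simp: zero permutes_id finite_permutations)
    also have "\<dots> = (\<Sum>i\<in>UNIV. E i i v)"
      by (simp add: one[unfolded id_def])
    finally show "(\<Sum>p | p permutes UNIV.
        of_int (sign p) * (\<Sum>i\<in>UNIV. E i (p i) v * (\<Prod>j\<in>UNIV - {i}. K x $ j $ p j)))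
      = (\<Sum>i\<in>UNIV. E i i v)" .
  qed
  finally show ?thesis .
qed

text \<open>Jacobi's formula. Multiplying by the fixed matrix \<open>matrix_inv (G x)\<close> moves
  the base point to the identity matrix, and multiplicativity of the determinant undoes
  this.\<close>

lemma det_has_derivative:
  fixes G :: "'a::real_normed_vector \<Rightarrow> real ^ 'n ^ 'n::finite"
  assumes G: "\<And>i j. ((\<lambda>y. G y $ i $ j) has_derivative (\<lambda>v. D v $ i $ j)) (at x)" and inv: "invertible (G x)"
  shows "((\<lambda>y. det (G y)) has_derivative
    (\<lambda>v. det (G x) * (\<Sum>i\<in>UNIV. \<Sum>j\<in>UNIV. matrix_inv (G x) $ i $ j * D v $ j $ i))) (at x)"
proof -
  let ?P = "matrix_inv (G x)"
  have "((\<lambda>y. det (?P ** G y)) has_derivative (\<lambda>v. \<Sum>i\<in>UNIV. \<Sum>j\<in>UNIV. ?P $ i $ j * D v $ j $ i)) (at x)"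
  proof (rule det_has_derivative_at_mat_1[where E = "\<lambda>i k v. \<Sum>j\<in>UNIV. ?P $ i $ j * D v $ j $ k"])
    show "((\<lambda>y. (?P ** G y) $ i $ k) has_derivative (\<lambda>v. \<Sum>j\<in>UNIV. ?P $ i $ j * D v $ j $ k)) (at x)" for i k
      unfolding matrix_matrix_mult_def
      by (simp, intro has_derivative_sum has_derivative_mult_right G)
  qed (rule matrix_inv_inverse[OF inv])
  then have "((\<lambda>y. det (G x) * det (?P ** G y)) has_derivative
      (\<lambda>v. det (G x) * (\<Sum>i\<in>UNIV. \<Sum>j\<in>UNIV. ?P $ i $ j * D v $ j $ i))) (at x)"
    by (rule has_derivative_mult_right)
  moreover have "det (G x) * det (?P ** G y) = det (G y)" for y
    by (simp add: det_mul[symmetric] matrix_mul_assoc matrix_inv_inverse[OF inv])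
  ultimately show ?thesis by simp
qed

section \<open>Integration on Euclidean space\<close>

lemma integrable_compact_support:
  fixes f :: "'a::euclidean_space \<Rightarrow> real"
  assumes "continuous_on UNIV f" "compact K" "\<And>x. x \<notin> K \<Longrightarrow> f x = 0"
  shows "integrable lborel f"
proof -
  have "integrable lborel (\<lambda>x. indicator K x *\<^sub>R f x)"
    using assms by (intro borel_integrable_compact) (auto intro: continuous_on_subset)
  also have "(\<lambda>x. indicator K x *\<^sub>R f x) = f"
    using assms(3) by (auto simp: fun_eq_iff indicator_def)
  finally show ?thesis .
qed

lemma lborel_integral_translate:
  fixes f :: "'a::euclidean_space \<Rightarrow> real"
  assumes "continuous_on UNIV f"
  shows "(\<integral>x. f (x + c) \<partial>lborel) = (\<integral>x. f x \<partial>lborel)"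
proof -
  have m: "f \<in> borel_measurable borel" using assms by (rule borel_measurable_continuous_onI)
  have "(\<integral>x. f x \<partial>distr lborel borel ((+) c)) = (\<integral>x. f (c + x) \<partial>lborel)"
    using m by (intro integral_distr) auto
  then show ?thesis by (simp add: lborel_distr_plus add.commute)
qed

lemma frechet_derivative_eq_0:
  assumes "open U" "x \<in> U" "\<And>y. y \<in> U \<Longrightarrow> f y = 0"
  shows "frechet_derivative f (at x) v = 0"
proof -
  have "(f has_derivative (\<lambda>_. 0)) (at x)"
    by (rule has_derivative_transform_within_open[OF has_derivative_const assms(1,2)]) (simp add: assms(3))
  then show ?thesis by (metis frechet_derivative_at)
qed

text \<open>The integral of \<open>t \<mapsto> f (x + t v)\<close> over \<open>x\<close> is constant in \<open>t\<close>; differentiate under the integral.\<close>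

lemma integral_derivative_eq_0:
  fixes f :: "'a::euclidean_space \<Rightarrow> real"
  assumes f: "C1_on UNIV f" and K: "compact K" "\<And>x. x \<notin> K \<Longrightarrow> f x = 0"
  shows "integrable lborel (\<lambda>x. frechet_derivative f (at x) v)"
    "(\<integral>x. frechet_derivative f (at x) v \<partial>lborel) = 0"
proof -
  let ?D = "\<lambda>x. frechet_derivative f (at x) v"
  note cont = C1_on_imp_continuous_on[OF f] and contD = C1_on_continuous_derivative[OF f, of v]
  have D0: "?D x = 0" if "x \<notin> K" for x
    by (rule frechet_derivative_eq_0[of "-K"]) (use that K in \<open>auto simp: compact_imp_closed open_Compl\<close>)
  show int: "integrable lborel ?D"
    by (rule integrable_compact_support[OF contD K(1) D0])
  have intf: "integrable lborel f"
    by (rule integrable_compact_support[OF cont K])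
  have "bounded (?D ` K)"
    by (intro compact_imp_bounded compact_continuous_image continuous_on_subset[OF contD] K(1)) auto
  then obtain C where "\<And>x. x \<in> K \<Longrightarrow> \<bar>?D x\<bar> \<le> C" by (auto simp: bounded_iff)
  then have C: "\<bar>?D x\<bar> \<le> max C 0" for x using D0[of x] by (cases "x \<in> K") fastforce+
  obtain R where R: "\<And>x. x \<in> K \<Longrightarrow> norm x \<le> R"
    using compact_imp_bounded[OF K(1)] by (auto simp: bounded_iff)
  \<comment> \<open>Difference quotients with step 1/(n+1). The step never exceeds 1, so shifted
    points stay within distance \<open>norm v\<close>.\<close>
  define s where "s n x = (f (x + (1 / real (Suc n)) *\<^sub>R v) - f x) * real (Suc n)" for n x
  have der: "((\<lambda>t. f (x + t *\<^sub>R v)) has_real_derivative ?D (x + t *\<^sub>R v)) (at t)" for x t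
  proof -
    have lin: "linear (frechet_derivative f (at (x + t *\<^sub>R v)))"
      using has_derivative_linear[OF C1_on_has_derivative[OF f]] by simp
    have "((\<lambda>t. x + t *\<^sub>R v) has_derivative (\<lambda>h. h *\<^sub>R v)) (at t)"
      by (auto intro!: derivative_eq_intros)
    from has_derivative_compose[OF this C1_on_has_derivative[OF f]]
    show ?thesis by (simp add: has_field_derivative_def linear_cmul[OF lin] mult_commute_abs)
  qed
  have bound: "\<bar>s n x\<bar> \<le> max C 0" for n x
  proof -
    have "\<exists>z. 0 < z \<and> z < 1 / real (Suc n) \<and>
      f (x + (1 / real (Suc n)) *\<^sub>R v) - f (x + 0 *\<^sub>R v) = (1 / real (Suc n) - 0) * ?D (x + z *\<^sub>R v)"
      by (rule MVT2) (auto intro: der)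
    then obtain z where "f (x + (1 / real (Suc n)) *\<^sub>R v) - f x = (1 / real (Suc n)) * ?D (x + z *\<^sub>R v)"
      by auto
    then have "s n x = ?D (x + z *\<^sub>R v)" by (simp add: s_def)
    then show ?thesis using C by simp
  qed
  \<comment> \<open>The mean value theorem bounds every quotient by the supremum of the derivative.
    All quotients vanish outside the ball of radius \<open>R + norm v\<close>, which gives an
    integrable majorant independent of n.\<close>
  have "(\<lambda>n. \<integral>x. s n x \<partial>lborel) \<longlonglongrightarrow> (\<integral>x. ?D x \<partial>lborel)"
  proof (rule integral_dominated_convergence[where w = "\<lambda>x. max C 0 * indicator (cball 0 (R + norm v)) x"])
    show "?D \<in> borel_measurable lborel" using int by auto
    show "s n \<in> borel_measurable lborel" for n
    proof -
      have "continuous_on UNIV (s n)"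
        unfolding s_def by (intro continuous_intros continuous_on_compose2[OF cont]) auto
      then show ?thesis by (simp add: borel_measurable_continuous_onI)
    qed
    show "integrable lborel (\<lambda>x. max C 0 * indicator (cball 0 (R + norm v)) x)"
      by (intro integrable_mult_right integrable_real_indicator)
         (auto intro!: emeasure_bounded_finite[unfolded infinity_ennreal_def])
    show "AE x in lborel. (\<lambda>n. s n x) \<longlonglongrightarrow> ?D x"
    proof (rule AE_I2)
      fix x
      have "((\<lambda>t. (f (x + t *\<^sub>R v) - f x) / t) \<longlongrightarrow> ?D x) (at 0)"
        using der[of x 0] by (simp add: has_field_derivative_iff)
      moreover have "filterlim (\<lambda>n. 1 / real (Suc n)) (at 0) sequentially"
        using LIMSEQ_Suc[OF lim_1_over_n] by (auto simp: filterlim_at)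
      ultimately have "(\<lambda>n. (f (x + (1 / real (Suc n)) *\<^sub>R v) - f x) / (1 / real (Suc n))) \<longlonglongrightarrow> ?D x"
        by (rule filterlim_compose)
      then show "(\<lambda>n. s n x) \<longlonglongrightarrow> ?D x" by (simp add: s_def)
    qed
    show "AE x in lborel. norm (s n x) \<le> max C 0 * indicator (cball 0 (R + norm v)) x" for n
    proof (rule AE_I2)
      fix x
      show "norm (s n x) \<le> max C 0 * indicator (cball 0 (R + norm v)) x"
      proof (cases "x \<in> cball 0 (R + norm v)")
        case False
        let ?w = "(1 / real (Suc n)) *\<^sub>R v"
        have "norm ?w \<le> norm v"
          by (simp add: divide_le_eq mult_left_le mult_le_cancel_left1)
        then have "norm x - norm v \<le> norm (x + ?w)"
          using norm_triangle_ineq4[of "x + ?w" ?w] by simp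
        with False have "norm (x + ?w) > R" "norm x > R"
          using norm_ge_zero[of v] by (auto simp del: norm_ge_zero)
        then have "x + ?w \<notin> K" "x \<notin> K" using R by force+
        then show ?thesis by (simp add: s_def K(2))
      qed (use bound in simp)
    qed
  qed
  moreover have "(\<integral>x. s n x \<partial>lborel) = 0" for n
  proof -
    let ?c = "(1 / real (Suc n)) *\<^sub>R v"
    have "integrable lborel (\<lambda>x. f (x + ?c))"
    proof (rule integrable_compact_support)
      show "compact ((\<lambda>x. x - ?c) ` K)"
        by (intro compact_continuous_image K(1) continuous_intros)
      show "f (x + ?c) = 0" if "x \<notin> (\<lambda>x. x - ?c) ` K" for x
        using that by (intro K(2)) (auto simp: image_iff dest: bspec[of _ _ "x + ?c"])
    qed (intro continuous_on_compose2[OF cont] continuous_intros, auto)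
    then show ?thesis
      unfolding s_def using intf lborel_integral_translate[OF cont, of ?c] by simp
  qed
  ultimately show "(\<integral>x. ?D x \<partial>lborel) = 0"
    by (simp add: LIMSEQ_const_iff)
qed

section \<open>Change of variables\<close>

text \<open>The change of variables theorem of the library wants a well-ordered index type. An arbitrary finite index
  type is replaced by a copy that carries some linear order.\<close>

datatype 'a ordered_index = Ordered_Index (unindex: 'a)

lemma bij_unindex: "bij unindex"
  by (metis bijI' ordered_index.expand ordered_index.sel)

lemma bij_Ordered_Index: "bij Ordered_Index"
  by (metis bijI' ordered_index.exhaust ordered_index.inject)

lemma Ordered_Index_unindex [simp]: "Ordered_Index (unindex x) = x"
  by (cases x) simp

instance ordered_index :: (finite) finite
proof
  have "finite (Ordered_Index ` (UNIV :: 'a set))" by simp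
  then show "finite (UNIV :: 'a ordered_index set)" by (simp only: bij_is_surj[OF bij_Ordered_Index])
qed

instantiation ordered_index :: (finite) linorder
begin

definition index_rank :: "'a ordered_index \<Rightarrow> nat" where
  "index_rank = (SOME f. inj f)"

definition less_eq_ordered_index :: "'a ordered_index \<Rightarrow> 'a ordered_index \<Rightarrow> bool" where
  "x \<le> y \<longleftrightarrow> index_rank x \<le> index_rank y"

definition less_ordered_index :: "'a ordered_index \<Rightarrow> 'a ordered_index \<Rightarrow> bool" where
  "x < y \<longleftrightarrow> index_rank x < index_rank y"

instance
proof -
  have "\<exists>f :: 'a ordered_index \<Rightarrow> nat. inj f"
    using finite_imp_inj_to_nat_seg[of "UNIV :: 'a ordered_index set"] by auto
  then have "inj (index_rank :: 'a ordered_index \<Rightarrow> nat)"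
    unfolding index_rank_def by (rule someI_ex)
  then show "OFCLASS('a ordered_index, linorder_class)"
    by intro_classes (auto simp: less_eq_ordered_index_def less_ordered_index_def inj_eq)
qed

end

instance ordered_index :: (finite) wellorder
proof (rule wf_wellorderI)
  have "{(x :: 'a ordered_index, y). x < y} = Wellfounded.measure index_rank"
    by (auto simp: less_ordered_index_def)
  then show "wf {(x :: 'a ordered_index, y). x < y}" by simp
qed intro_classes

definition reindex :: "real ^ 'a \<Rightarrow> real ^ ('a::finite) ordered_index" where
  "reindex x = (\<chi> i. x $ unindex i)"

definition unreindex :: "real ^ ('a::finite) ordered_index \<Rightarrow> real ^ 'a" where
  "unreindex y = (\<chi> a. y $ Ordered_Index a)"

lemma unreindex_reindex [simp]: "unreindex (reindex x) = x"
  by (simp add: vec_eq_iff reindex_def unreindex_def)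

lemma reindex_unreindex [simp]: "reindex (unreindex x) = x"
  by (simp add: vec_eq_iff reindex_def unreindex_def)

lemma bounded_linear_reindex: "bounded_linear reindex"
  unfolding linear_conv_bounded_linear[symmetric] by (auto simp: linear_iff vec_eq_iff reindex_def)

lemma bounded_linear_unreindex: "bounded_linear unreindex"
  unfolding linear_conv_bounded_linear[symmetric] by (auto simp: linear_iff vec_eq_iff unreindex_def)

lemma measurable_unreindex [measurable]: "unreindex \<in> borel_measurable borel"
  by (intro borel_measurable_continuous_onI bounded_linear.continuous_on[OF bounded_linear_unreindex] continuous_on_id)

lemma prod_Basis_vec:
  fixes f :: "real ^ 'n::finite \<Rightarrow> 'b::comm_monoid_mult"
  shows "(\<Prod>b\<in>Basis. f b) = (\<Prod>i\<in>UNIV. f (axis i 1))"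
proof -
  have B: "(Basis :: (real ^ 'n) set) = (\<lambda>i. axis i 1) ` UNIV" by (auto simp: Basis_vec_def)
  show ?thesis unfolding B by (subst prod.reindex) (auto simp: inj_on_def axis_eq_axis)
qed

text \<open>Lebesgue measure is determined by its values on boxes, and relabelling the coordinates
  only permutes the factors in the volume of a box.\<close>

lemma lborel_unreindex: "distr lborel borel (unreindex :: _ \<Rightarrow> real ^ 'a::finite) = lborel"
proof (rule lborel_eqI[symmetric])
  fix l u :: "real ^ 'a" assume le: "\<And>b. b \<in> Basis \<Longrightarrow> l \<bullet> b \<le> u \<bullet> b"
  have le': "l $ i \<le> u $ i" for i using le[of "axis i 1"] by (simp add: inner_axis)
  have "y $ Ordered_Index (unindex i) = y $ i" for y :: "real ^ 'a ordered_index" and i by simp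
  then have "unreindex -` box l u = box (reindex l) (reindex u)"
    unfolding set_eq_iff mem_box_cart vimage_eq reindex_def unreindex_def vec_lambda_beta
    by (metis ordered_index.sel)
  then have "emeasure (distr lborel borel unreindex) (box l u) = emeasure lborel (box (reindex l) (reindex u))"
    by (simp add: emeasure_distr)
  also have "\<dots> = (\<Prod>b\<in>Basis. (reindex u - reindex l) \<bullet> b)"
    using le' by (intro emeasure_lborel_box) (auto simp: Basis_vec_def inner_axis reindex_def)
  also have "(\<Prod>b\<in>Basis. (reindex u - reindex l) \<bullet> b) = (\<Prod>i\<in>UNIV. u $ unindex i - l $ unindex i)"
    unfolding prod_Basis_vec by (simp add: inner_axis reindex_def)
  also have "\<dots> = (\<Prod>i\<in>UNIV. u $ i - l $ i)"
    by (rule prod.reindex_bij_betw[OF bij_unindex])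
  also have "\<dots> = (\<Prod>b\<in>Basis. (u - l) \<bullet> b)"
    unfolding prod_Basis_vec by (simp add: inner_axis)
  finally show "emeasure (distr lborel borel unreindex) (box l u) = ennreal (\<Prod>b\<in>Basis. (u - l) \<bullet> b)" .
qed simp

text \<open>Conjugation with the relabelling is a sign-preserving bijection between the permutations
  in the two Leibniz sums.\<close>

lemma det_reindex:
  fixes A :: "real ^ 'a ^ 'a::finite"
  shows "det (\<chi> i j. A $ unindex i $ unindex j) = det A"
proof -
  let ?f = "map_permutation UNIV (Ordered_Index :: 'a \<Rightarrow> _)"
  have f: "?f p = Ordered_Index \<circ> p \<circ> unindex" for p
  proof -
    have "inv_into UNIV Ordered_Index = (unindex :: 'a ordered_index \<Rightarrow> 'a)"
      by (metis bij_Ordered_Index bij_is_inj inv_f_eq ext Ordered_Index_unindex)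
    moreover have "range (Ordered_Index :: 'a \<Rightarrow> _) = UNIV" using bij_Ordered_Index by (rule bij_is_surj)
    ultimately show ?thesis by (simp add: map_permutation_def restrict_id_def fun_eq_iff)
  qed
  have "bij_betw ?f {p. p permutes UNIV} {p. p permutes UNIV}"
  proof (rule bij_betw_byWitness[where f' = "\<lambda>q. unindex \<circ> q \<circ> Ordered_Index"])
    show "?f ` {p. p permutes UNIV} \<subseteq> {p. p permutes UNIV}"
      using map_permutation_permutes[OF bij_Ordered_Index] by auto
    show "(\<lambda>q. unindex \<circ> q \<circ> Ordered_Index) ` {p. p permutes (UNIV :: 'a ordered_index set)} \<subseteq> {p. p permutes UNIV}"
      by (auto intro!: bij_imp_permutes bij_comp bij_unindex bij_Ordered_Index dest: permutes_bij)
  qed (auto simp: f fun_eq_iff)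
  then have "(\<Sum>q | q permutes UNIV. of_int (sign q) * (\<Prod>i\<in>UNIV. A $ unindex i $ unindex (q i)))
    = (\<Sum>p | p permutes UNIV. of_int (sign (?f p)) * (\<Prod>i\<in>UNIV. A $ unindex i $ unindex (?f p i)))"
    by (rule sum.reindex_bij_betw[symmetric])
  also have "\<dots> = (\<Sum>p | p permutes UNIV. of_int (sign p) * (\<Prod>i\<in>UNIV. A $ i $ p i))"
  proof (intro sum.cong refl)
    fix p :: "'a \<Rightarrow> 'a" assume "p \<in> {p. p permutes UNIV}"
    then have "sign (?f p) = sign p"
      by (intro sign_map_permutation) (auto simp: bij_is_inj[OF bij_Ordered_Index])
    moreover have "(\<Prod>i\<in>UNIV. A $ unindex i $ unindex (?f p i)) = (\<Prod>i\<in>UNIV. A $ i $ p i)"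
      by (simp add: f prod.reindex_bij_betw[OF bij_unindex, of "\<lambda>i. A $ i $ p i"])
    ultimately show "of_int (sign (?f p)) * (\<Prod>i\<in>UNIV. A $ unindex i $ unindex (?f p i))
      = of_int (sign p) * (\<Prod>i\<in>UNIV. A $ i $ p i)" by simp
  qed
  finally show ?thesis by (simp add: det_def)
qed

text \<open>Conjugating \<open>\<psi>\<close> with the relabelling moves the problem to the
  well-ordered index type; measure and determinant are unaffected. Both integrands are extended by
  zero, the form in which chart integrands occur later.\<close>

lemma integral_change_of_variables_finite:
  fixes f :: "real ^ 'a::finite \<Rightarrow> real" and \<psi> :: "real ^ 'a \<Rightarrow> real ^ 'a"
  assumes S: "open S" and der: "\<And>x. x \<in> S \<Longrightarrow> (\<psi> has_derivative \<psi>' x) (at x)" and inj: "inj_on \<psi> S"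
    and intL: "integrable lborel (\<lambda>x. if x \<in> \<psi> ` S then f x else 0)"
    and intR: "integrable lborel (\<lambda>x. if x \<in> S then \<bar>det (matrix (\<psi>' x))\<bar> * f (\<psi> x) else 0)"
  shows "(\<integral>x. (if x \<in> \<psi> ` S then f x else 0) \<partial>lborel)
    = (\<integral>x. (if x \<in> S then \<bar>det (matrix (\<psi>' x))\<bar> * f (\<psi> x) else 0) \<partial>lborel)"
proof -
  let ?S = "unreindex -` S" and ?\<psi> = "\<lambda>y. reindex (\<psi> (unreindex y))"
  let ?\<psi>' = "\<lambda>y v. reindex (\<psi>' (unreindex y) (unreindex v))"
  \<comment> \<open>Replaces a Lebesgue integral on the original space by a Henstock-Kurzweil
    integral on the relabelled one, where the change of variables theorem is stated.\<close>
  have transfer: "integrable lborel (\<lambda>y. u (unreindex y)) \<and> integral UNIV (\<lambda>y. u (unreindex y)) = (\<integral>x. u x \<partial>lborel)"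
    if "integrable lborel u" for u :: "real ^ 'a \<Rightarrow> real"
  proof -
    have m: "u \<in> borel_measurable borel" using that by auto
    have i: "integrable lborel (\<lambda>y. u (unreindex y))"
      by (rule integrable_distr[of unreindex lborel borel u]) (simp_all add: lborel_unreindex that)
    have "(\<integral>x. u x \<partial>distr lborel borel unreindex) = (\<integral>y. u (unreindex y) \<partial>lborel)"
      using m by (intro integral_distr) auto
    with i show ?thesis by (simp add: integral_lborel lborel_unreindex)
  qed
  have img: "?\<psi> ` ?S = unreindex -` (\<psi> ` S)"
  proof -
    have "unreindex ` ?S = S"
      by (rule surj_image_vimage_eq, rule surjI, rule unreindex_reindex)
    moreover have "reindex ` T = unreindex -` T" for T :: "(real ^ 'a) set"
      by (auto simp: image_iff) (metis reindex_unreindex)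
    ultimately show ?thesis by (metis image_image)
  qed
  have der': "(?\<psi> has_derivative ?\<psi>' y) (at y within ?S)" if "y \<in> ?S" for y
    using that
    by (intro bounded_linear.has_derivative[OF bounded_linear_reindex]
        has_derivative_compose[OF bounded_linear.has_derivative[OF bounded_linear_unreindex has_derivative_ident] der])
       auto
  have inj': "inj_on ?\<psi> ?S"
    by (rule inj_onI) (metis inj inj_onD reindex_unreindex unreindex_reindex vimageE)
  have "open ?S"
    by (intro open_vimage S bounded_linear.continuous_on[OF bounded_linear_unreindex] continuous_on_id)
  then have S': "?S \<in> sets lebesgue" by auto
  have det: "det (matrix (?\<psi>' y)) = det (matrix (\<psi>' (unreindex y)))" for y
  proof -
    have "unreindex (axis j 1) = axis (unindex j) 1" for j :: "'a ordered_index"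
      by (cases j) (auto simp: vec_eq_iff unreindex_def axis_def)
    then have "matrix (?\<psi>' y) = (\<chi> i j. matrix (\<psi>' (unreindex y)) $ unindex i $ unindex j)"
      by (simp add: matrix_def reindex_def)
    then show ?thesis by (simp add: det_reindex)
  qed
  have abs: "(\<lambda>y. f (unreindex y)) absolutely_integrable_on ?\<psi> ` ?S"
  proof -
    have "integrable lborel (\<lambda>y. if unreindex y \<in> \<psi> ` S then f (unreindex y) else 0)"
      using transfer[OF intL] by blast
    then have "(\<lambda>y. if y \<in> ?\<psi> ` ?S then f (unreindex y) else 0) absolutely_integrable_on UNIV"
      unfolding img set_integrable_def by (simp add: integrable_completion)
    then show ?thesis by (simp only: absolutely_integrable_restrict_UNIV)
  qed
  \<comment> \<open>The theorem treats vector-valued integrands, so \<open>f\<close> takes a detour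
    through \<open>real ^ 1\<close>.\<close>
  have "integral (?\<psi> ` ?S) (\<lambda>y. vec (f (unreindex y)) :: real ^ 1)
    = integral ?S (\<lambda>y. \<bar>det (matrix (?\<psi>' y))\<bar> *\<^sub>R vec (f (unreindex (?\<psi> y))))"
    by (rule integral_change_of_variables[OF S' der' inj'])
       (use abs in \<open>auto simp: absolutely_integrable_on_1_iff\<close>)
  then have eq: "integral (?\<psi> ` ?S) (\<lambda>y. f (unreindex y))
    = integral ?S (\<lambda>y. \<bar>det (matrix (?\<psi>' y))\<bar> * f (unreindex (?\<psi> y)))"
    by (simp add: integral_on_1_eq)
  have "(\<integral>x. (if x \<in> \<psi> ` S then f x else 0) \<partial>lborel)
    = integral UNIV (\<lambda>y. if y \<in> unreindex -` (\<psi> ` S) then f (unreindex y) else 0)"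
    using transfer[OF intL] by (simp only: vimage_eq)
  also have "\<dots> = integral (?\<psi> ` ?S) (\<lambda>y. f (unreindex y))"
    unfolding img by (rule integral_restrict_UNIV)
  also have "\<dots> = integral ?S (\<lambda>y. \<bar>det (matrix (\<psi>' (unreindex y)))\<bar> * f (\<psi> (unreindex y)))"
    using eq by (simp add: det)
  also have "\<dots> = integral UNIV (\<lambda>y. if y \<in> ?S then \<bar>det (matrix (\<psi>' (unreindex y)))\<bar> * f (\<psi> (unreindex y)) else 0)"
    by (rule integral_restrict_UNIV[symmetric])
  also have "\<dots> = (\<integral>x. (if x \<in> S then \<bar>det (matrix (\<psi>' x))\<bar> * f (\<psi> x) else 0) \<partial>lborel)"
    using transfer[OF intR] by (simp only: vimage_eq)
  finally show ?thesis .
qed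

section \<open>Christoffel symbols\<close>

lemma bilin_add_left: "bilin M (a + b) c = bilin M a c + bilin M b c"
  by (simp add: bilin_def inner_add_left)

lemma bilin_add_right: "bilin M a (b + c) = bilin M a b + bilin M a c"
  by (simp add: bilin_def matrix_vector_right_distrib inner_add_right)

lemma bilin_diff_left: "bilin M (a - b) c = bilin M a c - bilin M b c"
  by (simp add: bilin_def inner_diff_left)

lemma bilin_scaleR_left: "bilin M (r *\<^sub>R a) c = r * bilin M a c"
  by (simp add: bilin_def)

lemma bilin_scaleR_right: "bilin M a (r *\<^sub>R c) = r * bilin M a c"
  by (simp add: bilin_def matrix_vector_mult_scaleR)

lemma bilin_zero: "bilin M 0 c = 0" "bilin M a 0 = 0"
  by (simp_all add: bilin_def)

lemma bilin_sum_left: "bilin M (\<Sum>i\<in>I. a i) c = (\<Sum>i\<in>I. bilin M (a i) c)"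
  by (simp add: bilin_def inner_sum_left)

lemma bilin_commute:
  assumes "transpose M = M" shows "bilin M a b = bilin M b a"
  unfolding bilin_def by (metis assms dot_lmul_matrix inner_commute vector_transpose_matrix)

lemma frechet_derivative_const_0: "frechet_derivative (\<lambda>_. c) (at x) = (\<lambda>_. 0)"
  using frechet_derivative_at[OF has_derivative_const] by metis

text \<open>Metric compatibility for constant fields, whose covariant derivative is the Christoffel
  term alone.\<close>

lemma metric_derivative_christoffel:
  fixes G :: "real ^ 'n \<Rightarrow> real ^ 'n ^ 'n::finite"
  assumes "open S" "x \<in> S" "\<And>y. y \<in> S \<Longrightarrow> transpose (G y) = G y" "invertible (G x)"
    and "G differentiable (at x)"
  shows "bilin (frechet_derivative G (at x) u) v w
    = bilin (G x) (christoffel_form G x u v) w + bilin (G x) v (christoffel_form G x u w)"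
proof -
  have "((\<lambda>y. bilin (G y) v w) has_derivative (\<lambda>z. bilin (frechet_derivative G (at x) z) v w)) (at x)"
    using bilin_has_derivative[OF assms(5)[unfolded frechet_derivative_works] has_derivative_const[of v] has_derivative_const[of w]]
    by (simp add: bilin_zero)
  from frechet_derivative_at[OF this]
  have "bilin (frechet_derivative G (at x) u) v w = frechet_derivative (\<lambda>y. bilin (G y) v w) (at x) u"
    by metis
  also have "\<dots> = bilin (G x) (christoffel_form G x u v) w + bilin (G x) v (christoffel_form G x u w)"
    using levi_civita_metric[of S x G "\<lambda>_. v" "\<lambda>_. w" "\<lambda>_. u", OF assms]
    by (simp add: levi_civita_def frechet_derivative_const_0)
  finally show ?thesis .
qed

lemma christoffel_form_commute:
  fixes G :: "real ^ 'n \<Rightarrow> real ^ 'n ^ 'n::finite"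
  assumes "open S" "x \<in> S" "\<And>y. y \<in> S \<Longrightarrow> transpose (G y) = G y" "G differentiable (at x)"
  shows "christoffel_form G x u v = christoffel_form G x v u"
  using levi_civita_torsion_free[of S x G "\<lambda>_. u" "\<lambda>_. v", OF assms]
  by (simp add: levi_civita_def bracket_def frechet_derivative_const_0)

lemma christoffel_form_axis: "christoffel_form G x (axis i 1) (axis j 1) $ k = christoffel G x k i j"
proof -
  have "(\<Sum>b\<in>UNIV. christoffel G x k a b * axis i 1 $ a * axis j 1 $ b)
    = (if a = i then christoffel G x k i j else 0)" for a
    by (simp add: axis_def if_distrib sum.delta cong: if_cong)
  then show ?thesis by (simp add: christoffel_form_def)
qed

text \<open>This is the identity (L_xi h)(u,v) = h(nabla_u xi, v) + h(u, nabla_v xi). For constant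
  \<open>u\<close> the bracket with \<open>\<xi>\<close> is minus the derivative of
  \<open>\<xi>\<close> along \<open>u\<close>, and the derivative of \<open>H\<close> along
  \<open>\<xi>\<close> supplies the Christoffel terms.\<close>

lemma lie_derivative_christoffel:
  fixes H :: "real ^ 'n \<Rightarrow> real ^ 'n ^ 'n::finite"
  assumes "open S" "y \<in> S" "\<And>y. y \<in> S \<Longrightarrow> transpose (H y) = H y" "invertible (H y)"
    and "H differentiable (at y)"
  shows "lie_derivative \<xi> H (\<lambda>_. u) (\<lambda>_. v) y
    = bilin (H y) (frechet_derivative \<xi> (at y) u + christoffel_form H y (\<xi> y) u) v
    + bilin (H y) u (frechet_derivative \<xi> (at y) v + christoffel_form H y (\<xi> y) v)"
proof -
  have "frechet_derivative (\<lambda>y. bilin (H y) u v) (at y) (\<xi> y)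
    = bilin (H y) (christoffel_form H y (\<xi> y) u) v + bilin (H y) u (christoffel_form H y (\<xi> y) v)"
    using levi_civita_metric[of S y H "\<lambda>_. u" "\<lambda>_. v" \<xi>, OF assms]
    by (simp add: levi_civita_def frechet_derivative_const_0)
  moreover have "bilin (H y) (- a) b = - bilin (H y) a b" "bilin (H y) b (- a) = - bilin (H y) b a" for a b
    using bilin_scaleR_left[of "H y" "-1" a b] bilin_scaleR_right[of "H y" b "-1" a] by simp_all
  ultimately show ?thesis
    by (simp add: lie_derivative_def bracket_def frechet_derivative_const_0 bilin_add_left bilin_add_right)
qed

text \<open>With \<open>d i a b\<close> for $\partial_i g_{ab}$ this is $\frac1{\sqrt g}\partial_i(\sqrt g\, g^{ij}) = - g^{kl}\Gamma^j_{kl}$.\<close>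

lemma christoffel_trace:
  fixes p :: "'a::finite \<Rightarrow> 'a \<Rightarrow> real" and d :: "'a \<Rightarrow> 'a \<Rightarrow> 'a \<Rightarrow> real"
  assumes p: "\<And>i j. p i j = p j i" and d: "\<And>i a b. d i a b = d i b a"
  shows "(\<Sum>i\<in>UNIV. (\<Sum>a\<in>UNIV. \<Sum>b\<in>UNIV. p a b * d i b a) / 2 * p i j - (\<Sum>a\<in>UNIV. \<Sum>b\<in>UNIV. p i a * d i a b * p b j))
    = - (\<Sum>k\<in>UNIV. \<Sum>l\<in>UNIV. p k l * ((\<Sum>m\<in>UNIV. p j m * (d k l m + d l k m - d m k l)) / 2))"
proof -
  \<comment> \<open>Both positive Christoffel terms contract to \<open>X\<close>, which also comes
    from differentiating the inverse metric; the negative one contracts to \<open>Y\<close>, which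
    comes from differentiating sqrt(det g).\<close>
  define X where "X = (\<Sum>i\<in>UNIV. \<Sum>a\<in>UNIV. \<Sum>b\<in>UNIV. p i a * d i a b * p b j)"
  define Y where "Y = (\<Sum>i\<in>UNIV. \<Sum>a\<in>UNIV. \<Sum>b\<in>UNIV. p a b * d i b a * p i j)"
  have X1: "(\<Sum>k\<in>UNIV. \<Sum>l\<in>UNIV. \<Sum>m\<in>UNIV. p k l * (p j m * d k l m)) = X"
    unfolding X_def by (intro sum.cong refl) (simp add: p[of j])
  have X2: "(\<Sum>k\<in>UNIV. \<Sum>l\<in>UNIV. \<Sum>m\<in>UNIV. p k l * (p j m * d l k m)) = X"
    unfolding X1[symmetric] by (subst sum.swap) (intro sum.cong refl, simp add: p)
  have "(\<Sum>k\<in>UNIV. \<Sum>l\<in>UNIV. \<Sum>m\<in>UNIV. p k l * (p j m * d m k l))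
    = (\<Sum>k\<in>UNIV. \<Sum>m\<in>UNIV. \<Sum>l\<in>UNIV. p k l * (p j m * d m k l))"
    by (rule sum.cong[OF refl], rule sum.swap)
  also have "\<dots> = (\<Sum>m\<in>UNIV. \<Sum>k\<in>UNIV. \<Sum>l\<in>UNIV. p k l * (p j m * d m k l))"
    by (rule sum.swap)
  also have "\<dots> = Y"
    unfolding Y_def by (intro sum.cong refl) (simp add: p[of j] d)
  finally have Y1: "(\<Sum>k\<in>UNIV. \<Sum>l\<in>UNIV. \<Sum>m\<in>UNIV. p k l * (p j m * d m k l)) = Y" .
  have "(\<Sum>k\<in>UNIV. \<Sum>l\<in>UNIV. p k l * ((\<Sum>m\<in>UNIV. p j m * (d k l m + d l k m - d m k l)) / 2))
    = ((\<Sum>k\<in>UNIV. \<Sum>l\<in>UNIV. \<Sum>m\<in>UNIV. p k l * (p j m * d k l m))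
      + (\<Sum>k\<in>UNIV. \<Sum>l\<in>UNIV. \<Sum>m\<in>UNIV. p k l * (p j m * d l k m))
      - (\<Sum>k\<in>UNIV. \<Sum>l\<in>UNIV. \<Sum>m\<in>UNIV. p k l * (p j m * d m k l))) / 2"
    unfolding sum.distrib[symmetric] sum_subtractf[symmetric] sum_divide_distrib sum_distrib_left
    by (intro sum.cong refl) (simp add: algebra_simps)
  also have "\<dots> = X - Y / 2" unfolding X1 X2 Y1 by simp
  finally show ?thesis
    by (simp add: X_def Y_def sum_subtractf sum_divide_distrib sum_distrib_right)
qed

text \<open>Differentiability is known from Cramer's rule. Differentiating the constant product of
  inverse and matrix, and multiplying by the inverse on the right, then gives the formula.\<close>

lemma matrix_inv_has_derivative:
  fixes G :: "real ^ 'm \<Rightarrow> real ^ 'n ^ 'n::finite"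
  assumes "open S" "x \<in> S" "C1_on S G" "\<And>x. x \<in> S \<Longrightarrow> invertible (G x)"
  shows "((\<lambda>y. matrix_inv (G y) $ i $ j) has_derivative
    (\<lambda>v. - (\<Sum>a\<in>UNIV. \<Sum>b\<in>UNIV. matrix_inv (G x) $ i $ a * frechet_derivative G (at x) v $ a $ b * matrix_inv (G x) $ b $ j))) (at x)"
proof -
  let ?P = "\<lambda>y. matrix_inv (G y)" and ?D = "frechet_derivative G (at x)"
  let ?DP = "frechet_derivative (\<lambda>y. matrix_inv (G y)) (at x)"
  have G: "(G has_derivative ?D) (at x)" and P: "(?P has_derivative ?DP) (at x)"
    using C1_on_has_derivative C1_on_matrix_inv assms by blast+
  have "?DP v = - (?P x ** ?D v ** ?P x)" for v
  proof -
    have "?DP v ** G x + ?P x ** ?D v = 0"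
    proof (intro iffD2[OF vec_eq_iff] allI)
      fix i j
      have "((\<lambda>y. \<Sum>k\<in>UNIV. ?P y $ i $ k * G y $ k $ j) has_derivative
          (\<lambda>v. \<Sum>k\<in>UNIV. ?P x $ i $ k * ?D v $ k $ j + ?DP v $ i $ k * G x $ k $ j)) (at x)"
        by (intro has_derivative_sum has_derivative_mult has_derivative_entry[OF G] has_derivative_entry[OF P])
      moreover have "((\<lambda>y. \<Sum>k\<in>UNIV. ?P y $ i $ k * G y $ k $ j) has_derivative (\<lambda>v. 0)) (at x)"
      proof (rule has_derivative_transform_within_open[OF has_derivative_const assms(1,2)])
        fix y assume "y \<in> S"
        then have "(?P y ** G y) $ i $ j = mat 1 $ i $ j" by (simp add: matrix_inv_inverse(2) assms(4))
        then show "mat 1 $ i $ j = (\<Sum>k\<in>UNIV. ?P y $ i $ k * G y $ k $ j)"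
          by (simp add: matrix_matrix_mult_def)
      qed
      ultimately have "(\<lambda>v. \<Sum>k\<in>UNIV. ?P x $ i $ k * ?D v $ k $ j + ?DP v $ i $ k * G x $ k $ j) = (\<lambda>v. 0)"
        by (rule has_derivative_unique)
      then show "(?DP v ** G x + ?P x ** ?D v) $ i $ j = 0 $ i $ j"
        by (simp add: matrix_matrix_mult_def fun_eq_iff sum.distrib add.commute)
    qed
    then have "(?DP v ** G x + ?P x ** ?D v) ** ?P x = 0" by simp
    moreover have "(A + B) ** C = A ** C + B ** C" for A B C :: "real ^ 'n ^ 'n"
      by (simp add: vec_eq_iff matrix_matrix_mult_def sum.distrib distrib_right)
    ultimately have "?DP v ** (G x ** ?P x) + ?P x ** ?D v ** ?P x = 0"
      by (simp add: matrix_mul_assoc)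
    then show ?thesis
      using matrix_inv_inverse(1)[OF assms(4)[OF assms(2)]] by (simp add: eq_neg_iff_add_eq_0)
  qed
  moreover have "(?P x ** ?D v ** ?P x) $ i $ j = (\<Sum>a\<in>UNIV. \<Sum>b\<in>UNIV. ?P x $ i $ a * ?D v $ a $ b * ?P x $ b $ j)" for v
    by (simp add: matrix_matrix_mult_def sum_distrib_right, rule sum.swap)
  ultimately show ?thesis
    using has_derivative_entry[OF P, of i j] by simp
qed

section \<open>The divergence of the one-form in a chart\<close>

definition volume_density :: "(real ^ 'a \<Rightarrow> real ^ 'a ^ 'a) \<Rightarrow> real ^ 'a::finite \<Rightarrow> real" where
  "volume_density G x = sqrt (det (G x))"

text \<open>The components of the one-form $X \mapsto h(d\varphi(X), \xi \circ \varphi)$.\<close>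

definition pullback_form ::
  "(real ^ 'b \<Rightarrow> real ^ 'b ^ 'b) \<Rightarrow> (real ^ 'b \<Rightarrow> real ^ 'b) \<Rightarrow> (real ^ 'a \<Rightarrow> real ^ 'b)
    \<Rightarrow> real ^ 'a::finite \<Rightarrow> real ^ 'a" where
  "pullback_form H \<xi> f x = (\<chi> j. bilin (H (f x)) (frechet_derivative f (at x) (axis j 1)) (\<xi> (f x)))"

text \<open>For harmonic \<open>f\<close> this is the divergence of \<open>pullback_form\<close>.\<close>

definition pullback_lie_trace ::
  "(real ^ 'a \<Rightarrow> real ^ 'a ^ 'a) \<Rightarrow> (real ^ 'b \<Rightarrow> real ^ 'b ^ 'b) \<Rightarrow> (real ^ 'b \<Rightarrow> real ^ 'b) \<Rightarrow> (real ^ 'a \<Rightarrow> real ^ 'b)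
    \<Rightarrow> real ^ 'a::finite \<Rightarrow> real" where
  "pullback_lie_trace G H \<xi> f x = (\<Sum>i\<in>UNIV. \<Sum>j\<in>UNIV. matrix_inv (G x) $ i $ j *
     (1 / 2 * lie_derivative \<xi> H (\<lambda>_. frechet_derivative f (at x) (axis i 1))
        (\<lambda>_. frechet_derivative f (at x) (axis j 1)) (f x)))"

text \<open>What a Riemannian metric provides inside a single chart, without the transformation law;
  it serves for source and target alike.\<close>

definition local_metric :: "(real ^ 'n) set \<Rightarrow> (real ^ 'n \<Rightarrow> real ^ 'n ^ 'n::finite) \<Rightarrow> bool" where
  "local_metric S G \<longleftrightarrow> open S \<and> smooth_on S G \<and>
     (\<forall>x\<in>S. transpose (G x) = G x \<and> (\<forall>v. v \<noteq> 0 \<longrightarrow> bilin (G x) v v > 0))"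

context
  fixes S :: "(real ^ 'n::finite) set" and G :: "real ^ 'n \<Rightarrow> real ^ 'n ^ 'n"
  assumes G: "local_metric S G"
begin

lemma local_metric_open: "open S"
  and local_metric_smooth: "smooth_on S G"
  and local_metric_transpose: "x \<in> S \<Longrightarrow> transpose (G x) = G x"
  and local_metric_pos: "x \<in> S \<Longrightarrow> v \<noteq> 0 \<Longrightarrow> bilin (G x) v v > 0"
  using G by (auto simp: local_metric_def)

lemma local_metric_C1: "C1_on S G"
  by (rule smooth_on_imp_C1_on[OF local_metric_smooth])

lemma local_metric_invertible: "x \<in> S \<Longrightarrow> invertible (G x)"
  by (rule positive_definite_invertible) (rule local_metric_pos)

lemma local_metric_det_pos: "x \<in> S \<Longrightarrow> det (G x) > 0"
  by (rule positive_definite_det_pos) (auto intro: local_metric_transpose local_metric_pos)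

lemma local_metric_inv_symmetric:
  assumes "x \<in> S" shows "matrix_inv (G x) $ i $ j = matrix_inv (G x) $ j $ i"
proof -
  have "transpose (matrix_inv (G x)) = matrix_inv (G x)"
    using assms by (intro matrix_inv_transpose local_metric_invertible local_metric_transpose)
  from arg_cong[OF this, of "\<lambda>M. M $ j $ i"] show ?thesis by (simp add: transpose_def)
qed

lemma local_metric_inv_C1: "C1_on S (\<lambda>x. matrix_inv (G x))"
  by (rule C1_on_matrix_inv[OF local_metric_open local_metric_C1 local_metric_invertible])

lemma volume_density_pos: "x \<in> S \<Longrightarrow> volume_density G x > 0"
  by (simp add: volume_density_def local_metric_det_pos)

lemma volume_density_C1: "C1_on S (volume_density G)"
  unfolding volume_density_def
  by (intro C1_on_sqrt C1_on_det C1_on_nth local_metric_C1 local_metric_det_pos)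

text \<open>Jacobi's formula followed by the square root; det / sqrt(det) = sqrt(det) brings the
  result into the form of a logarithmic derivative.\<close>

lemma volume_density_has_derivative:
  assumes "x \<in> S"
  shows "(volume_density G has_derivative (\<lambda>v. volume_density G x *
    ((\<Sum>a\<in>UNIV. \<Sum>b\<in>UNIV. matrix_inv (G x) $ a $ b * frechet_derivative G (at x) v $ b $ a) / 2))) (at x)"
proof -
  let ?tr = "\<lambda>v. \<Sum>a\<in>UNIV. \<Sum>b\<in>UNIV. matrix_inv (G x) $ a $ b * frechet_derivative G (at x) v $ b $ a"
  note pos = local_metric_det_pos[OF assms]
  have "((\<lambda>y. det (G y)) has_derivative (\<lambda>v. det (G x) * ?tr v)) (at x)"
    by (rule det_has_derivative[OF has_derivative_entry[OF C1_on_has_derivative[OF local_metric_C1 assms]]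
          local_metric_invertible[OF assms]])
  moreover have "(sqrt has_derivative (*) (inverse (sqrt (det (G x))) / 2)) (at (det (G x)))"
    using DERIV_real_sqrt[OF pos] by (simp add: has_field_derivative_def)
  ultimately have "((\<lambda>y. sqrt (det (G y))) has_derivative
      (\<lambda>v. inverse (sqrt (det (G x))) / 2 * (det (G x) * ?tr v))) (at x)"
    by (rule has_derivative_compose)
  moreover have "inverse (sqrt (det (G x))) / 2 * (det (G x) * t) = sqrt (det (G x)) * (t / 2)" for t
  proof -
    have "det (G x) = sqrt (det (G x)) * sqrt (det (G x))" using pos by simp
    then have "inverse (sqrt (det (G x))) * det (G x) = sqrt (det (G x))"
      using pos by (metis divide_inverse_commute nonzero_eq_divide_eq real_sqrt_eq_zero_cancel_iff less_irrefl)
    then show ?thesis by (metis (no_types) mult.assoc times_divide_eq_left times_divide_eq_right mult.commute)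
  qed
  ultimately show ?thesis unfolding volume_density_def[abs_def] by (simp only:)
qed

text \<open>The product rule yields one trace from the density and one from the inverse metric, and
  \<open>christoffel_trace\<close> combines them. The right-hand side contains the same contracted
  symbol as the tension field, so that the two can cancel in \<open>divergence\<close>.\<close>

lemma divergence_metric:
  assumes "x \<in> S"
  shows "(\<Sum>i\<in>UNIV. frechet_derivative (\<lambda>y. volume_density G y * matrix_inv (G y) $ i $ j) (at x) (axis i 1))
    = - volume_density G x * (\<Sum>k\<in>UNIV. \<Sum>l\<in>UNIV. matrix_inv (G x) $ k $ l * christoffel G x j k l)"
proof -
  let ?P = "matrix_inv (G x)" and ?D = "frechet_derivative G (at x)" and ?w = "volume_density G x"
  let ?d = "\<lambda>i a b. ?D (axis i 1) $ a $ b"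
  have diff: "G differentiable (at x)" using local_metric_C1 assms by auto
  have sym: "?d i a b = ?d i b a" for i a b
    by (rule metric_derivative_symmetric[OF local_metric_open assms local_metric_transpose diff])
  have d: "((\<lambda>y. volume_density G y * matrix_inv (G y) $ i $ j) has_derivative
    (\<lambda>v. ?w * - (\<Sum>a\<in>UNIV. \<Sum>b\<in>UNIV. ?P $ i $ a * ?D v $ a $ b * ?P $ b $ j)
      + ?w * ((\<Sum>a\<in>UNIV. \<Sum>b\<in>UNIV. ?P $ a $ b * ?D v $ b $ a) / 2) * ?P $ i $ j)) (at x)" for i
    by (intro has_derivative_mult volume_density_has_derivative assms
        matrix_inv_has_derivative[OF local_metric_open assms local_metric_C1 local_metric_invertible])
  have "frechet_derivative (\<lambda>y. volume_density G y * matrix_inv (G y) $ i $ j) (at x) (axis i 1)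
    = ?w * ((\<Sum>a\<in>UNIV. \<Sum>b\<in>UNIV. ?P $ a $ b * ?d i b a) / 2 * ?P $ i $ j
        - (\<Sum>a\<in>UNIV. \<Sum>b\<in>UNIV. ?P $ i $ a * ?d i a b * ?P $ b $ j))" for i
    using fun_cong[OF frechet_derivative_at[OF d[of i], symmetric], of "axis i 1"] by (simp add: algebra_simps)
  then have "(\<Sum>i\<in>UNIV. frechet_derivative (\<lambda>y. volume_density G y * matrix_inv (G y) $ i $ j) (at x) (axis i 1))
    = ?w * (\<Sum>i\<in>UNIV. (\<Sum>a\<in>UNIV. \<Sum>b\<in>UNIV. ?P $ a $ b * ?d i b a) / 2 * ?P $ i $ j
        - (\<Sum>a\<in>UNIV. \<Sum>b\<in>UNIV. ?P $ i $ a * ?d i a b * ?P $ b $ j))"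
    by (simp only: sum_distrib_left)
  also have "\<dots> = - ?w * (\<Sum>k\<in>UNIV. \<Sum>l\<in>UNIV. ?P $ k $ l * christoffel G x j k l)"
    unfolding christoffel_trace[of "\<lambda>i j. ?P $ i $ j" ?d, OF local_metric_inv_symmetric[OF assms] sym] christoffel_def
    by simp
  finally show ?thesis .
qed

end

text \<open>The local computation for one pair of charts: \<open>S\<close> and \<open>T\<close> are
  open coordinate domains in source and target, and \<open>f\<close> is the map in these
  coordinates.\<close>

locale harmonic_chart =
  fixes S :: "(real ^ 'a::finite) set" and T :: "(real ^ 'b::finite) set"
    and G :: "real ^ 'a \<Rightarrow> real ^ 'a ^ 'a" and H :: "real ^ 'b \<Rightarrow> real ^ 'b ^ 'b"
    and \<xi> :: "real ^ 'b \<Rightarrow> real ^ 'b" and f :: "real ^ 'a \<Rightarrow> real ^ 'b"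
  assumes metric_G: "local_metric S G" and metric_H: "local_metric T H"
    and smooth_\<xi>: "smooth_on T \<xi>" and smooth_f: "smooth_on S f" and f_image: "f ` S \<subseteq> T"
    and harmonic: "\<And>x. x \<in> S \<Longrightarrow> tension G H f x = 0"
begin

abbreviation df where "df x v \<equiv> frechet_derivative f (at x) v"
abbreviation P where "P x \<equiv> matrix_inv (G x)"
abbreviation \<theta> where "\<theta> \<equiv> pullback_form H \<xi> f"

lemma f_in: "x \<in> S \<Longrightarrow> f x \<in> T" using f_image by blast

lemma df_linear: "x \<in> S \<Longrightarrow> linear (frechet_derivative f (at x))"
  by (rule has_derivative_linear[OF C1_on_has_derivative[OF smooth_on_imp_C1_on[OF smooth_f]]])

lemma pullback_form_C1: "C1_on S \<theta>"
  unfolding pullback_form_def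
proof (rule C1_on_vecI, simp only: vec_lambda_beta)
  fix i
  note f = smooth_on_imp_C1_on[OF smooth_f]
  show "C1_on S (\<lambda>x. bilin (H (f x)) (df x (axis i 1)) (\<xi> (f x)))"
    by (intro C1_on_bilin smooth_on_derivative_C1_on[OF smooth_f]
        C1_on_compose[OF local_metric_C1[OF metric_H] f f_image]
        C1_on_compose[OF smooth_on_imp_C1_on[OF smooth_\<xi>] f f_image])
qed

text \<open>Metric compatibility of \<open>H\<close> splits the derivative of the metric into two
  Christoffel terms. One completes the derivative of \<open>df\<close> to the pull-back connection,
  the other completes the derivative of \<open>\<xi>\<close> to its covariant derivative; the
  symmetry of the symbols puts \<open>\<xi>\<close> in the slot used by
  \<open>lie_derivative_form\<close>.\<close>

lemma pullback_form_has_derivative: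
  assumes x: "x \<in> S"
  shows "((\<lambda>y. \<theta> y $ j) has_derivative (\<lambda>v.
      bilin (H (f x)) (pullback_connection H f (\<lambda>_. v) (\<lambda>y. df y (axis j 1)) x) (\<xi> (f x))
    + bilin (H (f x)) (df x (axis j 1)) (frechet_derivative \<xi> (at (f x)) (df x v) + christoffel_form H (f x) (\<xi> (f x)) (df x v)))) (at x)"
proof -
  note f = C1_on_has_derivative[OF smooth_on_imp_C1_on[OF smooth_f] x]
  note C1H = local_metric_C1[OF metric_H]
  have diffH: "H differentiable (at (f x))" using C1H f_in[OF x] by auto
  have "((\<lambda>y. bilin (H (f y)) (df y (axis j 1)) (\<xi> (f y))) has_derivative (\<lambda>v.
      bilin (frechet_derivative H (at (f x)) (df x v)) (df x (axis j 1)) (\<xi> (f x))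
    + bilin (H (f x)) (frechet_derivative (\<lambda>y. df y (axis j 1)) (at x) v) (\<xi> (f x))
    + bilin (H (f x)) (df x (axis j 1)) (frechet_derivative \<xi> (at (f x)) (df x v)))) (at x)"
    by (intro bilin_has_derivative C1_on_has_derivative[OF smooth_on_derivative_C1_on[OF smooth_f] x]
        has_derivative_compose[OF f] C1_on_has_derivative[OF C1H f_in[OF x]]
        C1_on_has_derivative[OF smooth_on_imp_C1_on[OF smooth_\<xi>] f_in[OF x]])
  then have "((\<lambda>y. \<theta> y $ j) has_derivative (\<lambda>v.
      bilin (frechet_derivative H (at (f x)) (df x v)) (df x (axis j 1)) (\<xi> (f x))
    + bilin (H (f x)) (frechet_derivative (\<lambda>y. df y (axis j 1)) (at x) v) (\<xi> (f x))
    + bilin (H (f x)) (df x (axis j 1)) (frechet_derivative \<xi> (at (f x)) (df x v)))) (at x)"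
    by (simp add: pullback_form_def)
  then show ?thesis
  proof (rule has_derivative_eq_rhs, intro ext)
    fix v
    have "christoffel_form H (f x) (\<xi> (f x)) (df x v) = christoffel_form H (f x) (df x v) (\<xi> (f x))"
      by (rule christoffel_form_commute[of T "f x" H, OF local_metric_open[OF metric_H] f_in[OF x]
            local_metric_transpose[OF metric_H] diffH])
    then show "bilin (frechet_derivative H (at (f x)) (df x v)) (df x (axis j 1)) (\<xi> (f x))
        + bilin (H (f x)) (frechet_derivative (\<lambda>y. df y (axis j 1)) (at x) v) (\<xi> (f x))
        + bilin (H (f x)) (df x (axis j 1)) (frechet_derivative \<xi> (at (f x)) (df x v))
      = bilin (H (f x)) (pullback_connection H f (\<lambda>_. v) (\<lambda>y. df y (axis j 1)) x) (\<xi> (f x))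
        + bilin (H (f x)) (df x (axis j 1)) (frechet_derivative \<xi> (at (f x)) (df x v) + christoffel_form H (f x) (\<xi> (f x)) (df x v))"
      by (simp add: pullback_connection_def bilin_add_left bilin_add_right
          metric_derivative_christoffel[of T "f x" H, OF local_metric_open[OF metric_H] f_in[OF x]
            local_metric_transpose[OF metric_H] local_metric_invertible[OF metric_H f_in[OF x]] diffH])
  qed
qed

text \<open>The equation tau = 0 paired with \<open>\<xi>\<close>: second derivatives of
  \<open>f\<close> are traded for Christoffel symbols of \<open>G\<close>. This is where harmonicity
  enters.\<close>

lemma harmonic_paired:
  assumes x: "x \<in> S"
  shows "(\<Sum>i\<in>UNIV. \<Sum>j\<in>UNIV. P x $ i $ j *
      bilin (H (f x)) (pullback_connection H f (coord_field i) (\<lambda>y. df y (axis j 1)) x) (\<xi> (f x)))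
    = (\<Sum>k\<in>UNIV. (\<Sum>i\<in>UNIV. \<Sum>j\<in>UNIV. P x $ i $ j * christoffel G x k i j) * \<theta> x $ k)"
proof -
  let ?h = "\<lambda>u. bilin (H (f x)) u (\<xi> (f x))"
  let ?N = "\<lambda>i j. pullback_connection H f (coord_field i) (\<lambda>y. df y (axis j 1)) x"
  have "second_fundamental_form G H f (coord_field i) (coord_field j) x
    = ?N i j - df x (christoffel_form G x (axis i 1) (axis j 1))" for i j
    by (simp add: second_fundamental_form_def coord_field_def levi_civita_def frechet_derivative_const_0)
  then have "(\<Sum>i\<in>UNIV. \<Sum>j\<in>UNIV. P x $ i $ j * ?h (?N i j - df x (christoffel_form G x (axis i 1) (axis j 1)))) = ?h (tension G H f x)"
    by (simp add: tension_def bilin_sum_left bilin_scaleR_left)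
  then have "(\<Sum>i\<in>UNIV. \<Sum>j\<in>UNIV. P x $ i $ j * ?h (?N i j))
    = (\<Sum>i\<in>UNIV. \<Sum>j\<in>UNIV. P x $ i $ j * ?h (df x (christoffel_form G x (axis i 1) (axis j 1))))"
    by (simp add: harmonic[OF x] bilin_zero bilin_diff_left right_diff_distrib sum_subtractf)
  also have "\<dots> = (\<Sum>i\<in>UNIV. \<Sum>j\<in>UNIV. \<Sum>k\<in>UNIV. P x $ i $ j * christoffel G x k i j * \<theta> x $ k)"
    by (subst linear_axis_sum[OF df_linear[OF x]])
       (simp add: christoffel_form_axis bilin_sum_left bilin_scaleR_left sum_distrib_left pullback_form_def mult.assoc)
  also have "\<dots> = (\<Sum>i\<in>UNIV. \<Sum>k\<in>UNIV. \<Sum>j\<in>UNIV. P x $ i $ j * christoffel G x k i j * \<theta> x $ k)"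
    by (rule sum.cong[OF refl], rule sum.swap)
  also have "\<dots> = (\<Sum>k\<in>UNIV. \<Sum>i\<in>UNIV. \<Sum>j\<in>UNIV. P x $ i $ j * christoffel G x k i j * \<theta> x $ k)"
    by (rule sum.swap)
  finally show ?thesis by (simp add: sum_distrib_right)
qed

lemma lie_derivative_form:
  assumes x: "x \<in> S"
  shows "lie_derivative \<xi> H (\<lambda>_. u) (\<lambda>_. v) (f x)
    = bilin (H (f x)) (frechet_derivative \<xi> (at (f x)) u + christoffel_form H (f x) (\<xi> (f x)) u) v
    + bilin (H (f x)) u (frechet_derivative \<xi> (at (f x)) v + christoffel_form H (f x) (\<xi> (f x)) v)"
  by (rule lie_derivative_christoffel[of T "f x" H, OF local_metric_open[OF metric_H] f_in[OF x] local_metric_transpose[OF metric_H]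
        local_metric_invertible[OF metric_H f_in[OF x]]])
     (use local_metric_C1[OF metric_H] f_in[OF x] in auto)

text \<open>The inverse metric is symmetric, so contraction with it sees only the symmetric part of
  the covariant derivative of \<open>\<xi>\<close>, and that is half the Lie derivative.\<close>

lemma pullback_lie_trace_eq:
  assumes x: "x \<in> S"
  shows "(\<Sum>i\<in>UNIV. \<Sum>j\<in>UNIV. P x $ i $ j * bilin (H (f x)) (df x (axis j 1))
      (frechet_derivative \<xi> (at (f x)) (df x (axis i 1)) + christoffel_form H (f x) (\<xi> (f x)) (df x (axis i 1))))
    = pullback_lie_trace G H \<xi> f x"
proof -
  define A where "A u = frechet_derivative \<xi> (at (f x)) u + christoffel_form H (f x) (\<xi> (f x)) u" for u
  define e where "e i = df x (axis i 1)" for i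
  note com = bilin_commute[OF local_metric_transpose[OF metric_H f_in[OF x]]]
  have "(\<Sum>i\<in>UNIV. \<Sum>j\<in>UNIV. P x $ i $ j * bilin (H (f x)) (e i) (A (e j)))
    = (\<Sum>j\<in>UNIV. \<Sum>i\<in>UNIV. P x $ i $ j * bilin (H (f x)) (e i) (A (e j)))"
    by (rule sum.swap)
  also have "\<dots> = (\<Sum>i\<in>UNIV. \<Sum>j\<in>UNIV. P x $ i $ j * bilin (H (f x)) (e j) (A (e i)))"
    by (intro sum.cong refl arg_cong2[of _ _ _ _ "(*)"] local_metric_inv_symmetric[OF metric_G x])
  finally have sw: "(\<Sum>i\<in>UNIV. \<Sum>j\<in>UNIV. P x $ i $ j * bilin (H (f x)) (e i) (A (e j)))
    = (\<Sum>i\<in>UNIV. \<Sum>j\<in>UNIV. P x $ i $ j * bilin (H (f x)) (e j) (A (e i)))" .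
  have "pullback_lie_trace G H \<xi> f x
    = (\<Sum>i\<in>UNIV. \<Sum>j\<in>UNIV. P x $ i $ j * (1 / 2 * (bilin (H (f x)) (e j) (A (e i)) + bilin (H (f x)) (e i) (A (e j)))))"
    unfolding pullback_lie_trace_def lie_derivative_form[OF x] A_def[symmetric] e_def[symmetric]
    by (simp add: com[of "A _" "e _"])
  also have "\<dots> = 1 / 2 * ((\<Sum>i\<in>UNIV. \<Sum>j\<in>UNIV. P x $ i $ j * bilin (H (f x)) (e j) (A (e i)))
      + (\<Sum>i\<in>UNIV. \<Sum>j\<in>UNIV. P x $ i $ j * bilin (H (f x)) (e i) (A (e j))))"
    by (simp add: sum_distrib_left distrib_left sum.distrib sum_divide_distrib add_divide_distrib)
  finally show ?thesis unfolding sw by (simp add: A_def e_def)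
qed

text \<open>The contracted Christoffel symbols from \<open>divergence_metric\<close> and
  \<open>harmonic_paired\<close> cancel, which leaves the trace of the Lie derivative; the cut-off
  \<open>\<rho>\<close> adds its derivative along the dual vector of
  \<open>\<theta>\<close>.\<close>

lemma divergence:
  assumes x: "x \<in> S" and \<rho>: "C1_on S \<rho>"
  shows "(\<Sum>i\<in>UNIV. frechet_derivative (\<lambda>y. \<rho> y * (volume_density G y * (P y *v \<theta> y) $ i)) (at x) (axis i 1))
    = volume_density G x * (\<rho> x * pullback_lie_trace G H \<xi> f x
      + (\<Sum>i\<in>UNIV. (P x *v \<theta> x) $ i * frechet_derivative \<rho> (at x) (axis i 1)))"
proof -
  let ?w = "volume_density G"
  let ?W = "\<lambda>i j. frechet_derivative (\<lambda>y. ?w y * P y $ i $ j) (at x)"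
  let ?N = "\<lambda>i j. bilin (H (f x)) (pullback_connection H f (\<lambda>_. i) (\<lambda>y. df y (axis j 1)) x) (\<xi> (f x))"
  let ?L = "\<lambda>i j. bilin (H (f x)) (df x (axis j 1)) (frechet_derivative \<xi> (at (f x)) (df x i) + christoffel_form H (f x) (\<xi> (f x)) (df x i))"
  have W: "((\<lambda>y. ?w y * P y $ i $ j) has_derivative ?W i j) (at x)" for i j
    by (intro C1_on_has_derivative[OF _ x] C1_on_mult volume_density_C1[OF metric_G]
        C1_on_nth local_metric_inv_C1[OF metric_G])
  have "((\<lambda>y. \<rho> y * (\<Sum>j\<in>UNIV. (?w y * P y $ i $ j) * \<theta> y $ j)) has_derivative (\<lambda>v.
      \<rho> x * (\<Sum>j\<in>UNIV. (?w x * P x $ i $ j) * (?N v j + ?L v j) + ?W i j v * \<theta> x $ j)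
      + frechet_derivative \<rho> (at x) v * (\<Sum>j\<in>UNIV. (?w x * P x $ i $ j) * \<theta> x $ j))) (at x)" for i
    by (intro has_derivative_mult has_derivative_sum W pullback_form_has_derivative[OF x] C1_on_has_derivative[OF \<rho> x])
  moreover have e: "(\<Sum>j\<in>UNIV. (?w y * P y $ i $ j) * \<theta> y $ j) = ?w y * (P y *v \<theta> y) $ i" for y i
    by (simp add: matrix_vector_mult_def sum_distrib_left mult.assoc)
  ultimately have d: "((\<lambda>y. \<rho> y * (?w y * (P y *v \<theta> y) $ i)) has_derivative (\<lambda>v.
      \<rho> x * (\<Sum>j\<in>UNIV. (?w x * P x $ i $ j) * (?N v j + ?L v j) + ?W i j v * \<theta> x $ j)
      + frechet_derivative \<rho> (at x) v * (?w x * (P x *v \<theta> x) $ i))) (at x)" for i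
    by simp
  have "(\<Sum>i\<in>UNIV. frechet_derivative (\<lambda>y. \<rho> y * (?w y * (P y *v \<theta> y) $ i)) (at x) (axis i 1))
    = (\<Sum>i\<in>UNIV. \<rho> x * (\<Sum>j\<in>UNIV. (?w x * P x $ i $ j) * (?N (axis i 1) j + ?L (axis i 1) j) + ?W i j (axis i 1) * \<theta> x $ j)
      + frechet_derivative \<rho> (at x) (axis i 1) * (?w x * (P x *v \<theta> x) $ i))"
    by (intro sum.cong refl fun_cong[OF frechet_derivative_at[OF d, symmetric]])
  also have "\<dots> = \<rho> x * (?w x * (\<Sum>i\<in>UNIV. \<Sum>j\<in>UNIV. P x $ i $ j * ?N (axis i 1) j)
      + ?w x * (\<Sum>i\<in>UNIV. \<Sum>j\<in>UNIV. P x $ i $ j * ?L (axis i 1) j)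
      + (\<Sum>i\<in>UNIV. \<Sum>j\<in>UNIV. ?W i j (axis i 1) * \<theta> x $ j))
      + ?w x * (\<Sum>i\<in>UNIV. (P x *v \<theta> x) $ i * frechet_derivative \<rho> (at x) (axis i 1))"
    by (simp add: sum.distrib sum_distrib_left distrib_left mult_ac)
  also have "(\<Sum>i\<in>UNIV. \<Sum>j\<in>UNIV. ?W i j (axis i 1) * \<theta> x $ j) = (\<Sum>j\<in>UNIV. (\<Sum>i\<in>UNIV. ?W i j (axis i 1)) * \<theta> x $ j)"
    by (subst sum.swap) (simp only: sum_distrib_right)
  also have "\<dots> = - ?w x * (\<Sum>k\<in>UNIV. (\<Sum>i\<in>UNIV. \<Sum>j\<in>UNIV. P x $ i $ j * christoffel G x k i j) * \<theta> x $ k)"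
  proof -
    have "(\<Sum>j\<in>UNIV. c * C j * t j) = c * (\<Sum>j\<in>UNIV. C j * t j)" for c :: real and C t :: "'a \<Rightarrow> real"
      by (simp add: sum_distrib_left mult.assoc)
    then show ?thesis unfolding divergence_metric[OF metric_G x] .
  qed
  also have "(\<Sum>i\<in>UNIV. \<Sum>j\<in>UNIV. P x $ i $ j * ?N (axis i 1) j)
    = (\<Sum>k\<in>UNIV. (\<Sum>i\<in>UNIV. \<Sum>j\<in>UNIV. P x $ i $ j * christoffel G x k i j) * \<theta> x $ k)"
    using harmonic_paired[OF x] by (simp add: coord_field_def)
  also have "(\<Sum>i\<in>UNIV. \<Sum>j\<in>UNIV. P x $ i $ j * ?L (axis i 1) j) = pullback_lie_trace G H \<xi> f x"
    by (rule pullback_lie_trace_eq[OF x])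
  finally show ?thesis by (simp add: algebra_simps)
qed

text \<open>Writing $g^{-1} = \sum_k V_k V_k^T$ turns the trace into $\sum_k \frac12 L_\xi h(df(V_k), df(V_k))$.\<close>

lemma pullback_lie_trace_sign:
  assumes x: "x \<in> S" and pos: "\<And>v. v \<noteq> 0 \<Longrightarrow> \<sigma> * lie_derivative \<xi> H (\<lambda>_. v) (\<lambda>_. v) (f x) > 0"
  shows "\<sigma> * pullback_lie_trace G H \<xi> f x \<ge> 0"
    and "pullback_lie_trace G H \<xi> f x = 0 \<Longrightarrow> df x v = 0"
proof -
  define B where "B u v = lie_derivative \<xi> H (\<lambda>_. u) (\<lambda>_. v) (f x)" for u v
  note inv = local_metric_invertible[OF metric_G x]
  obtain V :: "'a \<Rightarrow> real ^ 'a" where V: "\<And>i j. P x $ i $ j = (\<Sum>k\<in>UNIV. V k $ i * V k $ j)"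
    using psd_factor[OF matrix_inv_transpose[OF inv local_metric_transpose[OF metric_G x]]
        positive_definite_matrix_inv[OF local_metric_pos[OF metric_G x]]] by blast
  have lin: "linear (frechet_derivative \<xi> (at (f x)))"
    by (rule has_derivative_linear[OF C1_on_has_derivative[OF smooth_on_imp_C1_on[OF smooth_\<xi>] f_in[OF x]]])
  have B1: "linear (\<lambda>u. B u v)" and B2: "linear (B u)" for u v
    unfolding B_def lie_derivative_form[OF x]
    by (auto simp: linear_iff bilin_add_left bilin_add_right bilin_scaleR_left bilin_scaleR_right
        linear_add[OF lin] linear_cmul[OF lin] linear_add[OF christoffel_form_linear(1)]
        linear_cmul[OF christoffel_form_linear(1)] algebra_simps)
  let ?e = "\<lambda>i. df x (axis i 1)"
  have BV: "B (df x (V k)) (df x (V k)) = (\<Sum>i\<in>UNIV. \<Sum>j\<in>UNIV. V k $ i * V k $ j * B (?e i) (?e j))" for k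
  proof -
    have "B (\<Sum>i\<in>UNIV. c i *\<^sub>R u i) w = (\<Sum>i\<in>UNIV. c i * B (u i) w)"
      "B w (\<Sum>i\<in>UNIV. c i *\<^sub>R u i) = (\<Sum>i\<in>UNIV. c i * B w (u i))" for c and u :: "'a \<Rightarrow> real ^ 'b" and w
      by (simp_all add: linear_sum[OF B1] linear_cmul[OF B1] linear_sum[OF B2] linear_cmul[OF B2])
    then show ?thesis
      unfolding linear_axis_sum[OF df_linear[OF x], of "V k"]
      by (simp only: sum_distrib_left mult.assoc, subst sum.swap, simp only: mult_ac)
  qed
  have tr: "pullback_lie_trace G H \<xi> f x = (\<Sum>k\<in>UNIV. B (df x (V k)) (df x (V k))) / 2"
  proof -
    have "pullback_lie_trace G H \<xi> f x = (\<Sum>i\<in>UNIV. \<Sum>j\<in>UNIV. \<Sum>k\<in>UNIV. V k $ i * V k $ j * B (?e i) (?e j)) / 2"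
      unfolding pullback_lie_trace_def B_def[symmetric] V
      by (simp add: sum_divide_distrib sum_distrib_right)
    also have "(\<Sum>i\<in>UNIV. \<Sum>j\<in>UNIV. \<Sum>k\<in>UNIV. V k $ i * V k $ j * B (?e i) (?e j)) = (\<Sum>i\<in>UNIV. \<Sum>k\<in>UNIV. \<Sum>j\<in>UNIV. V k $ i * V k $ j * B (?e i) (?e j))"
      by (rule sum.cong[OF refl], rule sum.swap)
    also have "\<dots> = (\<Sum>k\<in>UNIV. \<Sum>i\<in>UNIV. \<Sum>j\<in>UNIV. V k $ i * V k $ j * B (?e i) (?e j))"
      by (rule sum.swap)
    finally show ?thesis by (simp only: BV)
  qed
  have nonneg: "\<sigma> * B u u \<ge> 0" for u
    using pos[of u] linear_0[OF B2] by (cases "u = 0") (auto simp: B_def)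
  show "\<sigma> * pullback_lie_trace G H \<xi> f x \<ge> 0"
    unfolding tr using nonneg by (simp add: sum_distrib_left sum_nonneg)
  assume "pullback_lie_trace G H \<xi> f x = 0"
  then have "(\<Sum>k\<in>UNIV. \<sigma> * B (df x (V k)) (df x (V k))) = 0"
    by (simp add: tr sum_distrib_left[symmetric])
  then have "\<sigma> * B (df x (V k)) (df x (V k)) = 0" for k
    using nonneg by (auto simp: sum_nonneg_eq_0_iff)
  then have zero: "df x (V k) = 0" for k
    using pos[of "df x (V k)"] unfolding B_def by (metis less_irrefl)
  \<comment> \<open>The range of the inverse metric is spanned by the \<open>V k\<close>, and since
    it is invertible this range is everything.\<close>
  have "df x (P x *v u) = 0" for u
  proof -
    have "P x *v u = (\<Sum>k\<in>UNIV. (V k \<bullet> u) *\<^sub>R V k)"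
    proof (rule iffD2[OF vec_eq_iff], rule allI)
      fix i
      have "(P x *v u) $ i = (\<Sum>j\<in>UNIV. \<Sum>k\<in>UNIV. V k $ i * V k $ j * u $ j)"
        by (simp add: matrix_vector_mult_def V sum_distrib_right)
      also have "\<dots> = (\<Sum>k\<in>UNIV. \<Sum>j\<in>UNIV. V k $ i * V k $ j * u $ j)"
        by (rule sum.swap)
      finally show "(P x *v u) $ i = (\<Sum>k\<in>UNIV. (V k \<bullet> u) *\<^sub>R V k) $ i"
        by (simp add: inner_vec_def sum_distrib_left sum_distrib_right mult_ac)
    qed
    then show ?thesis
      by (simp add: linear_sum[OF df_linear[OF x]] linear_cmul[OF df_linear[OF x]] zero)
  qed
  from this[of "G x *v v"] show "df x v = 0"
    by (simp add: matrix_vector_mul_assoc matrix_inv_inverse(2)[OF inv])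
qed

end

section \<open>Charts and partitions of unity\<close>

lemma chart_homeomorphism:
  "is_chart c \<Longrightarrow> homeomorphism (fst c) (snd c ` fst c) (snd c) (chart_inv c)"
  by (simp add: is_chart_def)

lemma chart_inv_left: "is_chart c \<Longrightarrow> m \<in> fst c \<Longrightarrow> chart_inv c (snd c m) = m"
  using homeomorphism_apply1[OF chart_homeomorphism] .

lemma chart_inv_continuous: "is_chart c \<Longrightarrow> continuous_on (snd c ` fst c) (chart_inv c)"
  using homeomorphism_cont2[OF chart_homeomorphism] .

lemma chart_inv_image: "is_chart c \<Longrightarrow> V \<subseteq> fst c \<Longrightarrow> x \<in> snd c ` V \<Longrightarrow> chart_inv c x \<in> V"
  by (auto simp: chart_inv_left subset_iff)

lemma chart_inv_right: "is_chart c \<Longrightarrow> x \<in> snd c ` fst c \<Longrightarrow> snd c (chart_inv c x) = x"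
  by (auto simp: chart_inv_left)

lemma chart_image_eq:
  assumes "is_chart c" "V \<subseteq> fst c"
  shows "snd c ` V = chart_inv c -` V \<inter> snd c ` fst c"
proof (intro equalityI subsetI)
  fix x assume "x \<in> chart_inv c -` V \<inter> snd c ` fst c"
  then show "x \<in> snd c ` V"
    using chart_inv_right[OF assms(1), of x] by (intro image_eqI[of _ _ "chart_inv c x"]) auto
qed (use assms chart_inv_image[OF assms] in auto)

lemma chart_open_image:
  assumes "is_chart c" "open V" "V \<subseteq> fst c"
  shows "open (snd c ` V)"
proof -
  have "continuous_on (snd c ` fst c) (chart_inv c)" "open (snd c ` fst c)"
    using assms(1) chart_inv_continuous[OF assms(1)] by (simp_all add: is_chart_def)
  then show ?thesis
    unfolding chart_image_eq[OF assms(1,3)] using assms(2) continuous_on_open_vimage by blast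
qed

lemma chart_inv_open_image:
  assumes "is_chart c" "open V" "V \<subseteq> snd c ` fst c"
  shows "open (chart_inv c ` V)"
proof -
  have "continuous_on (fst c) (snd c)" "open (fst c)"
    using assms(1) homeomorphism_cont1[OF chart_homeomorphism[OF assms(1)]] by (simp_all add: is_chart_def)
  then have "open (snd c -` V \<inter> fst c)"
    using assms(2) continuous_on_open_vimage by blast
  also have "snd c -` V \<inter> fst c = chart_inv c ` V"
  proof (intro equalityI subsetI)
    fix m assume "m \<in> snd c -` V \<inter> fst c"
    then show "m \<in> chart_inv c ` V"
      using chart_inv_left[OF assms(1), of m] by (intro image_eqI[of _ _ "snd c m"]) auto
  next
    fix m assume "m \<in> chart_inv c ` V"
    then obtain x where x: "x \<in> V" "m = chart_inv c x" by blast
    then have "x \<in> snd c ` fst c" using assms(3) by blast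
    then show "m \<in> snd c -` V \<inter> fst c"
      using x chart_inv_right[OF assms(1)] chart_inv_image[OF assms(1) order_refl] by simp
  qed
  finally show ?thesis .
qed

lemma transition_apply: "is_chart c \<Longrightarrow> m \<in> fst c \<Longrightarrow> transition c d (snd c m) = snd d m"
  by (simp add: transition_def chart_inv_left)

lemma inj_on_chart: "is_chart c \<Longrightarrow> V \<subseteq> fst c \<Longrightarrow> inj_on (snd c) V"
  by (metis chart_inv_left inj_on_inverseI subset_iff)

text \<open>The inverse metric applied to a covector is a vector: it obeys the transformation law.\<close>

lemma matrix_inv_covector_transform:
  fixes G G' :: "real ^ 'n ^ 'n::finite"
  assumes J: "linear J" and G: "\<And>v. v \<noteq> 0 \<Longrightarrow> bilin G v v > 0" and G': "\<And>v. v \<noteq> 0 \<Longrightarrow> bilin G' v v > 0"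
    and "transpose G = G" "transpose G' = G'"
    and GJ: "\<And>v w. bilin G' (J v) (J w) = bilin G v w" and \<theta>: "\<And>v. \<theta>' \<bullet> J v = \<theta> \<bullet> v"
  shows "J (matrix_inv G *v \<theta>) = matrix_inv G' *v \<theta>'"
proof -
  define z where "z = matrix_inv G *v \<theta>"
  have Gz: "G *v z = \<theta>"
    by (simp add: z_def matrix_vector_mul_assoc matrix_inv_inverse[OF positive_definite_invertible[OF G]])
  \<comment> \<open>\<open>G'\<close> pulls back to the definite form \<open>G\<close>, so
    \<open>J\<close> is injective and hence surjective. It is then enough to test covectors on
    vectors of the form \<open>J v\<close>.\<close>
  have "v = 0" if "J v = 0" for v
    using G[of v] GJ[of v v] that by (auto simp: bilin_zero)
  then have "inj J" by (simp add: linear_injective_0[OF J])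
  then have surj: "surj J" using J linear_injective_imp_surjective by blast
  have "(G' *v J z) \<bullet> w = \<theta>' \<bullet> w" for w
  proof -
    obtain v where w: "w = J v" using surj by (auto simp: surj_def)
    have "(G' *v J z) \<bullet> J v = bilin G' (J v) (J z)" by (simp add: bilin_def inner_commute)
    also have "\<dots> = bilin G v z" by (rule GJ)
    also have "\<dots> = \<theta>' \<bullet> J v" by (simp add: bilin_def Gz \<theta> inner_commute)
    finally show ?thesis by (simp add: w)
  qed
  then have "G' *v J z = \<theta>'" by (metis vector_eq_rdot)
  then have "matrix_inv G' *v \<theta>' = (matrix_inv G' ** G') *v J z"
    by (simp add: matrix_vector_mul_assoc[symmetric])
  then show ?thesis
    by (simp add: matrix_inv_inverse[OF positive_definite_invertible[OF G']] z_def)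
qed

text \<open>Taking determinants in G = J^T G' J. The absolute value of the Jacobian is exactly the
  factor of the change of variables theorem.\<close>

lemma det_metric_transform:
  fixes G G' :: "real ^ 'n ^ 'n::finite"
  assumes J: "linear J" and GJ: "\<And>v w. bilin G' (J v) (J w) = bilin G v w"
  shows "sqrt (det G) = \<bar>det (matrix J)\<bar> * sqrt (det G')"
proof -
  have MJ: "matrix J *v x = J x" for x
    by (rule fun_cong[OF matrix_vector_mul(2)[OF J]])
  have adj: "u \<bullet> (transpose (matrix J) *v z) = J u \<bullet> z" for u z
    by (metis MJ dot_lmul_matrix inner_commute transpose_matrix_vector)
  have "transpose (matrix J) ** G' ** matrix J = G"
  proof (intro iffD2[OF vec_eq_iff] allI)
    fix i j
    have "(transpose (matrix J) ** G' ** matrix J) $ i $ j = bilin (transpose (matrix J) ** G' ** matrix J) (axis i 1) (axis j 1)"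
      by (rule bilin_axis[symmetric])
    also have "\<dots> = bilin G' (J (axis i 1)) (J (axis j 1))"
      by (simp only: bilin_def matrix_vector_mul_assoc[symmetric] MJ adj)
    finally show "(transpose (matrix J) ** G' ** matrix J) $ i $ j = G $ i $ j"
      by (simp add: GJ bilin_axis)
  qed
  from arg_cong[OF this, of det] have "det G = (det (matrix J))\<^sup>2 * det G'"
    by (simp add: det_mul power2_eq_square mult_ac)
  then show ?thesis by (simp add: real_sqrt_mult)
qed

section \<open>C^1 functions, bump functions and a partition of unity\<close>

definition C1_function :: "('m, 'a::finite) chart set \<Rightarrow> ('m \<Rightarrow> real) \<Rightarrow> bool" where
  "C1_function A u \<longleftrightarrow> (\<forall>c\<in>A. C1_on (snd c ` fst c) (\<lambda>x. u (chart_inv c x)))"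

text \<open>Squaring the positive part makes the function C^1 across the sphere of radius
  \<open>r\<close>; higher smoothness is not aimed at. The extension by zero is harmless once the
  closed ball lies in the chart image.\<close>

definition bump :: "('m, 'a::finite) chart \<Rightarrow> real ^ 'a \<Rightarrow> real \<Rightarrow> 'm \<Rightarrow> real" where
  "bump c p r m = (if m \<in> fst c then (max 0 (r\<^sup>2 - (snd c m - p) \<bullet> (snd c m - p)))\<^sup>2 else 0)"

lemma bump_eq_0:
  assumes ch: "is_chart c" and r: "r > 0" and "m \<notin> chart_inv c ` cball p r"
  shows "bump c p r m = 0"
proof (cases "m \<in> fst c")
  case True
  have "snd c m \<notin> cball p r" using assms(3) chart_inv_left[OF ch True] by force
  then have "dist p (snd c m) > r" by simp
  then have "(dist p (snd c m))\<^sup>2 > r\<^sup>2" using r by (intro power_strict_mono) auto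
  then have "r\<^sup>2 - (snd c m - p) \<bullet> (snd c m - p) < 0"
    by (simp add: dist_norm power2_norm_eq_inner[symmetric] norm_minus_commute)
  then show ?thesis by (simp add: bump_def)
qed (simp add: bump_def)

text \<open>Away from 0 the function is locally 0 or the square. At 0 the difference quotient is
  bounded by the absolute value of the increment.\<close>

lemma C1_on_max_square: "C1_on S (\<lambda>t :: real. (max 0 t)\<^sup>2)"
proof (rule C1_on_real[where f' = "\<lambda>t. 2 * max 0 t"])
  fix t :: real
  consider "t < 0" | "t = 0" | "t > 0" by linarith
  then show "((\<lambda>t. (max 0 t)\<^sup>2) has_real_derivative 2 * max 0 t) (at t)"
  proof cases
    case 1
    have "((\<lambda>t :: real. 0) has_real_derivative 0) (at t)" by simp
    then have "((\<lambda>t. (max 0 t)\<^sup>2) has_real_derivative 0) (at t)"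
      by (rule has_field_derivative_transform_within_open[of _ _ _ "{..<0}"]) (use 1 in auto)
    then show ?thesis using 1 by simp
  next
    case 2
    have "((\<lambda>h :: real. (max 0 h)\<^sup>2 / h) \<longlongrightarrow> 0) (at 0)"
    proof (rule Lim_null_comparison)
      show "\<forall>\<^sub>F h in at 0. norm ((max 0 h)\<^sup>2 / h) \<le> \<bar>h :: real\<bar>"
        by (rule always_eventually) (auto simp: max_def power2_eq_square)
    qed (auto intro!: tendsto_eq_intros)
    then show ?thesis using 2 by (simp add: has_field_derivative_iff)
  next
    case 3
    have "((\<lambda>t :: real. t\<^sup>2) has_real_derivative 2 * t) (at t)" by (auto intro!: derivative_eq_intros)
    then have "((\<lambda>t. (max 0 t)\<^sup>2) has_real_derivative 2 * t) (at t)"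
      by (rule has_field_derivative_transform_within_open[of _ _ _ "{0<..}"]) (use 3 in auto)
    then show ?thesis using 3 by simp
  qed
qed (intro continuous_intros)

lemma C1_on_inner:
  fixes f g :: "'a::real_normed_vector \<Rightarrow> 'b::real_inner"
  assumes "C1_on S f" "C1_on S g"
  shows "C1_on S (\<lambda>x. f x \<bullet> g x)"
proof (rule C1_onI[where f' = "\<lambda>x v. f x \<bullet> frechet_derivative g (at x) v + frechet_derivative f (at x) v \<bullet> g x"])
  fix x assume "x \<in> S"
  then show "((\<lambda>x. f x \<bullet> g x) has_derivative
      (\<lambda>v. f x \<bullet> frechet_derivative g (at x) v + frechet_derivative f (at x) v \<bullet> g x)) (at x)"
    by (intro has_derivative_inner C1_on_has_derivative[OF assms(1)] C1_on_has_derivative[OF assms(2)])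
qed (intro continuous_on_add continuous_on_inner C1_on_continuous_derivative[OF assms(1)]
      C1_on_continuous_derivative[OF assms(2)] C1_on_imp_continuous_on[OF assms(1)]
      C1_on_imp_continuous_on[OF assms(2)])

context
  fixes A :: "('m::{second_countable_topology, t2_space}, 'a::finite) chart set"
  assumes atlas: "smooth_atlas A"
begin

lemma atlas_chart: "c \<in> A \<Longrightarrow> is_chart c"
  using atlas by (simp add: smooth_atlas_def)

lemma atlas_domain_open: "c \<in> A \<Longrightarrow> open (fst c)"
  using atlas_chart by (auto simp: is_chart_def)

lemma atlas_image_open: "c \<in> A \<Longrightarrow> V \<subseteq> fst c \<Longrightarrow> open V \<Longrightarrow> open (snd c ` V)"
  using atlas_chart chart_open_image by blast

lemma atlas_covers: obtains c where "c \<in> A" "m \<in> fst c"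
  using atlas unfolding smooth_atlas_def by (metis UNIV_I UN_E)

lemma transition_C1:
  "c \<in> A \<Longrightarrow> d \<in> A \<Longrightarrow> C1_on (snd c ` (fst c \<inter> fst d)) (transition c d)"
  using atlas by (intro smooth_on_imp_C1_on) (auto simp: smooth_atlas_def)

lemma transition_linear:
  "c \<in> A \<Longrightarrow> d \<in> A \<Longrightarrow> m \<in> fst c \<Longrightarrow> m \<in> fst d \<Longrightarrow> linear (frechet_derivative (transition c d) (at (snd c m)))"
  by (rule has_derivative_linear[OF C1_on_has_derivative[OF transition_C1]]) auto

lemma C1_function_const: "C1_function A (\<lambda>_. k)"
  by (auto simp: C1_function_def simp del: Ck_on.simps intro!: C1_on_const)

lemma C1_function_mult: "C1_function A u \<Longrightarrow> C1_function A v \<Longrightarrow> C1_function A (\<lambda>m. u m * v m)"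
  by (auto simp: C1_function_def simp del: Ck_on.simps intro!: C1_on_mult)

lemma C1_function_sum: "(\<And>i. i \<in> I \<Longrightarrow> C1_function A (u i)) \<Longrightarrow> C1_function A (\<lambda>m. \<Sum>i\<in>I. u i m)"
  by (auto simp: C1_function_def simp del: Ck_on.simps intro!: C1_on_sum)

lemma C1_function_inverse: "C1_function A u \<Longrightarrow> (\<And>m. u m \<noteq> 0) \<Longrightarrow> C1_function A (\<lambda>m. inverse (u m))"
  by (auto simp: C1_function_def simp del: Ck_on.simps intro!: C1_on_inverse)

text \<open>Continuity is available in charts only, so a neighbourhood of each point is found in a
  chart image and carried back by the inverse chart.\<close>

lemma C1_function_open_pos:
  assumes "C1_function A u"
  shows "open {m. u m > 0}"
proof (subst open_subopen, intro ballI)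
  fix m assume m: "m \<in> {m. u m > 0}"
  obtain c where c: "c \<in> A" "m \<in> fst c" by (rule atlas_covers)
  note ch = atlas_chart[OF c(1)]
  let ?V = "(\<lambda>x. u (chart_inv c x)) -` {0<..} \<inter> snd c ` fst c"
  have "continuous_on (snd c ` fst c) (\<lambda>x. u (chart_inv c x))"
    using assms c(1) by (intro C1_on_imp_continuous_on) (simp add: C1_function_def del: Ck_on.simps)
  then have "open ?V"
    by (rule continuous_on_open_vimage[OF atlas_image_open[OF c(1) order_refl atlas_domain_open[OF c(1)]],
        THEN iffD1, rule_format]) simp
  then have "open (chart_inv c ` ?V)" by (intro chart_inv_open_image ch) auto
  moreover have "m \<in> chart_inv c ` ?V"
    using m c(2) by (intro image_eqI[of _ _ "snd c m"]) (auto simp: chart_inv_left[OF ch])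
  moreover have "chart_inv c ` ?V \<subseteq> {m. u m > 0}" by auto
  ultimately show "\<exists>T. open T \<and> m \<in> T \<and> T \<subseteq> {m. u m > 0}" by blast
qed

lemma transition_image:
  assumes "c \<in> A" "V \<subseteq> fst c"
  shows "transition c d ` (snd c ` V) = snd d ` V"
  using assms by (force simp: transition_apply[OF atlas_chart])

text \<open>In another chart \<open>d\<close> two open sets cover the image: the overlap with
  \<open>c\<close>, where the explicit formula is composed with the transition map, and the
  complement of the support \<open>?K\<close>, where the bump is zero. The latter is open because a
  compact set in a Hausdorff space is closed.\<close>

lemma C1_function_bump:
  assumes c: "c \<in> A" and r: "r > 0" and K: "cball p r \<subseteq> snd c ` fst c"
  shows "C1_function A (bump c p r)"
  unfolding C1_function_def
proof
  fix d assume d: "d \<in> A"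
  note ch = atlas_chart[OF c] and chd = atlas_chart[OF d]
  let ?K = "chart_inv c ` cball p r" and ?b = "\<lambda>x. (max 0 (r\<^sup>2 - (x - p) \<bullet> (x - p)))\<^sup>2"
  let ?O1 = "snd d ` (fst d \<inter> fst c)" and ?O2 = "snd d ` (fst d - ?K)"
  have "continuous_on (cball p r) (chart_inv c)"
    using continuous_on_subset[OF chart_inv_continuous[OF ch] K] .
  then have "closed ?K" by (intro compact_imp_closed compact_continuous_image compact_cball)
  then have "open (fst d - ?K)" using atlas_domain_open[OF d] by (rule open_Diff[rotated])
  then have op: "open ?O1" "open ?O2"
    using atlas_domain_open[OF c] atlas_domain_open[OF d] by (auto intro!: atlas_image_open d)
  have "?K \<subseteq> fst c" using K chart_inv_image[OF ch order_refl] by auto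
  then have "fst d = (fst d \<inter> fst c) \<union> (fst d - ?K)" by auto
  then have un: "snd d ` fst d = ?O1 \<union> ?O2" by (metis image_Un)
  have "C1_on ?O1 (\<lambda>x. bump c p r (chart_inv d x))"
  proof (rule C1_on_cong[OF op(1)])
    have "C1_on UNIV ?b"
      by (rule C1_on_compose[OF C1_on_max_square[of UNIV]])
         (auto simp del: Ck_on.simps intro!: C1_on_diff C1_on_inner C1_on_const C1_on_ident)
    then show "C1_on ?O1 (\<lambda>x. ?b (transition d c x))"
      by (rule C1_on_compose[OF _ transition_C1[OF d c]]) simp
    fix x assume "x \<in> ?O1"
    then show "bump c p r (chart_inv d x) = ?b (transition d c x)"
      by (auto simp: bump_def chart_inv_left[OF chd] transition_apply[OF chd])
  qed
  moreover have "C1_on ?O2 (\<lambda>x. bump c p r (chart_inv d x))"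
  proof (rule C1_on_cong[OF op(2) C1_on_const])
    fix x assume "x \<in> ?O2"
    then have "chart_inv d x \<notin> ?K" using chart_inv_image[OF chd, of "fst d - ?K" x] by auto
    then show "bump c p r (chart_inv d x) = 0" by (rule bump_eq_0[OF ch r])
  qed
  ultimately show "C1_on (snd d ` fst d) (\<lambda>x. bump c p r (chart_inv d x))"
    unfolding un by (intro C1_on_Un op)
qed

text \<open>A bump is centred at every point of the manifold. By compactness finitely many centres
  \<open>I\<close> have bumps without a common zero, and division by their sum keeps the
  supports.\<close>

lemma C1_partition_of_unity:
  assumes compact: "compact (UNIV :: 'm set)"
    and cover: "\<And>m. c m \<in> A" "\<And>m. m \<in> V m" "\<And>m. V m \<subseteq> fst (c m)" "\<And>m. open (V m)"
  obtains I :: "'m set" and \<rho> :: "'m \<Rightarrow> 'm \<Rightarrow> real" and K :: "'m \<Rightarrow> 'm set"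
  where "finite I" "\<And>i. C1_function A (\<rho> i)" "\<And>i m. \<rho> i m \<ge> 0" "\<And>m. (\<Sum>i\<in>I. \<rho> i m) = 1"
    "\<And>i. compact (K i)" "\<And>i. K i \<subseteq> V i" "\<And>i m. m \<notin> K i \<Longrightarrow> \<rho> i m = 0"
proof -
  have "\<exists>r>0. cball (snd (c m) m) r \<subseteq> snd (c m) ` V m" for m
    using open_contains_cball atlas_image_open[OF cover(1,3,4)] cover(2) by (metis imageI)
  then obtain r where r: "\<And>m. r m > 0" "\<And>m. cball (snd (c m) m) (r m) \<subseteq> snd (c m) ` V m" by metis
  define b where "b i = bump (c i) (snd (c i) i) (r i)" for i
  define K where "K i = chart_inv (c i) ` cball (snd (c i) i) (r i)" for i
  have rc: "cball (snd (c m) m) (r m) \<subseteq> snd (c m) ` fst (c m)" for m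
    using r(2)[of m] cover(3)[of m] by blast
  have b1: "C1_function A (b i)" for i
    unfolding b_def by (rule C1_function_bump[OF cover(1) r(1) rc])
  have b0: "b i m \<ge> 0" for i m by (simp add: b_def bump_def)
  have bi: "b i i > 0" for i
    using cover(2,3)[of i] r(1)[of i] by (auto simp: b_def bump_def)
  have KV: "K i \<subseteq> V i" for i
    unfolding K_def using r(2)[of i] chart_inv_image[OF atlas_chart[OF cover(1)] cover(3)] by auto
  have Kc: "compact (K i)" for i
  proof -
    have "continuous_on (cball (snd (c i) i) (r i)) (chart_inv (c i))"
      using continuous_on_subset[OF chart_inv_continuous[OF atlas_chart[OF cover(1)]] rc] .
    then show ?thesis unfolding K_def by (intro compact_continuous_image compact_cball)
  qed
  have bK: "b i m = 0" if "m \<notin> K i" for i m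
    using that unfolding b_def K_def by (rule bump_eq_0[OF atlas_chart[OF cover(1)] r(1)])
  obtain I where I: "finite I" "UNIV \<subseteq> (\<Union>i\<in>I. {m. b i m > 0})"
  proof (rule compactE_image[OF compact, of UNIV "\<lambda>i. {m. b i m > 0}"])
    show "open {m. b i m > 0}" for i by (rule C1_function_open_pos[OF b1])
    show "UNIV \<subseteq> (\<Union>i. {m. b i m > 0})" using bi by auto
  qed (use that in blast)
  define B where "B m = (\<Sum>i\<in>I. b i m)" for m
  have B: "B m > 0" for m
  proof -
    obtain i where "i \<in> I" "b i m > 0" using I(2) by blast
    then show ?thesis unfolding B_def using I(1) b0 by (intro sum_pos2)
  qed
  show thesis
  proof (rule that[of I "\<lambda>i m. b i m * inverse (B m)" K])
    have "B m \<noteq> 0" for m using B[of m] by simp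
    then show "C1_function A (\<lambda>m. b i m * inverse (B m))" for i
      by (intro C1_function_mult b1 C1_function_inverse) (auto simp: B_def intro!: C1_function_sum b1)
    show "(\<Sum>i\<in>I. b i m * inverse (B m)) = 1" for m
      using B[of m] by (simp add: sum_distrib_right[symmetric] B_def[symmetric])
    show "b i m * inverse (B m) \<ge> 0" for i m
      using b0[of i m] B[of m] by simp
  qed (use I(1) Kc KV bK in auto)
qed

end

section \<open>Harmonic maps with a definite Lie derivative\<close>

text \<open>The extended function is continuous on the open sets \<open>S\<close> and
  \<open>- K\<close>, which cover the space.\<close>

lemma continuous_extend_by_0:
  fixes F :: "'a::t2_space \<Rightarrow> real"
  assumes "open S" "continuous_on S F" "compact K" "K \<subseteq> S" "\<And>x. x \<in> S \<Longrightarrow> x \<notin> K \<Longrightarrow> F x = 0"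
  shows "continuous_on UNIV (\<lambda>x. if x \<in> S then F x else 0)"
proof -
  let ?E = "\<lambda>x. if x \<in> S then F x else 0"
  have "open (- K)" using assms(3) by (simp add: compact_imp_closed open_Compl)
  moreover have "continuous_on S ?E" using assms(2) by (simp cong: continuous_on_cong)
  moreover have "continuous_on (- K) ?E \<longleftrightarrow> continuous_on (- K) (\<lambda>_. 0 :: real)"
    by (rule continuous_on_cong) (use assms(5) in auto)
  ultimately have "continuous_on (S \<union> - K) ?E" using assms(1) continuous_on_const by (intro continuous_on_open_Un) auto
  moreover have "S \<union> - K = UNIV" using assms(4) by auto
  ultimately show ?thesis by simp
qed

lemma C1_extend_by_0:
  fixes F :: "'a::real_normed_vector \<Rightarrow> real"
  assumes "open S" "C1_on S F" "compact K" "K \<subseteq> S" "\<And>x. x \<in> S \<Longrightarrow> x \<notin> K \<Longrightarrow> F x = 0"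
  shows "C1_on UNIV (\<lambda>x. if x \<in> S then F x else 0)"
proof -
  let ?E = "\<lambda>x. if x \<in> S then F x else 0"
  have op: "open (- K)" using assms(3) by (simp add: compact_imp_closed open_Compl)
  have "C1_on S ?E" by (rule C1_on_cong[OF assms(1,2)]) simp
  moreover have "C1_on (- K) ?E" by (rule C1_on_cong[OF op C1_on_const[of _ 0]]) (use assms(5) in auto)
  ultimately have "C1_on (S \<union> - K) ?E" using assms(1) op by (intro C1_on_Un)
  moreover have "S \<union> - K = UNIV" using assms(4) by auto
  ultimately show ?thesis by simp
qed

text \<open>The set where \<open>f\<close> is positive is open and of measure zero, hence
  empty.\<close>

lemma continuous_nonneg_integral_eq_0:
  fixes f :: "'a::euclidean_space \<Rightarrow> real"
  assumes "continuous_on UNIV f" "\<And>x. f x \<ge> 0" "integrable lborel f" "(\<integral>x. f x \<partial>lborel) = 0"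
  shows "f x = 0"
proof -
  let ?U = "f -` {0<..}"
  have "open ?U" using assms(1) by (intro open_vimage) auto
  have "AE x in lborel. f x = 0"
    using integral_nonneg_eq_0_iff_AE[OF assms(3)] assms(2,4) by simp
  then have "{x. f x \<noteq> 0} \<in> null_sets lborel"
    using assms(3) by (subst (asm) AE_iff_null) auto
  moreover have "{x. f x \<noteq> 0} = ?U" using assms(2) by (auto simp: less_le)
  ultimately have "negligible ?U"
    by (simp add: negligible_iff_null_sets null_sets_completionI)
  then have "?U = {}" using open_not_negligible \<open>open ?U\<close> by blast
  then show ?thesis using assms(2)[of x] by (auto simp: vimage_def less_le)
qed

lemma smooth_on_subset:
  assumes "smooth_on S f" "T \<subseteq> S"
  shows "smooth_on T f"
proof -
  have "Ck_on k T f" if "Ck_on k S f" for k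
    using that assms(2) by (induction k arbitrary: f) (auto intro: continuous_on_subset)
  then show ?thesis using assms(1) by (simp add: smooth_on_def)
qed

lemma frechet_derivative_eq_on_open:
  assumes "open U" "x \<in> U" "\<And>y. y \<in> U \<Longrightarrow> f y = g y" "f differentiable (at x)"
  shows "frechet_derivative f (at x) = frechet_derivative g (at x)"
proof -
  have "(g has_derivative frechet_derivative f (at x)) (at x)"
    by (rule has_derivative_transform_within_open[OF assms(4)[unfolded frechet_derivative_works] assms(1,2)])
       (rule assms(3))
  then show ?thesis by (rule frechet_derivative_at)
qed

text \<open>The sign \<open>\<sigma>\<close> allows a positive and a negative definite Lie
  derivative to be handled by one argument.\<close>

locale definite_harmonic_map =
  fixes A :: "('m::{second_countable_topology, t2_space}, 'a::finite) chart set"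
    and g :: "('m, 'a) metric"
    and B :: "('n::{second_countable_topology, t2_space}, 'b::finite) chart set"
    and h :: "('n, 'b) metric"
    and \<xi> :: "('n, 'b) vfield"
    and \<phi> :: "'m \<Rightarrow> 'n"
    and \<sigma> :: real
  assumes M: "riemannian_manifold A g" and compact_M: "compact (UNIV :: 'm set)"
    and N: "riemannian_manifold B h" and vector_field: "smooth_vector_field B \<xi>"
    and harmonic_map: "harmonic_map A g B h \<phi>"
    and definite: "\<And>d y v. d \<in> B \<Longrightarrow> y \<in> snd d ` fst d \<Longrightarrow> v \<noteq> 0 \<Longrightarrow>
      \<sigma> * lie_derivative (\<xi> d) (h d) (\<lambda>_. v) (\<lambda>_. v) y > 0"
begin

lemma atlas_A: "smooth_atlas A" and atlas_B: "smooth_atlas B"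
  using M N by (auto simp: riemannian_manifold_def smooth_manifold_def)

lemma chart_A: "c \<in> A \<Longrightarrow> is_chart c" and chart_B: "d \<in> B \<Longrightarrow> is_chart d"
  using atlas_chart atlas_A atlas_B by blast+

lemma continuous_\<phi>: "continuous_on UNIV \<phi>"
  using harmonic_map by (simp add: harmonic_map_def smooth_map_def)

text \<open>The part of the source chart on which the map can be read in the target chart.\<close>

definition dom :: "('m, 'a) chart \<Rightarrow> ('n, 'b) chart \<Rightarrow> 'm set" where
  "dom c d = fst c \<inter> \<phi> -` fst d"

abbreviation coords :: "('m, 'a) chart \<Rightarrow> ('n, 'b) chart \<Rightarrow> (real ^ 'a) set" where
  "coords c d \<equiv> snd c ` dom c d"

lemma dom_open: "c \<in> A \<Longrightarrow> d \<in> B \<Longrightarrow> open (dom c d)"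
  unfolding dom_def
  using atlas_domain_open[OF atlas_A] atlas_domain_open[OF atlas_B] open_vimage[OF _ continuous_\<phi>] by blast

lemma dom_subset: "dom c d \<subseteq> fst c"
  by (simp add: dom_def)

lemma coords_open: "c \<in> A \<Longrightarrow> d \<in> B \<Longrightarrow> open (coords c d)"
  using atlas_image_open[OF atlas_A _ dom_subset dom_open] .

lemma local_metric_A: "c \<in> A \<Longrightarrow> V \<subseteq> fst c \<Longrightarrow> open V \<Longrightarrow> local_metric (snd c ` V) (g c)"
  using M atlas_image_open[OF atlas_A, of c V] smooth_on_subset[of "snd c ` fst c" "g c" "snd c ` V"]
  by (auto simp: local_metric_def riemannian_manifold_def riemannian_metric_def)

lemma local_metric_B: "d \<in> B \<Longrightarrow> local_metric (snd d ` fst d) (h d)"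
  using N atlas_image_open[OF atlas_B _ order_refl atlas_domain_open[OF atlas_B]]
  by (auto simp: local_metric_def riemannian_manifold_def riemannian_metric_def)

lemma map_in_charts_apply: "c \<in> A \<Longrightarrow> m \<in> fst c \<Longrightarrow> map_in_charts c d \<phi> (snd c m) = snd d (\<phi> m)"
  by (simp add: map_in_charts_def chart_inv_left chart_A)

lemma harmonic_chart:
  assumes c: "c \<in> A" and d: "d \<in> B"
  shows "harmonic_chart (coords c d) (snd d ` fst d) (g c) (h d) (\<xi> d) (map_in_charts c d \<phi>)"
proof
  show "local_metric (coords c d) (g c)"
    by (rule local_metric_A[OF c dom_subset dom_open[OF c d]])
  show "local_metric (snd d ` fst d) (h d)" by (rule local_metric_B[OF d])
  show "smooth_on (snd d ` fst d) (\<xi> d)"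
    using vector_field d by (simp add: smooth_vector_field_def)
  show "smooth_on (coords c d) (map_in_charts c d \<phi>)"
    using harmonic_map c d by (simp add: harmonic_map_def smooth_map_def dom_def)
  show "map_in_charts c d \<phi> ` coords c d \<subseteq> snd d ` fst d"
    using c by (auto simp: dom_def map_in_charts_apply)
  show "tension (g c) (h d) (map_in_charts c d \<phi>) x = 0" if "x \<in> coords c d" for x
    using harmonic_map c d that unfolding harmonic_map_def dom_def by blast
qed

section \<open>The dual vector of the one-form and its independence of charts\<close>

definition flux_vector :: "('m, 'a) chart \<Rightarrow> ('n, 'b) chart \<Rightarrow> real ^ 'a \<Rightarrow> real ^ 'a" where
  "flux_vector c d x = matrix_inv (g c x) *v pullback_form (h d) (\<xi> d) (map_in_charts c d \<phi>) x"

text \<open>In coordinates this is <theta, du>, written as the derivative of \<open>u\<close> along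
  the vector metrically dual to theta.\<close>

definition flux_derivative :: "('m, 'a) chart \<Rightarrow> ('n, 'b) chart \<Rightarrow> ('m \<Rightarrow> real) \<Rightarrow> real ^ 'a \<Rightarrow> real" where
  "flux_derivative c d u x = frechet_derivative (\<lambda>y. u (chart_inv c y)) (at x) (flux_vector c d x)"

lemma pullback_form_inner:
  assumes "c \<in> A" "d \<in> B" "x \<in> coords c d"
  shows "pullback_form (h d) (\<xi> d) (map_in_charts c d \<phi>) x \<bullet> v
    = bilin (h d (map_in_charts c d \<phi> x)) (frechet_derivative (map_in_charts c d \<phi>) (at x) v) (\<xi> d (map_in_charts c d \<phi> x))"
  unfolding linear_axis_sum[OF harmonic_chart.df_linear[OF harmonic_chart[OF assms(1,2)] assms(3)], of v]
  by (simp add: pullback_form_def inner_vec_def bilin_sum_left bilin_scaleR_left mult.commute)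

text \<open>Charts change in source and target at once. The pairing h(d phi(v), xi) is unchanged
  because \<open>df\<close> intertwines the two transition derivatives while \<open>h\<close> and
  \<open>\<xi>\<close> obey their transformation laws; raising the index is then
  \<open>matrix_inv_covector_transform\<close>.\<close>

lemma flux_vector_transform:
  assumes c: "c \<in> A" "c' \<in> A" and d: "d \<in> B" "d' \<in> B" and m: "m \<in> dom c d" "m \<in> dom c' d'"
  shows "frechet_derivative (transition c c') (at (snd c m)) (flux_vector c d (snd c m)) = flux_vector c' d' (snd c' m)"
proof -
  define D where "D = dom c d \<inter> dom c' d'"
  define x y where "x = snd c m" and "y = snd d (\<phi> m)"
  let ?f = "map_in_charts c d \<phi>" and ?f' = "map_in_charts c' d' \<phi>"
  let ?J = "frechet_derivative (transition c c') (at x)" and ?K = "frechet_derivative (transition d d') (at y)"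
  interpret L: harmonic_chart "coords c d" "snd d ` fst d" "g c" "h d" "\<xi> d" ?f
    by (rule harmonic_chart[OF c(1) d(1)])
  interpret L': harmonic_chart "coords c' d'" "snd d' ` fst d'" "g c'" "h d'" "\<xi> d'" ?f'
    by (rule harmonic_chart[OF c(2) d(2)])
  have mem: "m \<in> fst c" "m \<in> fst c'" "\<phi> m \<in> fst d" "\<phi> m \<in> fst d'"
    using m by (auto simp: dom_def)
  have xS: "x \<in> coords c d" "snd c' m \<in> coords c' d'" using m by (auto simp: x_def)
  have xO: "x \<in> snd c ` (fst c \<inter> fst c')" "y \<in> snd d ` (fst d \<inter> fst d')"
    using mem by (auto simp: x_def y_def)
  have tr: "transition c c' x = snd c' m" "transition d d' y = snd d' (\<phi> m)" "?f x = y" "?f' (snd c' m) = snd d' (\<phi> m)"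
    using mem c d by (simp_all add: x_def y_def transition_apply chart_A chart_B map_in_charts_apply)
  \<comment> \<open>Near \<open>x\<close> the map is expressed in the new charts in two ways, and
    the chain rule is applied to both.\<close>
  have df: "frechet_derivative ?f' (at (snd c' m)) (?J v) = ?K (frechet_derivative ?f (at x) v)" for v
  proof -
    have "(?f' has_derivative frechet_derivative ?f' (at (snd c' m))) (at (transition c c' x))"
      using C1_on_has_derivative[OF smooth_on_imp_C1_on[OF L'.smooth_f] xS(2)] by (simp add: tr)
    from has_derivative_compose[OF C1_on_has_derivative[OF transition_C1[OF atlas_A c] xO(1)] this]
    have 1: "((\<lambda>z. ?f' (transition c c' z)) has_derivative (\<lambda>v. frechet_derivative ?f' (at (snd c' m)) (?J v))) (at x)" .
    have "(transition d d' has_derivative ?K) (at (?f x))"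
      using C1_on_has_derivative[OF transition_C1[OF atlas_B d] xO(2)] by (simp add: tr)
    from has_derivative_compose[OF C1_on_has_derivative[OF smooth_on_imp_C1_on[OF L.smooth_f] xS(1)] this]
    have 2: "((\<lambda>z. transition d d' (?f z)) has_derivative (\<lambda>v. ?K (frechet_derivative ?f (at x) v))) (at x)" .
    have "((\<lambda>z. ?f' (transition c c' z)) has_derivative (\<lambda>v. ?K (frechet_derivative ?f (at x) v))) (at x)"
    proof (rule has_derivative_transform_within_open[OF 2])
      show "open (snd c ` D)"
        unfolding D_def
        by (intro atlas_image_open[OF atlas_A c(1)] open_Int dom_open c d le_infI1 dom_subset)
      show "x \<in> snd c ` D" using m by (auto simp: x_def D_def)
      show "transition d d' (?f z) = ?f' (transition c c' z)" if "z \<in> snd c ` D" for z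
        using that c d by (auto simp: D_def dom_def transition_apply chart_A chart_B map_in_charts_apply)
    qed
    from has_derivative_unique[OF 1 this] show ?thesis by (rule fun_cong)
  qed
  have GJ: "bilin (g c' (snd c' m)) (?J v) (?J w) = bilin (g c x) v w" for v w
    using M c xO(1) unfolding riemannian_manifold_def riemannian_metric_def tr(1)[symmetric] by blast
  have HK: "bilin (h d' (snd d' (\<phi> m))) (?K v) (?K w) = bilin (h d y) v w" for v w
    using N d xO(2) unfolding riemannian_manifold_def riemannian_metric_def tr(2)[symmetric] by blast
  have \<xi>K: "\<xi> d' (snd d' (\<phi> m)) = ?K (\<xi> d y)"
    using vector_field d xO(2) unfolding smooth_vector_field_def tr(2)[symmetric] by blast
  have "?J (matrix_inv (g c x) *v pullback_form (h d) (\<xi> d) ?f x)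
    = matrix_inv (g c' (snd c' m)) *v pullback_form (h d') (\<xi> d') ?f' (snd c' m)"
  proof (rule matrix_inv_covector_transform[OF _ _ _ _ _ GJ])
    show "linear ?J" using transition_linear[OF atlas_A c mem(1,2)] by (simp add: x_def)
    show "bilin (g c x) v v > 0" if "v \<noteq> 0" for v by (rule local_metric_pos[OF L.metric_G xS(1) that])
    show "bilin (g c' (snd c' m)) v v > 0" if "v \<noteq> 0" for v by (rule local_metric_pos[OF L'.metric_G xS(2) that])
    show "transpose (g c x) = g c x" by (rule local_metric_transpose[OF L.metric_G xS(1)])
    show "transpose (g c' (snd c' m)) = g c' (snd c' m)" by (rule local_metric_transpose[OF L'.metric_G xS(2)])
    show "pullback_form (h d') (\<xi> d') ?f' (snd c' m) \<bullet> ?J v = pullback_form (h d) (\<xi> d) ?f x \<bullet> v" for v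
      by (simp only: pullback_form_inner[OF c(1) d(1) xS(1)] pullback_form_inner[OF c(2) d(2) xS(2)] tr df HK \<xi>K)
  qed
  then show ?thesis by (simp add: flux_vector_def x_def)
qed

lemma flux_derivative_transform:
  assumes c: "c \<in> A" "c' \<in> A" and d: "d \<in> B" "d' \<in> B" and m: "m \<in> dom c d" "m \<in> dom c' d'"
    and u: "C1_function A u"
  shows "flux_derivative c d u (snd c m) = flux_derivative c' d' u (snd c' m)"
proof -
  let ?x = "snd c m" and ?x' = "snd c' m" and ?\<psi> = "transition c c'"
  have mem: "m \<in> fst c" "m \<in> fst c'" using m by (auto simp: dom_def)
  have tr: "?\<psi> ?x = ?x'" by (rule transition_apply[OF chart_A[OF c(1)] mem(1)])
  have "C1_on (snd c' ` fst c') (\<lambda>y. u (chart_inv c' y))"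
    using u c(2) by (simp add: C1_function_def del: Ck_on.simps)
  from C1_on_has_derivative[OF this]
  have "((\<lambda>y. u (chart_inv c' y)) has_derivative frechet_derivative (\<lambda>y. u (chart_inv c' y)) (at ?x')) (at (?\<psi> ?x))"
    using mem by (simp add: tr)
  from has_derivative_compose[OF C1_on_has_derivative[OF transition_C1[OF atlas_A c]] this]
  have "((\<lambda>z. u (chart_inv c' (?\<psi> z))) has_derivative
      (\<lambda>v. frechet_derivative (\<lambda>y. u (chart_inv c' y)) (at ?x') (frechet_derivative ?\<psi> (at ?x) v))) (at ?x)"
    using mem by blast
  then have "((\<lambda>z. u (chart_inv c z)) has_derivative
      (\<lambda>v. frechet_derivative (\<lambda>y. u (chart_inv c' y)) (at ?x') (frechet_derivative ?\<psi> (at ?x) v))) (at ?x)"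
  proof (rule has_derivative_transform_within_open)
    show "open (snd c ` (fst c \<inter> fst c'))"
      by (intro atlas_image_open[OF atlas_A c(1)] open_Int atlas_domain_open[OF atlas_A c(1)]
          atlas_domain_open[OF atlas_A c(2)] Int_lower1)
    show "u (chart_inv c' (?\<psi> z)) = u (chart_inv c z)" if "z \<in> snd c ` (fst c \<inter> fst c')" for z
      using that c by (auto simp: transition_apply chart_A chart_inv_left)
  qed (use mem in auto)
  from frechet_derivative_at[OF this, symmetric]
  show ?thesis
    by (simp add: flux_derivative_def flux_vector_transform[OF c d m])
qed

lemma volume_density_transform:
  assumes c: "c \<in> A" "c' \<in> A" and m: "m \<in> fst c" "m \<in> fst c'"
  shows "volume_density (g c) (snd c m)
    = \<bar>det (matrix (frechet_derivative (transition c c') (at (snd c m))))\<bar> * volume_density (g c') (snd c' m)"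
proof -
  have "snd c m \<in> snd c ` (fst c \<inter> fst c')" using m by blast
  then have "bilin (g c' (transition c c' (snd c m))) (frechet_derivative (transition c c') (at (snd c m)) v)
      (frechet_derivative (transition c c') (at (snd c m)) w) = bilin (g c (snd c m)) v w" for v w
    using M c unfolding riemannian_manifold_def riemannian_metric_def by blast
  then show ?thesis
    unfolding volume_density_def transition_apply[OF chart_A[OF c(1)] m(1)]
    by (rule det_metric_transform[OF transition_linear[OF atlas_A c m]])
qed

lemma flux_derivative_eq_0:
  assumes c: "c \<in> A" and d: "d \<in> B" and K: "compact K" "\<And>m. m \<notin> K \<Longrightarrow> u m = 0" and m: "m \<in> dom c d" "m \<notin> K"
  shows "flux_derivative c d u (snd c m) = 0"
  unfolding flux_derivative_def
proof (rule frechet_derivative_eq_0)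
  show "open (snd c ` (dom c d - K))"
    using dom_open[OF c d] dom_subset[of c d] compact_imp_closed[OF K(1)]
    by (intro atlas_image_open[OF atlas_A c]) auto
  show "snd c m \<in> snd c ` (dom c d - K)" using m by blast
  show "u (chart_inv c y) = 0" if "y \<in> snd c ` (dom c d - K)" for y
    using that K(2) dom_subset[of c d] by (auto simp: chart_inv_left[OF chart_A[OF c]])
qed

lemma chart_function_C1:
  "c \<in> A \<Longrightarrow> C1_function A u \<Longrightarrow> C1_on (coords c d) (\<lambda>x. u (chart_inv c x))"
  using C1_on_subset[of "snd c ` fst c" "\<lambda>x. u (chart_inv c x)" "coords c d"] dom_subset[of c d]
  by (auto simp: C1_function_def simp del: Ck_on.simps)

lemma flux_vector_C1:
  assumes c: "c \<in> A" and d: "d \<in> B"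
  shows "C1_on (coords c d) (\<lambda>x. flux_vector c d x $ i)"
proof -
  interpret L: harmonic_chart "coords c d" "snd d ` fst d" "g c" "h d" "\<xi> d" "map_in_charts c d \<phi>"
    by (rule harmonic_chart[OF c d])
  show ?thesis
    unfolding flux_vector_def matrix_vector_mult_def vec_lambda_beta
    by (intro C1_on_sum C1_on_mult C1_on_nth local_metric_inv_C1[OF L.metric_G] L.pullback_form_C1)
qed

lemma flux_derivative_sum:
  assumes c: "c \<in> A" and u: "C1_function A u" and x: "x \<in> coords c d"
  shows "flux_derivative c d u x
    = (\<Sum>i\<in>UNIV. flux_vector c d x $ i * frechet_derivative (\<lambda>y. u (chart_inv c y)) (at x) (axis i 1))"
  unfolding flux_derivative_def
  by (subst linear_axis_sum[OF has_derivative_linear[OF C1_on_has_derivative[OF chart_function_C1[OF c u] x]]]) simp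

lemma flux_derivative_continuous:
  assumes c: "c \<in> A" and d: "d \<in> B" and u: "C1_function A u"
  shows "continuous_on (coords c d) (flux_derivative c d u)"
proof -
  have "continuous_on (coords c d)
      (\<lambda>x. \<Sum>i\<in>UNIV. flux_vector c d x $ i * frechet_derivative (\<lambda>y. u (chart_inv c y)) (at x) (axis i 1))"
    by (intro continuous_on_sum continuous_on_mult C1_on_imp_continuous_on[OF flux_vector_C1[OF c d]]
        C1_on_continuous_derivative[OF chart_function_C1[OF c u]])
  then show ?thesis using flux_derivative_sum[OF c u] by (simp cong: continuous_on_cong)
qed

lemma coords_compact:
  assumes c: "c \<in> A" and K: "compact K" "K \<subseteq> dom c d"
  shows "compact (snd c ` K)" "snd c ` K \<subseteq> coords c d"
    "\<And>m. m \<in> dom c d \<Longrightarrow> snd c m \<in> snd c ` K \<Longrightarrow> m \<in> K"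
proof -
  have "K \<subseteq> fst c" using K(2) dom_subset by blast
  then show "compact (snd c ` K)"
    using homeomorphism_cont1[OF chart_homeomorphism[OF chart_A[OF c]]]
    by (intro compact_continuous_image K(1)) (rule continuous_on_subset)
  show "snd c ` K \<subseteq> coords c d" using K(2) by blast
  show "m \<in> K" if "m \<in> dom c d" "snd c m \<in> snd c ` K" for m
  proof -
    have "m \<in> fst c" using that(1) dom_subset by blast
    then show ?thesis
      using that(2) inj_on_image_mem_iff[OF inj_on_chart[OF chart_A[OF c] order_refl]] \<open>K \<subseteq> fst c\<close> by blast
  qed
qed

section \<open>Integrals in charts\<close>

definition flux_integrand ::
  "('m, 'a) chart \<Rightarrow> ('n, 'b) chart \<Rightarrow> ('m \<Rightarrow> real) \<Rightarrow> ('m \<Rightarrow> real) \<Rightarrow> real ^ 'a \<Rightarrow> real" where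
  "flux_integrand c d u v x = (if x \<in> coords c d
     then v (chart_inv c x) * (volume_density (g c) x * flux_derivative c d u x) else 0)"

text \<open>A compact support of either function inside \<open>dom c d\<close> suffices, since the
  derivative of \<open>u\<close> vanishes wherever \<open>u\<close> vanishes nearby. The extension
  by zero is then continuous.\<close>

lemma flux_integrand_integrable:
  assumes c: "c \<in> A" and d: "d \<in> B" and u: "C1_function A u" and v: "C1_function A v"
    and K: "compact K" "K \<subseteq> dom c d" "(\<forall>m. m \<notin> K \<longrightarrow> u m = 0) \<or> (\<forall>m. m \<notin> K \<longrightarrow> v m = 0)"
  shows "continuous_on UNIV (flux_integrand c d u v)" "integrable lborel (flux_integrand c d u v)"
proof -
  note lm = local_metric_A[OF c dom_subset dom_open[OF c d]]
  let ?F = "\<lambda>x. v (chart_inv c x) * (volume_density (g c) x * flux_derivative c d u x)"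
  have zero: "?F x = 0" if x: "x \<in> coords c d" "x \<notin> snd c ` K" for x
  proof -
    obtain m where m: "m \<in> dom c d" "x = snd c m" using x(1) by blast
    then have "m \<notin> K" using x(2) by blast
    then show ?thesis
      using K(3) flux_derivative_eq_0[OF c d K(1) _ m(1)] m dom_subset[of c d]
      by (auto simp: chart_inv_left[OF chart_A[OF c]])
  qed
  show cont: "continuous_on UNIV (flux_integrand c d u v)"
    unfolding flux_integrand_def
    by (rule continuous_extend_by_0[OF coords_open[OF c d] _ coords_compact(1,2)[OF c K(1,2)] zero])
       (intro continuous_on_mult C1_on_imp_continuous_on[OF chart_function_C1[OF c v]]
        C1_on_imp_continuous_on[OF volume_density_C1[OF lm]] flux_derivative_continuous[OF c d u])
  show "integrable lborel (flux_integrand c d u v)"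
    by (rule integrable_compact_support[OF cont coords_compact(1)[OF c K(1,2)]])
       (use zero in \<open>auto simp: flux_integrand_def\<close>)
qed

text \<open>As \<open>u\<close> is supported in the first domain and \<open>v\<close> in the second,
  both integrands live on the overlap. There the density changes by the Jacobian determinant and
  <theta, du> is invariant, so change of variables applies.\<close>

lemma flux_integral_transform:
  assumes c: "c \<in> A" "c' \<in> A" and d: "d \<in> B" "d' \<in> B" and u: "C1_function A u" and v: "C1_function A v"
    and K: "compact K" "K \<subseteq> dom c d" "\<And>m. m \<notin> K \<Longrightarrow> u m = 0"
    and K': "compact K'" "K' \<subseteq> dom c' d'" "\<And>m. m \<notin> K' \<Longrightarrow> v m = 0"
  shows "(\<integral>x. flux_integrand c d u v x \<partial>lborel) = (\<integral>x. flux_integrand c' d' u v x \<partial>lborel)"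
proof -
  define D where "D = dom c d \<inter> dom c' d'"
  let ?\<psi> = "transition c' c" and ?S = "snd c' ` D"
  let ?F = "\<lambda>x. v (chart_inv c x) * (volume_density (g c) x * flux_derivative c d u x)"
  let ?J = "\<lambda>x. frechet_derivative ?\<psi> (at x)"
  have sub: "D \<subseteq> fst c" "D \<subseteq> fst c'" by (auto simp: D_def dom_def)
  have img: "?\<psi> ` ?S = snd c ` D" by (rule transition_image[OF atlas_A c(2) sub(2)])
  have L: "flux_integrand c d u v = (\<lambda>x. if x \<in> ?\<psi> ` ?S then ?F x else 0)"
  proof
    fix x
    show "flux_integrand c d u v x = (if x \<in> ?\<psi> ` ?S then ?F x else 0)"
    proof (cases "x \<in> coords c d")
      case True
      then obtain m where m: "m \<in> dom c d" "x = snd c m" by blast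
      then have mc: "m \<in> fst c" by (simp add: dom_def)
      \<comment> \<open>A point of the first domain outside the overlap lies outside the second
        domain, hence outside the support of \<open>v\<close>.\<close>
      have "v m = 0" if "x \<notin> snd c ` D"
        using that m K'(2,3) by (auto simp: D_def)
      then show ?thesis using True m by (auto simp: flux_integrand_def img chart_inv_left[OF chart_A[OF c(1)] mc])
    next
      case False
      then have "x \<notin> snd c ` D" by (auto simp: D_def)
      then show ?thesis using False by (simp add: flux_integrand_def img)
    qed
  qed
  have R: "flux_integrand c' d' u v = (\<lambda>x. if x \<in> ?S then \<bar>det (matrix (?J x))\<bar> * ?F (?\<psi> x) else 0)"
  proof
    fix x
    show "flux_integrand c' d' u v x = (if x \<in> ?S then \<bar>det (matrix (?J x))\<bar> * ?F (?\<psi> x) else 0)"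
    proof (cases "x \<in> coords c' d'")
      case True
      then obtain m where m: "m \<in> dom c' d'" "x = snd c' m" by blast
      then have mc': "m \<in> fst c'" by (simp add: dom_def)
      show ?thesis
      proof (cases "m \<in> D")
        case mO: True
        then have md: "m \<in> dom c d" and mc: "m \<in> fst c" by (auto simp: D_def dom_def)
        have "x \<in> ?S" using mO m by blast
        then show ?thesis
          using True volume_density_transform[OF c(2,1) mc' mc] flux_derivative_transform[OF c d md m(1) u]
          by (simp add: flux_integrand_def m(2) transition_apply[OF chart_A[OF c(2)] mc']
              chart_inv_left[OF chart_A[OF c(1)] mc] chart_inv_left[OF chart_A[OF c(2)] mc'])
      next
        case False
        \<comment> \<open>Conversely, outside the first domain it is the derivative of
          \<open>u\<close> that vanishes.\<close>
        then have "m \<notin> K" using m(1) K(2) by (auto simp: D_def)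
        then have "flux_derivative c' d' u x = 0"
          unfolding m(2) by (intro flux_derivative_eq_0[OF c(2) d(2) K(1,3) m(1)])
        moreover have "x \<notin> ?S"
          using False m(2) inj_on_image_mem_iff[OF inj_on_chart[OF chart_A[OF c(2)] order_refl] mc' sub(2)] by simp
        ultimately show ?thesis by (simp add: flux_integrand_def)
      qed
    next
      case False
      then have "x \<notin> ?S" by (auto simp: D_def)
      then show ?thesis using False by (simp add: flux_integrand_def)
    qed
  qed
  have der: "(?\<psi> has_derivative ?J x) (at x)" if "x \<in> ?S" for x
    by (rule C1_on_has_derivative[OF transition_C1[OF atlas_A c(2,1)]]) (use that sub in auto)
  have "open ?S" unfolding D_def
    by (intro atlas_image_open[OF atlas_A c(2)] open_Int dom_open c d sub[unfolded D_def])
  moreover have "inj_on ?\<psi> ?S"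
  proof (rule inj_onI)
    fix x y assume "x \<in> ?S" "y \<in> ?S" and eq: "?\<psi> x = ?\<psi> y"
    then obtain m n where mn: "m \<in> D" "x = snd c' m" "n \<in> D" "y = snd c' n" by blast
    then have "snd c m = snd c n" using eq sub by (auto simp: transition_apply[OF chart_A[OF c(2)]] subset_iff)
    then show "x = y" using mn inj_onD[OF inj_on_chart[OF chart_A[OF c(1)] sub(1)]] by auto
  qed
  moreover have "integrable lborel (flux_integrand c d u v)"
    by (rule flux_integrand_integrable(2)[OF c(1) d(1) u v K(1,2)]) (use K(3) in blast)
  moreover have "integrable lborel (flux_integrand c' d' u v)"
    by (rule flux_integrand_integrable(2)[OF c(2) d(2) u v K'(1,2)]) (use K'(3) in blast)
  ultimately show ?thesis
    unfolding L R by (intro integral_change_of_variables_finite der)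
qed

definition lie_integrand ::
  "('m, 'a) chart \<Rightarrow> ('n, 'b) chart \<Rightarrow> ('m \<Rightarrow> real) \<Rightarrow> real ^ 'a \<Rightarrow> real" where
  "lie_integrand c d u x = (if x \<in> coords c d
     then u (chart_inv c x) * (volume_density (g c) x * pullback_lie_trace (g c) (h d) (\<xi> d) (map_in_charts c d \<phi>) x) else 0)"

text \<open>Extended by zero, the components of sqrt(det g) times \<open>u\<close> times the dual
  vector are C^1 on the whole space with compact support, so their partial derivatives integrate to
  zero. By \<open>harmonic_chart.divergence\<close> their sum is the integrand with the Lie trace
  plus the flux integrand.\<close>

lemma chart_divergence_theorem:
  assumes c: "c \<in> A" and d: "d \<in> B" and u: "C1_function A u"
    and K: "compact K" "K \<subseteq> dom c d" "\<And>m. m \<notin> K \<Longrightarrow> u m = 0"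
  shows "continuous_on UNIV (lie_integrand c d u)" "integrable lborel (lie_integrand c d u)"
    "(\<integral>x. lie_integrand c d u x \<partial>lborel) = - (\<integral>x. flux_integrand c d u (\<lambda>_. 1) x \<partial>lborel)"
proof -
  interpret L: harmonic_chart "coords c d" "snd d ` fst d" "g c" "h d" "\<xi> d" "map_in_charts c d \<phi>"
    by (rule harmonic_chart[OF c d])
  let ?u = "\<lambda>x. u (chart_inv c x)"
  let ?V = "\<lambda>i x. ?u x * (volume_density (g c) x * flux_vector c d x $ i)"
  let ?W = "\<lambda>i x. if x \<in> coords c d then ?V i x else 0"
  let ?div = "\<lambda>x. \<Sum>i\<in>UNIV. frechet_derivative (?W i) (at x) (axis i 1)"
  note cK = coords_compact[OF c K(1,2)]
  have V0: "?V i x = 0" if x: "x \<in> coords c d" "x \<notin> snd c ` K" for i x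
  proof -
    obtain m where m: "m \<in> dom c d" "x = snd c m" using x(1) by blast
    then have "m \<notin> K" using x(2) by blast
    then show ?thesis using K(3) m dom_subset[of c d] by (auto simp: chart_inv_left[OF chart_A[OF c]])
  qed
  have V: "C1_on (coords c d) (?V i)" for i
    by (intro C1_on_mult chart_function_C1[OF c u] volume_density_C1[OF L.metric_G] flux_vector_C1[OF c d])
  have W: "C1_on UNIV (?W i)" for i
    by (rule C1_extend_by_0[OF coords_open[OF c d] V cK(1,2) V0])
  have W0: "?W i x = 0" if "x \<notin> snd c ` K" for i x
    using V0 that by simp
  note int = integral_derivative_eq_0[OF W cK(1) W0]
  have u1: "C1_function A (\<lambda>_. 1)" by (rule C1_function_const[OF atlas_A])
  note flux = flux_integrand_integrable[OF c d u u1 K(1,2)]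
  have eq: "lie_integrand c d u = (\<lambda>x. ?div x - flux_integrand c d u (\<lambda>_. 1) x)"
  proof
    fix x
    show "lie_integrand c d u x = ?div x - flux_integrand c d u (\<lambda>_. 1) x"
    proof (cases "x \<in> coords c d")
      case True
      have "frechet_derivative (?W i) (at x) = frechet_derivative (?V i) (at x)" for i
        by (rule frechet_derivative_eq_on_open[OF coords_open[OF c d] True]) (use W in auto)
      then have "?div x = volume_density (g c) x * (?u x * pullback_lie_trace (g c) (h d) (\<xi> d) (map_in_charts c d \<phi>) x
          + flux_derivative c d u x)"
        using L.divergence[OF True chart_function_C1[OF c u]]
        by (simp add: flux_derivative_sum[OF c u True] flux_vector_def)
      then show ?thesis using True by (simp add: lie_integrand_def flux_integrand_def algebra_simps)
    next
      case False
      have "frechet_derivative (?W i) (at x) v = 0" for i v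
        by (rule frechet_derivative_eq_0[of "- (snd c ` K)"])
           (use False cK(1,2) W0 in \<open>auto simp: compact_imp_closed open_Compl\<close>)
      then show ?thesis using False by (simp add: lie_integrand_def flux_integrand_def)
    qed
  qed
  have fl: "(\<forall>m. m \<notin> K \<longrightarrow> u m = 0) \<or> (\<forall>m. m \<notin> K \<longrightarrow> (\<lambda>_. 1 :: real) m = 0)" using K(3) by blast
  show "continuous_on UNIV (lie_integrand c d u)"
    unfolding eq by (intro continuous_on_diff continuous_on_sum C1_on_continuous_derivative[OF W] flux(1)[OF fl])
  have intdiv: "integrable lborel ?div" by (intro Bochner_Integration.integrable_sum int(1))
  then show "integrable lborel (lie_integrand c d u)"
    unfolding eq by (intro Bochner_Integration.integrable_diff flux(2)[OF fl])
  have "(\<integral>x. ?div x \<partial>lborel) = (\<Sum>i\<in>UNIV. \<integral>x. frechet_derivative (?W i) (at x) (axis i 1) \<partial>lborel)"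
    by (rule Bochner_Integration.integral_sum) (rule int(1))
  also have "\<dots> = 0" by (intro sum.neutral ballI int(2))
  finally show "(\<integral>x. lie_integrand c d u x \<partial>lborel) = - (\<integral>x. flux_integrand c d u (\<lambda>_. 1) x \<partial>lborel)"
    unfolding eq by (simp add: Bochner_Integration.integral_diff[OF intdiv flux(2)[OF fl]])
qed

section \<open>Vanishing of the derivative and constancy of the map\<close>

lemma derivative_vanishes:
  obtains c d V where "c \<in> A" "d \<in> B" "open V" "m \<in> V" "V \<subseteq> dom c d"
    "\<And>x v. x \<in> snd c ` V \<Longrightarrow> frechet_derivative (map_in_charts c d \<phi>) (at x) v = 0"
proof -
  have "\<exists>c d. c \<in> A \<and> d \<in> B \<and> n \<in> dom c d" for n
  proof -
    obtain c where "c \<in> A" "n \<in> fst c" by (rule atlas_covers[OF atlas_A])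
    moreover obtain d where "d \<in> B" "\<phi> n \<in> fst d" by (rule atlas_covers[OF atlas_B])
    ultimately show ?thesis by (intro exI[of _ c] exI[of _ d]) (simp add: dom_def)
  qed
  then obtain c d where cd: "\<And>n. c n \<in> A" "\<And>n. d n \<in> B" "\<And>n. n \<in> dom (c n) (d n)" by metis
  obtain I \<rho> K where I: "finite I" and \<rho>: "\<And>i. C1_function A (\<rho> i)" "\<And>i m. \<rho> i m \<ge> 0" "\<And>m. (\<Sum>i\<in>I. \<rho> i m) = 1"
    and K: "\<And>i. compact (K i)" "\<And>i. K i \<subseteq> dom (c i) (d i)" "\<And>i m. m \<notin> K i \<Longrightarrow> \<rho> i m = 0"
    by (rule C1_partition_of_unity[OF atlas_A compact_M cd(1,3) dom_subset dom_open[OF cd(1,2)]]) blast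
  let ?E = "\<lambda>i. lie_integrand (c i) (d i) (\<rho> i)"
  let ?X = "\<lambda>i j k. flux_integrand (c i) (d i) (\<rho> j) (\<rho> k)"
  note E = chart_divergence_theorem[OF cd(1,2) \<rho>(1) K]
  have intX: "integrable lborel (?X i i k)" "integrable lborel (?X i j i)" for i j k
    by (rule flux_integrand_integrable(2)[OF cd(1,2) \<rho>(1) \<rho>(1) K(1,2)], use K(3) in blast)+
  \<comment> \<open>Inserts the factor 1 as the sum of all \<open>\<rho> k\<close>, so that each
    summand is also supported in the k-th chart.\<close>
  have X1: "flux_integrand (c i) (d i) (\<rho> i) (\<lambda>_. 1) = (\<lambda>x. \<Sum>k\<in>I. ?X i i k x)" for i
    by (auto simp: flux_integrand_def fun_eq_iff sum_distrib_right[symmetric] \<rho>(3))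
  \<comment> \<open>The sum of the \<open>\<rho> j\<close> is the constant 1, so its derivative in
    any direction is zero.\<close>
  have X0: "(\<Sum>j\<in>I. ?X k j k x) = 0" for k x
  proof (cases "x \<in> coords (c k) (d k)")
    case True
    have "((\<lambda>y. \<Sum>j\<in>I. \<rho> j (chart_inv (c k) y)) has_derivative
        (\<lambda>v. \<Sum>j\<in>I. frechet_derivative (\<lambda>y. \<rho> j (chart_inv (c k) y)) (at x) v)) (at x)"
      by (intro has_derivative_sum C1_on_has_derivative[OF chart_function_C1[OF cd(1) \<rho>(1)] True])
    then have "(\<lambda>v. \<Sum>j\<in>I. frechet_derivative (\<lambda>y. \<rho> j (chart_inv (c k) y)) (at x) v) = (\<lambda>v. 0)"
      unfolding \<rho>(3) using has_derivative_const has_derivative_unique by blast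
    then have "(\<Sum>j\<in>I. flux_derivative (c k) (d k) (\<rho> j) x) = 0"
      unfolding flux_derivative_def by (rule fun_cong)
    then show ?thesis using True by (simp add: flux_integrand_def sum_distrib_left[symmetric])
  qed (simp add: flux_integrand_def)
  have "(\<Sum>i\<in>I. \<integral>x. ?E i x \<partial>lborel) = - (\<Sum>i\<in>I. \<Sum>k\<in>I. \<integral>x. ?X i i k x \<partial>lborel)"
    by (simp add: E(3) X1 Bochner_Integration.integral_sum intX(1) sum_negf)
  \<comment> \<open>The exchange of charts: the summand with \<open>\<rho> i\<close> differentiated
    and \<open>\<rho> k\<close> as factor moves from the i-th to the k-th chart.\<close>
  also have "(\<Sum>i\<in>I. \<Sum>k\<in>I. \<integral>x. ?X i i k x \<partial>lborel) = (\<Sum>i\<in>I. \<Sum>k\<in>I. \<integral>x. ?X k i k x \<partial>lborel)"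
    by (intro sum.cong refl flux_integral_transform[OF cd(1,1,2,2) \<rho>(1,1) K K])
  also have "\<dots> = (\<Sum>k\<in>I. \<Sum>i\<in>I. \<integral>x. ?X k i k x \<partial>lborel)"
    by (rule sum.swap)
  also have "\<dots> = (\<Sum>k\<in>I. \<integral>x. (\<Sum>i\<in>I. ?X k i k x) \<partial>lborel)"
    by (simp add: Bochner_Integration.integral_sum intX(2))
  also have "\<dots> = 0" by (simp add: X0)
  finally have sum0: "(\<Sum>i\<in>I. \<integral>x. \<sigma> * ?E i x \<partial>lborel) = 0"
    by (simp add: sum_distrib_left[symmetric])
  have sign: "\<sigma> * pullback_lie_trace (g (c i)) (h (d i)) (\<xi> (d i)) (map_in_charts (c i) (d i) \<phi>) x \<ge> 0"
    "pullback_lie_trace (g (c i)) (h (d i)) (\<xi> (d i)) (map_in_charts (c i) (d i) \<phi>) x = 0 \<Longrightarrow>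
      frechet_derivative (map_in_charts (c i) (d i) \<phi>) (at x) v = 0"
    if "x \<in> coords (c i) (d i)" for i x v
  proof -
    interpret L: harmonic_chart "coords (c i) (d i)" "snd (d i) ` fst (d i)" "g (c i)" "h (d i)" "\<xi> (d i)" "map_in_charts (c i) (d i) \<phi>"
      by (rule harmonic_chart[OF cd(1,2)])
    note pos = definite[OF cd(2) L.f_in[OF that]]
    show "\<sigma> * pullback_lie_trace (g (c i)) (h (d i)) (\<xi> (d i)) (map_in_charts (c i) (d i) \<phi>) x \<ge> 0"
      by (rule L.pullback_lie_trace_sign(1)[OF that pos])
    show "frechet_derivative (map_in_charts (c i) (d i) \<phi>) (at x) v = 0"
      if 0: "pullback_lie_trace (g (c i)) (h (d i)) (\<xi> (d i)) (map_in_charts (c i) (d i) \<phi>) x = 0"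
      by (rule L.pullback_lie_trace_sign(2)[OF \<open>x \<in> _\<close> pos 0])
  qed
  have wpos: "volume_density (g (c i)) x > 0" if "x \<in> coords (c i) (d i)" for i x
    by (rule volume_density_pos[OF local_metric_A[OF cd(1) dom_subset dom_open[OF cd(1,2)]] that])
  have nonneg: "\<sigma> * ?E i x \<ge> 0" for i x
  proof (cases "x \<in> coords (c i) (d i)")
    case True
    have "\<sigma> * ?E i x = \<rho> i (chart_inv (c i) x) * (volume_density (g (c i)) x *
        (\<sigma> * pullback_lie_trace (g (c i)) (h (d i)) (\<xi> (d i)) (map_in_charts (c i) (d i) \<phi>) x))"
      using True by (simp add: lie_integrand_def)
    also have "\<dots> \<ge> 0"
      by (intro mult_nonneg_nonneg \<rho>(2) less_imp_le[OF wpos[OF True]] sign(1)[OF True])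
    finally show ?thesis .
  qed (simp add: lie_integrand_def)
  \<comment> \<open>Definiteness at one nonzero vector over one point already excludes zero; a basis
    vector exists because index types are inhabited.\<close>
  have \<sigma>: "\<sigma> \<noteq> 0"
  proof
    assume "\<sigma> = 0"
    obtain d where "d \<in> B" "\<phi> m \<in> fst d" by (rule atlas_covers[OF atlas_B])
    then show False
      using definite[of d "snd d (\<phi> m)" "axis undefined 1"] \<open>\<sigma> = 0\<close> by (simp add: axis_eq_0_iff)
  qed
  \<comment> \<open>A vanishing sum of nonnegative integrals forces each to vanish, and a continuous
    nonnegative integrand is then zero everywhere.\<close>
  have E0: "?E i x = 0" if "i \<in> I" for i x
  proof -
    have "(\<integral>x. \<sigma> * ?E i x \<partial>lborel) = 0"
      by (rule sum_nonneg_0[OF I _ sum0 that]) (intro integral_nonneg_AE AE_I2 nonneg)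
    moreover have "continuous_on UNIV (\<lambda>x. \<sigma> * ?E i x)" by (intro continuous_intros E(1))
    moreover have "integrable lborel (\<lambda>x. \<sigma> * ?E i x)" using E(2)[of i] by simp
    ultimately have "\<sigma> * ?E i x = 0"
      using nonneg continuous_nonneg_integral_eq_0[of "\<lambda>x. \<sigma> * ?E i x" x] by blast
    with \<sigma> show ?thesis by simp
  qed
  obtain i where i: "i \<in> I" "\<rho> i m > 0"
    using \<rho>(3)[of m] \<rho>(2)[of _ m] by (metis less_le sum.neutral zero_neq_one)
  let ?V = "{n. \<rho> i n > 0}"
  have "?V \<subseteq> K i" using K(3)[of _ i] by force
  then have VK: "?V \<subseteq> dom (c i) (d i)" using K(2) by blast
  show thesis
  proof (rule that[OF cd(1,2) C1_function_open_pos[OF atlas_A \<rho>(1)] _ VK])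
    show "m \<in> ?V" using i by simp
    fix x v assume "x \<in> snd (c i) ` ?V"
    then obtain n where n: "\<rho> i n > 0" "x = snd (c i) n" by blast
    then have nd: "n \<in> dom (c i) (d i)" using VK by blast
    then have x: "x \<in> coords (c i) (d i)" and "n \<in> fst (c i)" using n by (auto simp: dom_def)
    then have "\<rho> i (chart_inv (c i) x) > 0" using n chart_inv_left[OF chart_A[OF cd(1)]] by simp
    then have "pullback_lie_trace (g (c i)) (h (d i)) (\<xi> (d i)) (map_in_charts (c i) (d i) \<phi>) x = 0"
      using E0[OF i(1), of x] x wpos[OF x] by (simp add: lie_integrand_def)
    then show "frechet_derivative (map_in_charts (c i) (d i) \<phi>) (at x) v = 0"
      by (rule sign(2)[OF x])
  qed
qed

text \<open>On a ball, which is convex, a zero derivative makes the coordinate expression constant;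
  the target chart is injective, so the map itself is constant near \<open>m\<close>.\<close>

lemma locally_constant: "\<exists>T. open T \<and> m \<in> T \<and> (\<forall>n\<in>T. \<phi> m = \<phi> n)"
proof -
  obtain c d V where c: "c \<in> A" and d: "d \<in> B" and V: "open V" "m \<in> V" "V \<subseteq> dom c d"
    and df: "\<And>x v. x \<in> snd c ` V \<Longrightarrow> frechet_derivative (map_in_charts c d \<phi>) (at x) v = 0"
    by (rule derivative_vanishes[of m]) blast
  let ?f = "map_in_charts c d \<phi>"
  have Vc: "V \<subseteq> fst c" using V(3) dom_subset by blast
  have "open (snd c ` V)" by (rule atlas_image_open[OF atlas_A c Vc V(1)])
  then obtain r where r: "r > 0" "ball (snd c m) r \<subseteq> snd c ` V"
    using V(2) open_contains_ball by blast
  have der: "(?f has_derivative (\<lambda>_. 0)) (at x)" if "x \<in> ball (snd c m) r" for x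
  proof -
    have x: "x \<in> snd c ` V" using that r(2) by blast
    then have "x \<in> coords c d" using V(3) by blast
    then have "(?f has_derivative frechet_derivative ?f (at x)) (at x)"
      by (rule C1_on_has_derivative[OF smooth_on_imp_C1_on[OF harmonic_chart.smooth_f[OF harmonic_chart[OF c d]]]])
    moreover have "frechet_derivative ?f (at x) = (\<lambda>_. 0)" by (rule ext) (rule df[OF x])
    ultimately show ?thesis by simp
  qed
  let ?U = "chart_inv c ` ball (snd c m) r"
  have bc: "ball (snd c m) r \<subseteq> snd c ` fst c" using r(2) Vc by blast
  have "\<phi> m = \<phi> n" if nU: "n \<in> ?U" for n
  proof -
    obtain x where x: "x \<in> ball (snd c m) r" "n = chart_inv c x" using nU by blast
    have n: "n \<in> V" unfolding x(2) by (rule chart_inv_image[OF chart_A[OF c] Vc]) (use x(1) r(2) in blast)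
    have "snd c n = x" unfolding x(2) by (rule chart_inv_right[OF chart_A[OF c]]) (use x(1) bc in blast)
    moreover have "?f (snd c m) = ?f x"
      by (rule has_derivative_zero_unique[of "ball (snd c m) r"]) (use r(1) x(1) in \<open>auto intro: has_derivative_at_withinI[OF der]\<close>)
    moreover have "m \<in> fst c" "n \<in> fst c" using n V(2) Vc by blast+
    ultimately have "snd d (\<phi> m) = snd d (\<phi> n)"
      using map_in_charts_apply[OF c, of m d] map_in_charts_apply[OF c, of n d] by simp
    moreover have "\<phi> m \<in> fst d" "\<phi> n \<in> fst d" using V n by (auto simp: dom_def)
    ultimately show ?thesis by (rule inj_onD[OF inj_on_chart[OF chart_B[OF d] order_refl]])
  qed
  moreover have "open ?U" by (rule chart_inv_open_image[OF chart_A[OF c] open_ball bc])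
  moreover have "m \<in> ?U"
    using r(1) V(2) Vc chart_inv_left[OF chart_A[OF c], of m] by (intro image_eqI[of _ _ "snd c m"]) auto
  ultimately show ?thesis by blast
qed

lemma map_constant: "\<phi> constant_on UNIV"
proof -
  have conn: "connected (UNIV :: 'm set)"
    using M by (simp add: riemannian_manifold_def smooth_manifold_def)
  have "\<forall>m\<in>UNIV. eventually (\<lambda>n. \<phi> m = \<phi> n) (at m)"
  proof
    fix m
    obtain T where "open T" "m \<in> T" "\<forall>n\<in>T. \<phi> m = \<phi> n" using locally_constant by blast
    then show "eventually (\<lambda>n. \<phi> m = \<phi> n) (at m)"
      unfolding eventually_at_topological by (intro exI[of _ T]) simp
  qed
  from connected_local_const[OF conn UNIV_I UNIV_I this] show ?thesis
    unfolding constant_on_def by blast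
qed

end


theorem proposition9:
  fixes A :: "('m::{second_countable_topology, t2_space}, 'a::finite) chart set"
    and g :: "('m, 'a) metric"
    and B :: "('n::{second_countable_topology, t2_space}, 'b::finite) chart set"
    and h :: "('n, 'b) metric"
    and \<xi> :: "('n, 'b) vfield"
    and \<Lambda> :: real
    and \<phi> :: "'m \<Rightarrow> 'n"
  assumes "riemannian_manifold A g"
    and "compact (UNIV :: 'm set)"
    and "orientable A"
    and "nontrivial_ricci_soliton B h \<xi> \<Lambda>"
    and "ricci_greater B h \<Lambda> \<or> ricci_less B h \<Lambda>"
    and "harmonic_map A g B h \<phi>"
  shows "\<phi> constant_on UNIV"
proof -
  have sol: "riemannian_manifold B h" "smooth_vector_field B \<xi>"
    and eq: "\<And>d y v. d \<in> B \<Longrightarrow> y \<in> snd d ` fst d \<Longrightarrow>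
      ricci (h d) y v v + 1 / 2 * lie_derivative (\<xi> d) (h d) (\<lambda>_. v) (\<lambda>_. v) y = \<Lambda> * bilin (h d y) v v"
    using assms(4) unfolding nontrivial_ricci_soliton_def ricci_soliton_def by blast+
  \<comment> \<open>The soliton equation makes the Lie derivative twice the difference of
    \<open>\<Lambda>\<close> times the metric and the Ricci tensor. The sign is -1 for
    \<open>ricci_greater\<close> and 1 for \<open>ricci_less\<close>.\<close>
  have "\<exists>\<sigma>. \<forall>d\<in>B. \<forall>y\<in>snd d ` fst d. \<forall>v. v \<noteq> 0 \<longrightarrow> \<sigma> * lie_derivative (\<xi> d) (h d) (\<lambda>_. v) (\<lambda>_. v) y > 0"
    using assms(5)
  proof
    assume gt: "ricci_greater B h \<Lambda>"
    have "- 1 * lie_derivative (\<xi> d) (h d) (\<lambda>_. v) (\<lambda>_. v) y > 0"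
      if "d \<in> B" "y \<in> snd d ` fst d" "v \<noteq> 0" for d y v
    proof -
      have "ricci (h d) y v v > \<Lambda> * bilin (h d y) v v"
        using gt that unfolding ricci_greater_def by blast
      with eq[OF that(1,2), of v] show ?thesis by linarith
    qed
    then show ?thesis by blast
  next
    assume lt: "ricci_less B h \<Lambda>"
    have "1 * lie_derivative (\<xi> d) (h d) (\<lambda>_. v) (\<lambda>_. v) y > 0"
      if "d \<in> B" "y \<in> snd d ` fst d" "v \<noteq> 0" for d y v
    proof -
      have "ricci (h d) y v v < \<Lambda> * bilin (h d y) v v"
        using lt that unfolding ricci_less_def by blast
      with eq[OF that(1,2), of v] show ?thesis by linarith
    qed
    then show ?thesis by blast
  qed
  then obtain \<sigma> where "\<And>d y v. d \<in> B \<Longrightarrow> y \<in> snd d ` fst d \<Longrightarrow> v \<noteq> 0 \<Longrightarrow>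
      \<sigma> * lie_derivative (\<xi> d) (h d) (\<lambda>_. v) (\<lambda>_. v) y > 0" by blast
  then interpret definite_harmonic_map A g B h \<xi> \<phi> \<sigma>
    using assms(1,2,6) sol by unfold_locales
  show ?thesis by (rule map_constant)
qed

end
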